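(* Let $F=\frac{(b\alpha+\beta)^2}{\alpha}$ be a singular square metric on a manifold $M$ of dimension $n\ge3$, where $\alpha=\sqrt{a_{ij}(x)y^iy^j}$ is a Riemannian metric, $\beta=b_i(x)y^i$ is a nowhere vanishing $1$-form and $b=\|\beta\|_\alpha$. If $F$ is a Douglas metric, then there are scalar functions $c(x),d(x)$ with $r_{ij}=c\,a_{ij}+d\,b_ib_j-\frac{3}{b^2}(s_ib_j+s_jb_i)$ and $s_{ij}=\frac1{b^2}(b_is_j-b_js_i)$ (and conversely). Assume that the ratio $c(x):d(x)$ depends only on $b$. Then $F$ is a Douglas metric if and only if it can be reduced to one of the following cases (where reducing means that the pair $(\alpha,\beta)$ may be replaced by another pair consisting of a Riemannian metric and a $1$-form, again denoted $\alpha,\beta$ with $b=\|\beta\|_\alpha$, for which the same $F$ equals $\frac{(b\alpha+\beta)^2}{\alpha}$): (i) $\alpha$ and $\beta$ can be expressed as $$\alpha=\sqrt{\bar\alpha^2+(\bar b^{-8}-\bar b^{-2})\bar\beta^2},\qquad \beta=\bar b^{-3}\bar\beta,$$ where the Riemannian metric $\bar\alpha$ and the $1$-form $\bar\beta$ satisfy, for some scalar function $\bar\tau=\bar\tau(x)$, $$\bar r_{ij}=\bar\tau\,\bar a_{ij},\qquad \bar s_{ij}=\frac1{\bar b^2}(\bar b_i\bar s_j-\bar b_j\bar s_i).$$ In this case, $\bar b=b$ and $F$ is reexpressed as $$F=\frac{\left(\sqrt{\bar b^6(\bar b^2\bar\alpha^2-\bar\beta^2)+\bar\beta^2}+\bar\beta\right)^2}{\bar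 b^2\sqrt{\bar b^6(\bar b^2\bar\alpha^2-\bar\beta^2)+\bar\beta^2}};$$ (ii) $\alpha$ and $\beta$ can be expressed as $$\alpha=\bar b^{-3}\bar\alpha,\qquad \beta=\bar b^{-3}\bar\beta,$$ where the Riemannian metric $\bar\alpha$ and the $1$-form $\bar\beta$ satisfy, for some scalar function $\bar\tau=\bar\tau(x)$, $$\bar r_{ij}=\bar\tau(\bar b^2\bar a_{ij}-\bar b_i\bar b_j),\qquad \bar s_{ij}=\frac1{\bar b^2}(\bar b_i\bar s_j-\bar b_j\bar s_i).$$ In this case, $\bar b=b$ and $F$ is reexpressed as $$F=\frac{(\bar b\bar\alpha+\bar\beta)^2}{\bar b^3\bar\alpha}.$$
   Context: For a Riemannian metric $\alpha=\sqrt{a_{ij}y^iy^j}$ and a $1$-form $\beta=b_iy^i$, let $b_{i|j}$ be the coefficients of the covariant derivative of $\beta$ with respect to $\alpha$, $(a^{ij})=(a_{ij})^{-1}$, $b^i=a^{ij}b_j$, $b^2=b^ib_i=\|\beta\|_\alpha^2$, $r_{ij}=\frac12(b_{i|j}+b_{j|i})$, $s_{ij}=\frac12(b_{i|j}-b_{j|i})$, $s_i=b^js_{ji}$. Barred quantities $\bar a_{ij},\bar b_i,\bar b,\bar r_{ij},\bar s_{ij},\bar s_i$ are the same objects formed from $\bar\alpha,\bar\beta$; in particular $\bar b=\|\bar\beta\|_{\bar\alpha}$. A singular square metric is a metric of the form $F=\frac{(b\alpha+\beta)^2}{\alpha}$; its fundamental tensor $g_{ij}=[\frac12F^2]_{y^iy^j}$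 is degenerate in the two directions determined by $b\alpha\pm\beta=0$. The spray coefficients of $F$ are $G^i=\frac14 g^{il}\{[F^2]_{x^ky^l}y^k-[F^2]_{x^l}\}$, where $(g^{ij})=(g_{ij})^{-1}$. $F$ is a Douglas metric (vanishing Douglas curvature) if in local coordinates $G^i=\frac12\Gamma^i_{jk}(x)y^jy^k+P(x,y)y^i$ for some local functions $\Gamma^i_{jk}(x)$ and some local function $P(x,y)$ positively homogeneous of degree one in $y$. *)

theory Defs
  imports "HOL-Analysis.Analysis"
begin

section \<open>Smooth maps and manifolds\<close>

text \<open>\<open>C_k_on\<close> is meant for open sets in finite-dimensional spaces.\<close>

primrec C_k_on ::
  "nat \<Rightarrow> 'a::real_normed_vector set \<Rightarrow> ('a \<Rightarrow> 'b::real_normed_vector) \<Rightarrow> bool" where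
  "C_k_on 0 S f \<longleftrightarrow> continuous_on S f"
| "C_k_on (Suc k) S f \<longleftrightarrow> (\<forall>x\<in>S. f differentiable (at x)) \<and>
     (\<forall>v. C_k_on k S (\<lambda>x. frechet_derivative f (at x) v))"

definition smooth_on ::
  "'a::real_normed_vector set \<Rightarrow> ('a \<Rightarrow> 'b::real_normed_vector) \<Rightarrow> bool" where
  "smooth_on S f \<longleftrightarrow> (\<forall>k. C_k_on k S f)"

definition pderiv_at :: "'n::finite \<Rightarrow> (real^'n \<Rightarrow> real) \<Rightarrow> real^'n \<Rightarrow> real" where
  "pderiv_at k f x = frechet_derivative f (at x) (axis k 1)"

text \<open>A chart is a pair of a domain and a coordinate map; the values of the map outside the
  domain are irrelevant.\<close>

type_synonym ('m, 'n) chart = "'m set \<times> ('m \<Rightarrow> real^'n)"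

definition region :: "('m, 'n::finite) chart \<Rightarrow> (real^'n) set" where
  "region \<kappa> = snd \<kappa> ` fst \<kappa>"

definition point_of :: "('m, 'n::finite) chart \<Rightarrow> real^'n \<Rightarrow> 'm" where
  "point_of \<kappa> = inv_into (fst \<kappa>) (snd \<kappa>)"

definition overlap :: "('m, 'n::finite) chart \<Rightarrow> ('m, 'n) chart \<Rightarrow> (real^'n) set" where
  "overlap \<kappa> \<kappa>' = snd \<kappa> ` (fst \<kappa> \<inter> fst \<kappa>')"

definition transition ::
  "('m, 'n::finite) chart \<Rightarrow> ('m, 'n) chart \<Rightarrow> real^'n \<Rightarrow> real^'n" where
  "transition \<kappa> \<kappa>' = snd \<kappa>' \<circ> point_of \<kappa>"

text \<open>The manifold is the whole type \<open>'m\<close>; its dimension is \<open>CARD('n)\<close>.  Tensor fields are given by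
  their components in the charts of the atlas, subject to the transformation law.\<close>

definition smooth_atlas :: "('m::topological_space, 'n::finite) chart set \<Rightarrow> bool" where
  "smooth_atlas A \<longleftrightarrow>
     (\<Union>\<kappa>\<in>A. fst \<kappa>) = UNIV \<and>
     (\<forall>\<kappa>\<in>A. open (fst \<kappa>) \<and> open (region \<kappa>) \<and>
        homeomorphism (fst \<kappa>) (region \<kappa>) (snd \<kappa>) (point_of \<kappa>)) \<and>
     (\<forall>\<kappa>\<in>A. \<forall>\<kappa>'\<in>A. smooth_on (overlap \<kappa> \<kappa>') (transition \<kappa> \<kappa>'))"

definition smooth_function :: "('m, 'n::finite) chart set \<Rightarrow> ('m \<Rightarrow> real) \<Rightarrow> bool" where
  "smooth_function A c \<longleftrightarrow> (\<forall>\<kappa>\<in>A. smooth_on (region \<kappa>) (c \<circ> point_of \<kappa>))"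

definition riemannian_metric ::
  "('m, 'n::finite) chart set \<Rightarrow> (('m, 'n) chart \<Rightarrow> real^'n \<Rightarrow> real^'n^'n) \<Rightarrow> bool" where
  "riemannian_metric A a \<longleftrightarrow>
     (\<forall>\<kappa>\<in>A. smooth_on (region \<kappa>) (a \<kappa>) \<and>
        (\<forall>x\<in>region \<kappa>. transpose (a \<kappa> x) = a \<kappa> x \<and> (\<forall>y. y \<noteq> 0 \<longrightarrow> y \<bullet> (a \<kappa> x *v y) > 0))) \<and>
     (\<forall>\<kappa>\<in>A. \<forall>\<kappa>'\<in>A. \<forall>x\<in>overlap \<kappa> \<kappa>'.
        let J = jacobian (transition \<kappa> \<kappa>') (at x)
        in a \<kappa> x = transpose J ** a \<kappa>' (transition \<kappa> \<kappa>' x) ** J)"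

definition one_form ::
  "('m, 'n::finite) chart set \<Rightarrow> (('m, 'n) chart \<Rightarrow> real^'n \<Rightarrow> real^'n) \<Rightarrow> bool" where
  "one_form A b \<longleftrightarrow>
     (\<forall>\<kappa>\<in>A. smooth_on (region \<kappa>) (b \<kappa>)) \<and>
     (\<forall>\<kappa>\<in>A. \<forall>\<kappa>'\<in>A. \<forall>x\<in>overlap \<kappa> \<kappa>'.
        let J = jacobian (transition \<kappa> \<kappa>') (at x)
        in b \<kappa> x = transpose J *v b \<kappa>' (transition \<kappa> \<kappa>' x))"

definition nowhere_vanishing ::
  "('m, 'n::finite) chart set \<Rightarrow> (('m, 'n) chart \<Rightarrow> real^'n \<Rightarrow> real^'n) \<Rightarrow> bool" where
  "nowhere_vanishing A b \<longleftrightarrow> (\<forall>\<kappa>\<in>A. \<forall>x\<in>region \<kappa>. b \<kappa> x \<noteq> 0)"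


section \<open>A Riemannian metric and a 1-form in one coordinate system\<close>

definition metric_norm :: "(real^'n::finite \<Rightarrow> real^'n^'n) \<Rightarrow> real^'n \<Rightarrow> real^'n \<Rightarrow> real" where
  "metric_norm a x y = sqrt (\<Sum>i\<in>UNIV. \<Sum>j\<in>UNIV. a x $ i $ j * y $ i * y $ j)"

definition form_eval :: "(real^'n::finite \<Rightarrow> real^'n) \<Rightarrow> real^'n \<Rightarrow> real^'n \<Rightarrow> real" where
  "form_eval b x y = (\<Sum>i\<in>UNIV. b x $ i * y $ i)"

definition raised ::
  "(real^'n::finite \<Rightarrow> real^'n^'n) \<Rightarrow> (real^'n \<Rightarrow> real^'n) \<Rightarrow> real^'n \<Rightarrow> real^'n" where
  "raised a b x = matrix_inv (a x) *v b x"

definition form_norm ::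
  "(real^'n::finite \<Rightarrow> real^'n^'n) \<Rightarrow> (real^'n \<Rightarrow> real^'n) \<Rightarrow> real^'n \<Rightarrow> real" where
  "form_norm a b x = sqrt (\<Sum>i\<in>UNIV. raised a b x $ i * b x $ i)"

text \<open>\<open>christoffel a x k i j\<close> has the upper index \<open>k\<close>, and \<open>cov_deriv a b x i j\<close> is
  \<open>b\<^sub>i\<^sub>|\<^sub>j\<close>: the index of differentiation comes last.\<close>

definition christoffel ::
  "(real^'n::finite \<Rightarrow> real^'n^'n) \<Rightarrow> real^'n \<Rightarrow> 'n \<Rightarrow> 'n \<Rightarrow> 'n \<Rightarrow> real" where
  "christoffel a x k i j = 1/2 * (\<Sum>l\<in>UNIV. matrix_inv (a x) $ k $ l *
     (pderiv_at i (\<lambda>u. a u $ l $ j) x + pderiv_at j (\<lambda>u. a u $ l $ i) x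
        - pderiv_at l (\<lambda>u. a u $ i $ j) x))"

definition cov_deriv ::
  "(real^'n::finite \<Rightarrow> real^'n^'n) \<Rightarrow> (real^'n \<Rightarrow> real^'n) \<Rightarrow> real^'n \<Rightarrow> 'n \<Rightarrow> 'n \<Rightarrow> real" where
  "cov_deriv a b x i j =
     pderiv_at j (\<lambda>u. b u $ i) x - (\<Sum>k\<in>UNIV. christoffel a x k i j * b x $ k)"

definition r_tensor ::
  "(real^'n::finite \<Rightarrow> real^'n^'n) \<Rightarrow> (real^'n \<Rightarrow> real^'n) \<Rightarrow> real^'n \<Rightarrow> 'n \<Rightarrow> 'n \<Rightarrow> real" where
  "r_tensor a b x i j = 1/2 * (cov_deriv a b x i j + cov_deriv a b x j i)"

definition s_tensor ::
  "(real^'n::finite \<Rightarrow> real^'n^'n) \<Rightarrow> (real^'n \<Rightarrow> real^'n) \<Rightarrow> real^'n \<Rightarrow> 'n \<Rightarrow> 'n \<Rightarrow> real" where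
  "s_tensor a b x i j = 1/2 * (cov_deriv a b x i j - cov_deriv a b x j i)"

definition s_form ::
  "(real^'n::finite \<Rightarrow> real^'n^'n) \<Rightarrow> (real^'n \<Rightarrow> real^'n) \<Rightarrow> real^'n \<Rightarrow> 'n \<Rightarrow> real" where
  "s_form a b x i = (\<Sum>j\<in>UNIV. raised a b x $ j * s_tensor a b x j i)"


section \<open>Sprays and Douglas metrics\<close>

definition fundamental_tensor ::
  "(real^'n::finite \<Rightarrow> real^'n \<Rightarrow> real) \<Rightarrow> real^'n \<Rightarrow> real^'n \<Rightarrow> real^'n^'n" where
  "fundamental_tensor F x y =
     (\<chi> i j. pderiv_at j (\<lambda>v. pderiv_at i (\<lambda>w. 1/2 * (F x w)\<^sup>2) v) y)"

definition spray ::
  "(real^'n::finite \<Rightarrow> real^'n \<Rightarrow> real) \<Rightarrow> real^'n \<Rightarrow> real^'n \<Rightarrow> real^'n" where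
  "spray F x y = (\<chi> i. 1/4 * (\<Sum>l\<in>UNIV. matrix_inv (fundamental_tensor F x y) $ i $ l *
     ((\<Sum>k\<in>UNIV. pderiv_at l (\<lambda>v. pderiv_at k (\<lambda>u. (F u v)\<^sup>2) x) y * y $ k)
        - pderiv_at l (\<lambda>u. (F u y)\<^sup>2) x)))"

text \<open>The spray coefficients only make sense where the fundamental tensor is invertible.  For a
  singular square metric this excludes the two directions \<open>b\<alpha> \<plusminus> \<beta> = 0\<close>.\<close>

definition regular_directions ::
  "(real^'n::finite \<Rightarrow> real^'n \<Rightarrow> real) \<Rightarrow> real^'n \<Rightarrow> (real^'n) set" where
  "regular_directions F x = {y. y \<noteq> 0 \<and> invertible (fundamental_tensor F x y)}"

definition douglas_on ::
  "(real^'n::finite) set \<Rightarrow> (real^'n \<Rightarrow> real^'n \<Rightarrow> real) \<Rightarrow> bool" where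
  "douglas_on V F \<longleftrightarrow>
     (\<exists>(\<Gamma> :: 'n \<Rightarrow> 'n \<Rightarrow> 'n \<Rightarrow> real^'n \<Rightarrow> real) (P :: real^'n \<Rightarrow> real^'n \<Rightarrow> real).
        (\<forall>i j k. smooth_on V (\<Gamma> i j k)) \<and>
        (\<forall>x\<in>V. \<forall>y\<in>regular_directions F x. \<forall>t>0. P x (t *\<^sub>R y) = t * P x y) \<and>
        (\<forall>x\<in>V. \<forall>y\<in>regular_directions F x. \<forall>i.
           spray F x y $ i =
             1/2 * (\<Sum>j\<in>UNIV. \<Sum>k\<in>UNIV. \<Gamma> i j k x * y $ j * y $ k) + P x y * y $ i))"

definition douglas_metric ::
  "('m, 'n::finite) chart set \<Rightarrow> (('m, 'n) chart \<Rightarrow> real^'n \<Rightarrow> real^'n \<Rightarrow> real) \<Rightarrow> bool" where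
  "douglas_metric A F \<longleftrightarrow> (\<forall>\<kappa>\<in>A. douglas_on (region \<kappa>) (F \<kappa>))"


section \<open>Singular square metrics\<close>

text \<open>\<open>F\<close> is given by its expressions in the charts; only its values at nonzero tangent vectors
  matter.\<close>

definition singular_square_metric ::
  "('m, 'n::finite) chart set \<Rightarrow> (('m, 'n) chart \<Rightarrow> real^'n \<Rightarrow> real^'n^'n) \<Rightarrow>
   (('m, 'n) chart \<Rightarrow> real^'n \<Rightarrow> real^'n) \<Rightarrow>
   (('m, 'n) chart \<Rightarrow> real^'n \<Rightarrow> real^'n \<Rightarrow> real) \<Rightarrow> bool" where
  "singular_square_metric A a b F \<longleftrightarrow>
     riemannian_metric A a \<and> one_form A b \<and>
     (\<forall>\<kappa>\<in>A. \<forall>x\<in>region \<kappa>. \<forall>y. y \<noteq> 0 \<longrightarrow>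
        F \<kappa> x y =
          (form_norm (a \<kappa>) (b \<kappa>) x * metric_norm (a \<kappa>) x y + form_eval (b \<kappa>) x y)\<^sup>2
            / metric_norm (a \<kappa>) x y)"

definition s_condition ::
  "('m, 'n::finite) chart set \<Rightarrow> (('m, 'n) chart \<Rightarrow> real^'n \<Rightarrow> real^'n^'n) \<Rightarrow>
   (('m, 'n) chart \<Rightarrow> real^'n \<Rightarrow> real^'n) \<Rightarrow> bool" where
  "s_condition A a b \<longleftrightarrow>
     (\<forall>\<kappa>\<in>A. \<forall>x\<in>region \<kappa>. \<forall>i j.
        s_tensor (a \<kappa>) (b \<kappa>) x i j =
          1 / (form_norm (a \<kappa>) (b \<kappa>) x)\<^sup>2 *
            (b \<kappa> x $ i * s_form (a \<kappa>) (b \<kappa>) x j - b \<kappa> x $ j * s_form (a \<kappa>) (b \<kappa>) x i))"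

definition douglas_equations ::
  "('m, 'n::finite) chart set \<Rightarrow> (('m, 'n) chart \<Rightarrow> real^'n \<Rightarrow> real^'n^'n) \<Rightarrow>
   (('m, 'n) chart \<Rightarrow> real^'n \<Rightarrow> real^'n) \<Rightarrow> ('m \<Rightarrow> real) \<Rightarrow> ('m \<Rightarrow> real) \<Rightarrow> bool" where
  "douglas_equations A a b c d \<longleftrightarrow>
     (\<forall>\<kappa>\<in>A. \<forall>x\<in>region \<kappa>. \<forall>i j.
        r_tensor (a \<kappa>) (b \<kappa>) x i j =
          c (point_of \<kappa> x) * a \<kappa> x $ i $ j + d (point_of \<kappa> x) * b \<kappa> x $ i * b \<kappa> x $ j
          - 3 / (form_norm (a \<kappa>) (b \<kappa>) x)\<^sup>2 *
              (s_form (a \<kappa>) (b \<kappa>) x i * b \<kappa> x $ j + s_form (a \<kappa>) (b \<kappa>) x j * b \<kappa> x $ i)) \<and>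
     s_condition A a b"

text \<open>The ratio \<open>c : d\<close> is taken projectively, so that \<open>d\<close> may vanish: it equals
  \<open>f(b) : g(b)\<close>, where \<open>f\<close> and \<open>g\<close> have no common zero.  A point where \<open>c = d = 0\<close> imposes no
  condition.\<close>

definition ratio_depends_on_norm ::
  "('m, 'n::finite) chart set \<Rightarrow> (('m, 'n) chart \<Rightarrow> real^'n \<Rightarrow> real^'n^'n) \<Rightarrow>
   (('m, 'n) chart \<Rightarrow> real^'n \<Rightarrow> real^'n) \<Rightarrow> ('m \<Rightarrow> real) \<Rightarrow> ('m \<Rightarrow> real) \<Rightarrow> bool" where
  "ratio_depends_on_norm A a b c d \<longleftrightarrow>
     (\<exists>f g :: real \<Rightarrow> real. (\<forall>t. f t \<noteq> 0 \<or> g t \<noteq> 0) \<and>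
        (\<forall>\<kappa>\<in>A. \<forall>x\<in>region \<kappa>.
           c (point_of \<kappa> x) * g (form_norm (a \<kappa>) (b \<kappa>) x) =
           d (point_of \<kappa> x) * f (form_norm (a \<kappa>) (b \<kappa>) x)))"

text \<open>In the two cases below \<open>(a, b)\<close> stands for \<open>(\<alpha>, \<beta>)\<close>, and \<open>(a', b')\<close> for the barred
  pair.\<close>

definition case_i ::
  "('m, 'n::finite) chart set \<Rightarrow> (('m, 'n) chart \<Rightarrow> real^'n \<Rightarrow> real^'n^'n) \<Rightarrow>
   (('m, 'n) chart \<Rightarrow> real^'n \<Rightarrow> real^'n) \<Rightarrow> (('m, 'n) chart \<Rightarrow> real^'n \<Rightarrow> real^'n^'n) \<Rightarrow>
   (('m, 'n) chart \<Rightarrow> real^'n \<Rightarrow> real^'n) \<Rightarrow> bool" where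
  "case_i A a b a' b' \<longleftrightarrow>
     riemannian_metric A a' \<and> one_form A b' \<and> nowhere_vanishing A b' \<and>
     (\<forall>\<kappa>\<in>A. \<forall>x\<in>region \<kappa>. \<forall>y.
        metric_norm (a \<kappa>) x y =
          sqrt ((metric_norm (a' \<kappa>) x y)\<^sup>2 +
            (form_norm (a' \<kappa>) (b' \<kappa>) x powi (-8) - form_norm (a' \<kappa>) (b' \<kappa>) x powi (-2)) *
              (form_eval (b' \<kappa>) x y)\<^sup>2) \<and>
        form_eval (b \<kappa>) x y = form_norm (a' \<kappa>) (b' \<kappa>) x powi (-3) * form_eval (b' \<kappa>) x y) \<and>
     (\<exists>\<tau>. smooth_function A \<tau> \<and>
        (\<forall>\<kappa>\<in>A. \<forall>x\<in>region \<kappa>. \<forall>i j.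
           r_tensor (a' \<kappa>) (b' \<kappa>) x i j = \<tau> (point_of \<kappa> x) * a' \<kappa> x $ i $ j)) \<and>
     s_condition A a' b'"

definition case_ii ::
  "('m, 'n::finite) chart set \<Rightarrow> (('m, 'n) chart \<Rightarrow> real^'n \<Rightarrow> real^'n^'n) \<Rightarrow>
   (('m, 'n) chart \<Rightarrow> real^'n \<Rightarrow> real^'n) \<Rightarrow> (('m, 'n) chart \<Rightarrow> real^'n \<Rightarrow> real^'n^'n) \<Rightarrow>
   (('m, 'n) chart \<Rightarrow> real^'n \<Rightarrow> real^'n) \<Rightarrow> bool" where
  "case_ii A a b a' b' \<longleftrightarrow>
     riemannian_metric A a' \<and> one_form A b' \<and> nowhere_vanishing A b' \<and>
     (\<forall>\<kappa>\<in>A. \<forall>x\<in>region \<kappa>. \<forall>y.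
        metric_norm (a \<kappa>) x y = form_norm (a' \<kappa>) (b' \<kappa>) x powi (-3) * metric_norm (a' \<kappa>) x y \<and>
        form_eval (b \<kappa>) x y = form_norm (a' \<kappa>) (b' \<kappa>) x powi (-3) * form_eval (b' \<kappa>) x y) \<and>
     (\<exists>\<tau>. smooth_function A \<tau> \<and>
        (\<forall>\<kappa>\<in>A. \<forall>x\<in>region \<kappa>. \<forall>i j.
           r_tensor (a' \<kappa>) (b' \<kappa>) x i j =
             \<tau> (point_of \<kappa> x) *
               ((form_norm (a' \<kappa>) (b' \<kappa>) x)\<^sup>2 * a' \<kappa> x $ i $ j - b' \<kappa> x $ i * b' \<kappa> x $ j))) \<and>
     s_condition A a' b'"

end

theory Submission
  imports Defs
begin

text \<open>The pairs \<open>(\<alpha>, \<beta>)\<close> and \<open>(k\<^sup>2 \<alpha>, k \<beta>)\<close> define the same \<open>F\<close>, so one may normalise \<open>b = 1\<close>.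
  Writing the spray as that of \<open>\<alpha>\<close> plus \<open>T(y, y) / 2 + P y\<close>, the Douglas condition becomes an
  equation between \<open>T\<close>, \<open>P\<close>, \<open>r\<^sub>i\<^sub>j\<close> and \<open>s\<^sub>i\<^sub>j\<close>.  Its component orthogonal to \<open>y\<close> and \<open>b\<close>, compared at
  \<open>y\<close> and \<open>-y\<close>, gives \<open>s = 0\<close>; the remaining components, along \<open>y = u + t b\<close> with \<open>u\<close> orthogonal to
  \<open>b\<close>, form a polynomial identity in \<open>t\<close> which forces \<open>r\<^sub>i\<^sub>j = c (a\<^sub>i\<^sub>j - b\<^sub>i b\<^sub>j)\<close>.  Conversely these two
  equations give an explicit spray of Douglas type.  They are exactly case (ii) with
  \<open>\<alpha>' = \<alpha>\<close> and \<open>\<beta>' = \<beta>\<close>, and a single transformation rule for \<open>r\<close> and \<open>s\<close> under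
  \<open>a \<mapsto> p a + q b b\<close>, \<open>b \<mapsto> u b\<close> translates them into the equations of an arbitrary pair and
  derives them from both cases.\<close>

section \<open>Smooth functions\<close>

text \<open>The gauge uses \<open>k = b\<close>: the norm of the 1-form becomes
  \<open>b / k = 1\<close>. The gain is that \<open>b^2\<close> is then constant, so that
  \<open>r(B, v) + s(B, v) = 0\<close> with \<open>B\<close> the raised form, and that of the two
  functions \<open>c\<close>, \<open>d\<close> only the combination
  \<open>(3 c + 2 d b^2) / b^3\<close> remains; the rest is the derivative of \<open>b^2\<close>
  along \<open>B\<close>, which the gauge removes. The obstacle to necessity is \<open>P\<close>, an
  unknown function of the direction whose values at \<open>y\<close> and \<open>-y\<close> are
  unrelated. It has to be eliminated before directions can be compared: a test vector orthogonal to
  \<open>y\<close> and \<open>b\<close> annihilates it, which takes three dimensions, and in the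
  plane of \<open>u\<close> and \<open>b\<close> the equations for the two test vectors
  \<open>u\<close> and \<open>B\<close> eliminate it together. All this happens at one point and
  yields a number \<open>c\<close> there. That these numbers form a smooth function on the manifold
  is a separate matter: smoothness comes from a quotient of traces, agreement between charts from
  the tensor property of \<open>r\<close>, which rests on the symmetry of the second derivatives of
  transition maps.\<close>

lemma C_k_on_cong:
  assumes "open S" and "\<And>x. x \<in> S \<Longrightarrow> f x = g x" and "C_k_on k S f"
  shows "C_k_on k S g"
  using assms(2,3)
proof (induction k arbitrary: f g)
  case 0
  then show ?case by (simp cong: continuous_on_cong)
next
  case (Suc k)
  have d: "(g has_derivative frechet_derivative f (at x)) (at x)" if "x \<in> S" for x
  proof -
    have "(f has_derivative frechet_derivative f (at x)) (at x)"
      using Suc.prems(2) that by (simp add: frechet_derivative_works[symmetric])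
    then show ?thesis
      using has_derivative_transform_within_open[OF _ \<open>open S\<close> that] Suc.prems(1) by blast
  qed
  have eq: "frechet_derivative f (at x) = frechet_derivative g (at x)" if "x \<in> S" for x
    using frechet_derivative_at[OF d[OF that]] .
  have "C_k_on k S (\<lambda>x. frechet_derivative g (at x) v)" for v
    using Suc.IH[of "\<lambda>x. frechet_derivative f (at x) v" "\<lambda>x. frechet_derivative g (at x) v"]
      eq Suc.prems(2) by simp
  moreover have "\<forall>x\<in>S. g differentiable (at x)"
    using d differentiable_def by blast
  ultimately show ?case by simp
qed

text \<open>By uniqueness of derivatives an explicit candidate \<open>f'\<close> agrees with
  \<open>frechet_derivative\<close> on the open set, so the latter never has to be computed.\<close>

lemma C_k_on_SucI:
  assumes "open S" and "\<And>x. x \<in> S \<Longrightarrow> (f has_derivative f' x) (at x)"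
    and "\<And>v. C_k_on k S (\<lambda>x. f' x v)"
  shows "C_k_on (Suc k) S f"
proof -
  have "C_k_on k S (\<lambda>x. frechet_derivative f (at x) v)" for v
    by (rule C_k_on_cong[OF assms(1) _ assms(3)[of v]]) (simp add: frechet_derivative_at[OF assms(2)])
  then show ?thesis
    using assms(2) by (auto simp: differentiable_def)
qed

lemma C_k_on_has_derivative:
  assumes "C_k_on (Suc k) S f" and "x \<in> S"
  shows "(f has_derivative frechet_derivative f (at x)) (at x)"
  using assms by (simp add: frechet_derivative_works[symmetric])

lemma C_k_on_SucD: "C_k_on (Suc k) S f \<Longrightarrow> C_k_on k S f"
proof (induction k arbitrary: f)
  case 0
  then show ?case
    by (simp add: continuous_on_eq_continuous_within differentiable_imp_continuous_within
        continuous_at_imp_continuous_at_within)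
next
  case (Suc k)
  then show ?case by (metis C_k_on.simps(2))
qed

lemma C_k_on_const: "open S \<Longrightarrow> C_k_on k S (\<lambda>x. c)"
  by (induction k arbitrary: c) (auto intro!: C_k_on_SucI[where f'="\<lambda>x v. 0"])

lemma C_k_on_linear:
  assumes "bounded_linear h" "open S" "C_k_on k S f"
  shows "C_k_on k S (\<lambda>x. h (f x))"
  using assms(3)
proof (induction k arbitrary: f)
  case 0
  then show ?case
    using bounded_linear.continuous_on[OF assms(1)] by simp
next
  case (Suc k)
  show ?case
  proof (rule C_k_on_SucI[OF assms(2)])
    show "((\<lambda>x. h (f x)) has_derivative (\<lambda>v. h (frechet_derivative f (at x) v))) (at x)"
      if "x \<in> S" for x
      using bounded_linear.has_derivative[OF assms(1) C_k_on_has_derivative[OF Suc.prems that]] .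
  qed (use Suc in simp)
qed

lemma C_k_on_add:
  assumes "open S" "C_k_on k S f" "C_k_on k S g"
  shows "C_k_on k S (\<lambda>x. f x + g x)"
  using assms(2,3)
proof (induction k arbitrary: f g)
  case 0
  then show ?case by (simp add: continuous_on_add)
next
  case (Suc k)
  show ?case
    by (rule C_k_on_SucI[OF assms(1) has_derivative_add])
      (use Suc in \<open>auto intro: C_k_on_has_derivative\<close>)
qed

lemma C_k_on_bilinear:
  assumes "bounded_bilinear h" "open S" "C_k_on k S f" "C_k_on k S g"
  shows "C_k_on k S (\<lambda>x. h (f x) (g x))"
  using assms(3,4)
proof (induction k arbitrary: f g)
  case 0
  then show ?case
    using bounded_bilinear.continuous_on[OF assms(1)] by simp
next
  case (Suc k)
  show ?case
  proof (rule C_k_on_SucI[OF assms(2)])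
    show "((\<lambda>x. h (f x) (g x)) has_derivative
       (\<lambda>v. h (f x) (frechet_derivative g (at x) v) + h (frechet_derivative f (at x) v) (g x))) (at x)"
      if "x \<in> S" for x
      by (intro bounded_bilinear.FDERIV[OF assms(1)] C_k_on_has_derivative[OF Suc.prems(1) that]
          C_k_on_has_derivative[OF Suc.prems(2) that])
    show "C_k_on k S (\<lambda>x. h (f x) (frechet_derivative g (at x) v)
        + h (frechet_derivative f (at x) v) (g x))" for v
      using Suc.IH[OF C_k_on_SucD[OF Suc.prems(1)]] Suc.IH[OF _ C_k_on_SucD[OF Suc.prems(2)]] Suc.prems
      by (intro C_k_on_add assms(2)) simp_all
  qed
qed

text \<open>For a real outer function the derivative is multiplication by a number, so the chain
  rule yields a product of two functions to which \<open>C_k_on_bilinear\<close> and the induction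
  hypothesis apply.\<close>

lemma C_k_on_compose_real:
  fixes \<phi> :: "real \<Rightarrow> real"
  assumes "open S" "open T" "\<And>x. x \<in> S \<Longrightarrow> f x \<in> T" "C_k_on k S f" "C_k_on k T \<phi>"
  shows "C_k_on k S (\<lambda>x. \<phi> (f x))"
  using assms(3-5)
proof (induction k arbitrary: f \<phi>)
  case 0
  then show ?case
    by (auto intro: continuous_on_compose2)
next
  case (Suc k)
  show ?case
  proof (rule C_k_on_SucI[OF assms(1)])
    fix x assume x: "x \<in> S"
    have d: "(\<phi> has_derivative frechet_derivative \<phi> (at (f x))) (at (f x))"
      using Suc.prems x C_k_on_has_derivative by blast
    have "(\<phi> \<circ> f has_derivative frechet_derivative \<phi> (at (f x)) \<circ> frechet_derivative f (at x)) (at x)"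
      using d Suc.prems x by (intro diff_chain_at) (auto intro: C_k_on_has_derivative)
    moreover have "frechet_derivative \<phi> (at (f x)) w = w * frechet_derivative \<phi> (at (f x)) 1" for w
      using linear_scale[OF has_derivative_linear[OF d], of w 1] by simp
    then have "frechet_derivative \<phi> (at (f x)) \<circ> frechet_derivative f (at x)
        = (\<lambda>v. frechet_derivative f (at x) v * frechet_derivative \<phi> (at (f x)) 1)"
      unfolding o_def by blast
    ultimately show "((\<lambda>x. \<phi> (f x)) has_derivative
        (\<lambda>v. frechet_derivative f (at x) v * frechet_derivative \<phi> (at (f x)) 1)) (at x)"
      by (simp add: o_def)
  next
    fix v
    show "C_k_on k S (\<lambda>x. frechet_derivative f (at x) v * frechet_derivative \<phi> (at (f x)) 1)"
      using Suc.IH[OF Suc.prems(1) C_k_on_SucD[OF Suc.prems(2)], of "\<lambda>y. frechet_derivative \<phi> (at y) 1"]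
        Suc.prems(2,3) by (intro C_k_on_bilinear[OF bounded_bilinear_mult] assms) simp_all
  qed
qed

text \<open>The derivative is a polynomial in \<open>inverse\<close> itself, so the induction
  closes. For \<open>sqrt\<close> below it closes in the same way, through the inverse of
  \<open>sqrt\<close>.\<close>

lemma C_k_on_inverse: "C_k_on k {t::real. t \<noteq> 0} inverse"
proof (induction k)
  case 0
  then show ?case by (auto intro!: continuous_intros)
next
  case (Suc k)
  have o: "open {t::real. t \<noteq> 0}" by (simp add: open_delete Collect_neg_eq open_Compl)
  show ?case
  proof (rule C_k_on_SucI[OF o])
    show "(inverse has_derivative (\<lambda>v. - (inverse x * v * inverse x))) (at x)"
      if "x \<in> {t. t \<noteq> 0}" for x :: real
      using that by (simp add: has_derivative_inverse')
    show "C_k_on k {t. t \<noteq> 0} (\<lambda>x::real. - (inverse x * v * inverse x))" for v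
      by (intro C_k_on_linear[OF bounded_linear_minus[OF bounded_linear_ident]]
          C_k_on_bilinear[OF bounded_bilinear_mult] C_k_on_const Suc o)
  qed
qed

lemma C_k_on_sqrt: "C_k_on k {0<..} sqrt"
proof (induction k)
  case 0
  then show ?case by (auto intro!: continuous_intros)
next
  case (Suc k)
  show ?case
  proof (rule C_k_on_SucI)
    show "(sqrt has_derivative (\<lambda>v. v * (inverse (sqrt x) * (1/2)))) (at x)"
      if "x \<in> {0<..}" for x :: real
    proof -
      have "(*) (inverse (sqrt x) / 2) = (\<lambda>v. v * (inverse (sqrt x) * (1/2)))"
        by (rule ext) simp
      then show ?thesis
        using that DERIV_real_sqrt[of x] unfolding has_field_derivative_def by auto
    qed
    show "C_k_on k {0<..} (\<lambda>x::real. v * (inverse (sqrt x) * (1/2)))" for v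
      by (intro C_k_on_bilinear[OF bounded_bilinear_mult] C_k_on_const
          C_k_on_compose_real[OF _ _ _ _ C_k_on_inverse] Suc)
        (auto simp: open_delete Collect_neg_eq open_Compl)
  qed simp
qed

lemma smooth_on_cong:
  "open S \<Longrightarrow> (\<And>x. x \<in> S \<Longrightarrow> f x = g x) \<Longrightarrow> smooth_on S f \<Longrightarrow> smooth_on S g"
  unfolding smooth_on_def using C_k_on_cong by blast

lemma smooth_on_const: "open S \<Longrightarrow> smooth_on S (\<lambda>x. c)"
  by (simp add: smooth_on_def C_k_on_const)

lemma smooth_on_linear:
  "bounded_linear h \<Longrightarrow> open S \<Longrightarrow> smooth_on S f \<Longrightarrow> smooth_on S (\<lambda>x. h (f x))"
  by (simp add: smooth_on_def C_k_on_linear)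

lemma smooth_on_add:
  "open S \<Longrightarrow> smooth_on S f \<Longrightarrow> smooth_on S g \<Longrightarrow> smooth_on S (\<lambda>x. f x + g x)"
  by (simp add: smooth_on_def C_k_on_add)

lemma smooth_on_bilinear:
  "bounded_bilinear h \<Longrightarrow> open S \<Longrightarrow> smooth_on S f \<Longrightarrow> smooth_on S g \<Longrightarrow> smooth_on S (\<lambda>x. h (f x) (g x))"
  by (simp add: smooth_on_def C_k_on_bilinear)

lemma smooth_on_minus: "open S \<Longrightarrow> smooth_on S f \<Longrightarrow> smooth_on S (\<lambda>x. - f x)"
  by (rule smooth_on_linear[OF bounded_linear_minus[OF bounded_linear_ident]])

lemma smooth_on_diff:
  "open S \<Longrightarrow> smooth_on S f \<Longrightarrow> smooth_on S g \<Longrightarrow> smooth_on S (\<lambda>x. f x - g x)"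
  using smooth_on_add[of S f "\<lambda>x. - g x"] smooth_on_minus by auto

lemmas smooth_on_mult = smooth_on_bilinear[OF bounded_bilinear_mult]
lemmas smooth_on_scaleR = smooth_on_bilinear[OF bounded_bilinear_scaleR]
lemmas smooth_on_inner = smooth_on_bilinear[OF bounded_bilinear_inner]
lemmas smooth_on_vec_nth = smooth_on_linear[OF bounded_linear_vec_nth]

lemma smooth_on_inverse:
  fixes f :: "'a::real_normed_vector \<Rightarrow> real"
  assumes "open S" "smooth_on S f" "\<And>x. x \<in> S \<Longrightarrow> f x \<noteq> 0"
  shows "smooth_on S (\<lambda>x. inverse (f x))"
proof -
  have "open {t::real. t \<noteq> 0}" by (simp add: open_delete Collect_neg_eq open_Compl)
  with assms show ?thesis
    unfolding smooth_on_def by (auto intro: C_k_on_compose_real[OF _ _ _ _ C_k_on_inverse])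
qed

lemma smooth_on_divide:
  fixes f g :: "'a::real_normed_vector \<Rightarrow> real"
  assumes "open S" "smooth_on S f" "smooth_on S g" "\<And>x. x \<in> S \<Longrightarrow> g x \<noteq> 0"
  shows "smooth_on S (\<lambda>x. f x / g x)"
  unfolding divide_inverse using assms by (intro smooth_on_mult smooth_on_inverse)

lemma smooth_on_sqrt:
  assumes "open S" "smooth_on S f" "\<And>x. x \<in> S \<Longrightarrow> f x > 0"
  shows "smooth_on S (\<lambda>x. sqrt (f x))"
  using assms unfolding smooth_on_def by (auto intro: C_k_on_compose_real[OF _ _ _ _ C_k_on_sqrt])

lemma smooth_on_sum:
  assumes "open S" "\<And>i. i \<in> I \<Longrightarrow> smooth_on S (f i)"
  shows "smooth_on S (\<lambda>x. \<Sum>i\<in>I. f i x)"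
  using assms(2) by (induction I rule: infinite_finite_induct)
    (auto intro: smooth_on_const smooth_on_add assms(1))

lemma smooth_on_prod:
  fixes f :: "'i \<Rightarrow> 'a::real_normed_vector \<Rightarrow> real"
  assumes "open S" "\<And>i. i \<in> I \<Longrightarrow> smooth_on S (f i)"
  shows "smooth_on S (\<lambda>x. \<Prod>i\<in>I. f i x)"
  using assms(2) by (induction I rule: infinite_finite_induct)
    (auto intro: smooth_on_const smooth_on_mult assms(1))

lemma smooth_on_vecI:
  fixes f :: "'a::real_normed_vector \<Rightarrow> real^'n"
  assumes "open S" "\<And>i. smooth_on S (\<lambda>x. f x $ i)"
  shows "smooth_on S f"
proof -
  have "smooth_on S (\<lambda>x. \<Sum>i\<in>UNIV. f x $ i *\<^sub>R axis i (1::real))"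
    by (intro smooth_on_sum smooth_on_scaleR smooth_on_const assms)
  moreover have "(\<Sum>i\<in>UNIV. f x $ i *\<^sub>R axis i (1::real)) = f x" for x
    by (simp add: vec_eq_iff axis_def if_distrib cong: if_cong)
  ultimately show ?thesis by simp
qed

lemma smooth_on_has_derivative:
  "smooth_on S f \<Longrightarrow> x \<in> S \<Longrightarrow> (f has_derivative frechet_derivative f (at x)) (at x)"
  unfolding smooth_on_def using C_k_on_has_derivative by blast

lemma smooth_on_frechet: "smooth_on S f \<Longrightarrow> smooth_on S (\<lambda>x. frechet_derivative f (at x) v)"
  unfolding smooth_on_def by (metis C_k_on.simps(2))

lemma smooth_on_pderiv_at: "smooth_on S f \<Longrightarrow> smooth_on S (pderiv_at k f)"
  unfolding pderiv_at_def[abs_def] by (rule smooth_on_frechet)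

section \<open>Smooth dependence of determinants and inverse matrices on a parameter\<close>

lemma smooth_on_det:
  fixes M :: "'a::real_normed_vector \<Rightarrow> real^'n::finite^'n"
  assumes "open S" "\<And>i j. smooth_on S (\<lambda>x. M x $ i $ j)"
  shows "smooth_on S (\<lambda>x. det (M x))"
  unfolding det_def
  by (intro smooth_on_sum smooth_on_mult smooth_on_prod smooth_on_const assms)

lemma matrix_inv_right_left:
  fixes M :: "real^'n::finite^'n"
  assumes "invertible M"
  shows "M ** matrix_inv M = mat 1" "matrix_inv M ** M = mat 1"
  using someI_ex[OF assms[unfolded invertible_def]] by (simp_all add: matrix_inv_def)

text \<open>Cramer's rule for \<open>M z = axis l 1\<close>: the entry is a quotient of
  determinants, where \<open>C\<close> is \<open>M\<close> with column \<open>k\<close> replaced by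
  \<open>axis l 1\<close>.\<close>

lemma smooth_on_matrix_inv:
  fixes M :: "'a::real_normed_vector \<Rightarrow> real^'n::finite^'n"
  assumes S: "open S" and sm: "\<And>i j. smooth_on S (\<lambda>x. M x $ i $ j)"
    and inv: "\<And>x. x \<in> S \<Longrightarrow> invertible (M x)"
  shows "smooth_on S (\<lambda>x. matrix_inv (M x) $ k $ l)"
proof -
  define C where "C x = (\<chi> i j. if j = k then (axis l 1 :: real^'n) $ i else M x $ i $ j)" for x
  have "smooth_on S (\<lambda>x. C x $ i $ j)" for i j
    using sm S by (cases "j = k") (auto simp: C_def intro: smooth_on_const)
  then have "smooth_on S (\<lambda>x. det (C x) / det (M x))"
    using inv by (intro smooth_on_divide smooth_on_det S sm) (auto simp: invertible_det_nz)
  moreover have "det (C x) / det (M x) = matrix_inv (M x) $ k $ l" if "x \<in> S" for x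
  proof -
    have "M x *v (matrix_inv (M x) *v axis l 1) = axis l 1"
      using matrix_inv_right_left(1)[OF inv[OF that]] by (simp add: matrix_vector_mul_assoc)
    then have "(matrix_inv (M x) *v axis l 1) $ k = det (C x) / det (M x)"
      using cramer[of "M x" "matrix_inv (M x) *v axis l 1" "axis l 1"] inv[OF that]
      unfolding C_def by (simp add: invertible_det_nz)
    then show ?thesis
      by (simp add: matrix_vector_mult_basis column_def)
  qed
  ultimately show ?thesis by (rule smooth_on_cong[OF S, rotated])
qed

text \<open>The second difference of \<open>f\<close> on the parallelogram spanned by \<open>t u\<close> and \<open>t v\<close> is symmetric in
  \<open>u\<close> and \<open>v\<close>, and equals \<open>t\<^sup>2\<close> times the mixed derivative up to \<open>o(t\<^sup>2)\<close>.\<close>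

lemma second_difference_limit:
  fixes f :: "'a::real_normed_vector \<Rightarrow> real"
  assumes S: "open S" and x: "x \<in> S"
    and df: "\<And>z. z \<in> S \<Longrightarrow> (f has_derivative f' z) (at z)"
    and d2: "((\<lambda>z. f' z u) has_derivative h) (at x)"
  shows "((\<lambda>t. (f (x + t *\<^sub>R u + t *\<^sub>R v) - f (x + t *\<^sub>R u) - f (x + t *\<^sub>R v) + f x) / t\<^sup>2)
           \<longlongrightarrow> h v) (at_right 0)"
proof -
  obtain r where r: "r > 0" "ball x r \<subseteq> S"
    using S x openE by blast
  define K where "K = norm u + norm v + 1"
  have K: "K > 0" by (simp add: K_def add_nonneg_pos)
  have h: "linear h" using d2 has_derivative_linear by blast
  show ?thesis
  proof (rule tendstoI)
    fix e :: real assume e: "e > 0"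
    \<comment> \<open>The errors at \<open>c = 0\<close> and \<open>c = 1\<close> are each at most
      \<open>e' * (t * K)\<close>, together \<open>t * (e / 2)\<close>.\<close>
    define e' where "e' = e / (4 * K)"
    have e': "e' > 0" using e K by (simp add: e'_def)
    obtain d where d: "d > 0"
      "\<And>z. norm (z - x) < d \<Longrightarrow> norm (f' z u - f' x u - h (z - x)) \<le> e' * norm (z - x)"
      using d2 e' unfolding has_derivative_at_alt by meson
    define m where "m = min r d / K"
    have m: "m > 0" using r d K by (simp add: m_def)
    have bound: "norm ((f (x + t *\<^sub>R u + t *\<^sub>R v) - f (x + t *\<^sub>R u) - f (x + t *\<^sub>R v) + f x) / t\<^sup>2 - h v) < e"
      if t: "0 < t" "t < m" for t
    proof -
      have small: "norm (s *\<^sub>R (t *\<^sub>R u) + c *\<^sub>R (t *\<^sub>R v)) < min r d \<and>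
          norm (s *\<^sub>R (t *\<^sub>R u) + c *\<^sub>R (t *\<^sub>R v)) \<le> t * K"
        if "0 \<le> s" "s \<le> 1" "0 \<le> c" "c \<le> 1" for s c :: real
      proof -
        have "norm (s *\<^sub>R (t *\<^sub>R u) + c *\<^sub>R (t *\<^sub>R v)) \<le> s * (t * norm u) + c * (t * norm v)"
          using that t by (intro order_trans[OF norm_triangle_ineq]) simp
        also have "\<dots> \<le> 1 * (t * norm u) + 1 * (t * norm v)"
          using that t by (intro add_mono mult_right_mono) auto
        also have "\<dots> \<le> t * K" using t by (simp add: K_def algebra_simps)
        finally have "norm (s *\<^sub>R (t *\<^sub>R u) + c *\<^sub>R (t *\<^sub>R v)) \<le> t * K" .
        moreover have "t * K < min r d"
          using t K by (simp add: m_def pos_less_divide_eq)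
        ultimately show ?thesis by linarith
      qed
      define p where "p s c = x + s *\<^sub>R (t *\<^sub>R u) + c *\<^sub>R (t *\<^sub>R v)" for s c :: real
      have pS: "p s c \<in> S" if "0 \<le> s" "s \<le> 1" "0 \<le> c" "c \<le> 1" for s c
      proof -
        have "dist x (p s c) = norm (s *\<^sub>R (t *\<^sub>R u) + c *\<^sub>R (t *\<^sub>R v))"
          unfolding p_def dist_norm norm_minus_commute[of x] by (simp add: add.assoc)
        then show ?thesis using small[OF that] r by auto
      qed
      \<comment> \<open>The mean value theorem along \<open>u\<close>, applied to the difference
        across \<open>v\<close>, reduces the second difference to first derivatives at two points.
        Only differentiability of \<open>f' z u\<close> at the single point \<open>x\<close> is then
        needed.\<close>
      define \<phi> where "\<phi> s = f (p s 1) - f (p s 0)" for s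
      have "(\<phi> has_derivative (\<lambda>k. f' (p s 1) (k *\<^sub>R (t *\<^sub>R u)) - f' (p s 0) (k *\<^sub>R (t *\<^sub>R u)))) (at s)"
        if "0 \<le> s" "s \<le> 1" for s
      proof -
        have "((\<lambda>s. f (p s c)) has_derivative (\<lambda>k. f' (p s c) (k *\<^sub>R (t *\<^sub>R u)))) (at s)"
          if "0 \<le> c" "c \<le> 1" for c
        proof -
          have 1: "((\<lambda>s. p s c) has_derivative (\<lambda>k. k *\<^sub>R (t *\<^sub>R u))) (at s)"
            unfolding p_def by (auto intro!: derivative_eq_intros)
          show ?thesis
            using has_derivative_compose[OF 1 df[OF pS[OF \<open>0 \<le> s\<close> \<open>s \<le> 1\<close> that]]] .
        qed
        from has_derivative_diff[OF this[of 1] this[of 0]] show ?thesis by (simp add: \<phi>_def[abs_def])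
      qed
      then obtain s where s: "0 < s" "s < 1"
        "\<phi> 1 - \<phi> 0 = f' (p s 1) ((1 - 0) *\<^sub>R (t *\<^sub>R u)) - f' (p s 0) ((1 - 0) *\<^sub>R (t *\<^sub>R u))"
        using mvt_simple[of 0 1 \<phi> "\<lambda>s k. f' (p s 1) (k *\<^sub>R (t *\<^sub>R u)) - f' (p s 0) (k *\<^sub>R (t *\<^sub>R u))"]
        by (force intro: has_derivative_at_withinI)
      have lin: "f' (p s c) (t *\<^sub>R u) = t * f' (p s c) u" if "0 \<le> c" "c \<le> 1" for c
        using linear_scale[OF has_derivative_linear[OF df[OF pS[of s c]]]] s that by simp
      have Q: "f (x + t *\<^sub>R u + t *\<^sub>R v) - f (x + t *\<^sub>R u) - f (x + t *\<^sub>R v) + f x = t * (f' (p s 1) u - f' (p s 0) u)"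
        using s(3) lin[of 0] lin[of 1] by (simp add: \<phi>_def p_def algebra_simps)
      have E: "norm (f' (p s c) u - f' x u - h (p s c - x)) \<le> e' * (t * K)" if "0 \<le> c" "c \<le> 1" for c
      proof -
        have "norm (p s c - x) < d \<and> norm (p s c - x) \<le> t * K"
          using small[of s c] s that by (auto simp: p_def add.assoc)
        then show ?thesis using d(2)[of "p s c"] e'
          by (smt (verit) mult_left_mono)
      qed
      have hv: "h (p s 1 - x) - h (p s 0 - x) = t * h v"
        using linear_diff[OF h, of "p s 1 - x" "p s 0 - x"] linear_scale[OF h, of t v] by (simp add: p_def)
      have "norm (f' (p s 1) u - f' (p s 0) u - t * h v) \<le> 2 * (e' * (t * K))"
        using E[of 0] E[of 1] hv by (simp add: abs_le_iff)
      also have "\<dots> = t * (e / 2)" using K by (simp add: e'_def)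
      also have "\<dots> < t * e" using t e by simp
      finally have "norm (f' (p s 1) u - f' (p s 0) u - t * h v) < t * e" .
      then have "norm ((f' (p s 1) u - f' (p s 0) u - t * h v) / t) < e"
        using t by (simp add: norm_divide divide_less_eq mult.commute)
      moreover have "(f' (p s 1) u - f' (p s 0) u - t * h v) / t
          = (f (x + t *\<^sub>R u + t *\<^sub>R v) - f (x + t *\<^sub>R u) - f (x + t *\<^sub>R v) + f x) / t\<^sup>2 - h v"
        unfolding Q using t by (simp add: power2_eq_square field_simps)
      ultimately show ?thesis by simp
    qed
    then show "\<forall>\<^sub>F t in at_right 0. dist ((f (x + t *\<^sub>R u + t *\<^sub>R v) - f (x + t *\<^sub>R u) - f (x + t *\<^sub>R v) + f x) / t\<^sup>2) (h v) < e"
      using m unfolding eventually_at_right_field dist_norm by blast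
  qed
qed

text \<open>Both sides are limits of the same second difference. The inner product with an arbitrary
  \<open>w\<close> reduces vector values to real ones, as the mean value theorem requires. The lemma
  is meant for transition maps.\<close>

lemma second_derivative_symmetric:
  fixes f :: "'a::real_normed_vector \<Rightarrow> 'b::real_inner"
  assumes S: "open S" and x: "x \<in> S"
    and df: "\<And>z. z \<in> S \<Longrightarrow> (f has_derivative f' z) (at z)"
    and du: "((\<lambda>z. f' z u) has_derivative hu) (at x)"
    and dv: "((\<lambda>z. f' z v) has_derivative hv) (at x)"
  shows "hu v = hv u"
proof -
  have "hu v \<bullet> w = hv u \<bullet> w" for w
  proof -
    note L = second_difference_limit[OF S x, where f="\<lambda>z. f z \<bullet> w" and f'="\<lambda>z k. f' z k \<bullet> w"]
    have 1: "((\<lambda>t. (f (x + t *\<^sub>R u + t *\<^sub>R v) \<bullet> w - f (x + t *\<^sub>R u) \<bullet> w - f (x + t *\<^sub>R v) \<bullet> w + f x \<bullet> w) / t\<^sup>2)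
           \<longlongrightarrow> hu v \<bullet> w) (at_right 0)"
      using L[of u "\<lambda>k. hu k \<bullet> w" v, OF has_derivative_inner_left[OF df]
          has_derivative_inner_left[OF du]] by simp
    have 2: "((\<lambda>t. (f (x + t *\<^sub>R v + t *\<^sub>R u) \<bullet> w - f (x + t *\<^sub>R v) \<bullet> w - f (x + t *\<^sub>R u) \<bullet> w + f x \<bullet> w) / t\<^sup>2)
           \<longlongrightarrow> hv u \<bullet> w) (at_right 0)"
      using L[of v "\<lambda>k. hv k \<bullet> w" u, OF has_derivative_inner_left[OF df]
          has_derivative_inner_left[OF dv]] by simp
    have "(\<lambda>t. (f (x + t *\<^sub>R v + t *\<^sub>R u) \<bullet> w - f (x + t *\<^sub>R v) \<bullet> w - f (x + t *\<^sub>R u) \<bullet> w + f x \<bullet> w) / t\<^sup>2)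
      = (\<lambda>t. (f (x + t *\<^sub>R u + t *\<^sub>R v) \<bullet> w - f (x + t *\<^sub>R u) \<bullet> w - f (x + t *\<^sub>R v) \<bullet> w + f x \<bullet> w) / t\<^sup>2)"
      by (simp add: algebra_simps)
    from 2[unfolded this] show ?thesis
      by (rule tendsto_unique[OF trivial_limit_at_right_real 1])
  qed
  then show ?thesis
    using vector_eq_rdot by blast
qed

section \<open>Bilinear forms and the tensors of a pair\<close>

definition bil :: "real^'n::finite^'n \<Rightarrow> real^'n \<Rightarrow> real^'n \<Rightarrow> real" where
  "bil M u w = u \<bullet> (M *v w)"

lemma bil_sum: "bil M u w = (\<Sum>i\<in>UNIV. \<Sum>j\<in>UNIV. M $ i $ j * u $ i * w $ j)"
  by (simp add: bil_def inner_vec_def matrix_vector_mult_def sum_distrib_left mult_ac)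

lemma bil_linear [simp]:
  "bil M (u + u') w = bil M u w + bil M u' w"
  "bil M (u - u') w = bil M u w - bil M u' w"
  "bil M (c *\<^sub>R u) w = c * bil M u w"
  "bil M (- u) w = - bil M u w"
  "bil M 0 w = 0"
  "bil M u (w + w') = bil M u w + bil M u w'"
  "bil M u (w - w') = bil M u w - bil M u w'"
  "bil M u (c *\<^sub>R w) = c * bil M u w"
  "bil M u (- w) = - bil M u w"
  "bil M u 0 = 0"
  "bil (M + M') u w = bil M u w + bil M' u w"
  "bil (c *\<^sub>R M) u w = c * bil M u w"
  "bil 0 u w = 0"
  by (simp_all add: bil_def inner_add_left inner_diff_left inner_add_right inner_diff_right
      matrix_vector_right_distrib matrix_vector_mult_diff_distrib matrix_vector_mult_add_rdistrib
      matrix_vector_mult_scaleR scaleR_matrix_vector_assoc[symmetric])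
    (metis inner_minus_right mult_1s(3) matrix_vector_mult_scaleR scaleR_minus1_left)

lemma bil_axis [simp]: "bil M (axis i 1) (axis j 1) = M $ i $ j"
  by (simp add: bil_def matrix_vector_mult_basis inner_axis' column_def)

lemma bounded_bilinear_matrix_vector:
  "bounded_bilinear ((*v) :: real^'n::finite^'m::finite \<Rightarrow> real^'n \<Rightarrow> real^'m)"
  unfolding bilinear_conv_bounded_bilinear[symmetric] bilinear_def linear_iff
  by (simp add: matrix_vector_right_distrib matrix_vector_mult_add_rdistrib matrix_vector_mult_scaleR
      scaleR_matrix_vector_assoc[symmetric])

lemma bounded_linear_bil: "bounded_linear (\<lambda>M. bil M u w)"
  by (rule linear_conv_bounded_linear[THEN iffD1]) (simp add: linear_iff)

lemma bil_commute: "transpose M = M \<Longrightarrow> bil M u w = bil M w u"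
  unfolding bil_def by (metis dot_lmul_matrix inner_commute transpose_matrix_vector)

lemma metric_norm_bil: "metric_norm a x y = sqrt (bil (a x) y y)"
  by (simp add: metric_norm_def bil_sum)

lemma form_eval_inner: "form_eval b x y = b x \<bullet> y"
  by (simp add: form_eval_def inner_vec_def)

lemma form_norm_inner: "form_norm a b x = sqrt (b x \<bullet> raised a b x)"
  by (simp add: form_norm_def inner_vec_def mult.commute)

text \<open>The bridge between the index equations of the statement and the coordinate-free forms in
  which all computations are done.\<close>

lemma bilinear_iff_axis:
  fixes f g :: "real^'n::finite \<Rightarrow> real^'n \<Rightarrow> real"
  assumes "bilinear f" "bilinear g"
  shows "(\<forall>i j. f (axis i 1) (axis j 1) = g (axis i 1) (axis j 1)) \<longleftrightarrow> (\<forall>u v. f u v = g u v)"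
proof
  assume *: "\<forall>i j. f (axis i 1) (axis j 1) = g (axis i 1) (axis j 1)"
  have "f = g"
    by (rule bilinear_eq_stdbasis[OF assms]) (use * in \<open>auto simp: Basis_vec_def\<close>)
  then show "\<forall>u v. f u v = g u v" by simp
qed simp

text \<open>\<open>rform\<close> and \<open>sform\<close> are \<open>r\<^sub>i\<^sub>j u\<^sup>i v\<^sup>j\<close> and \<open>s\<^sub>i\<^sub>j u\<^sup>i v\<^sup>j\<close>.  In \<open>r\<^sub>i\<^sub>j\<close> the Christoffel symbols occur
  only contracted with \<open>b\<close>, so the inverse matrix enters through the raised form alone.\<close>

definition rform ::
  "(real^'n::finite \<Rightarrow> real^'n^'n) \<Rightarrow> (real^'n \<Rightarrow> real^'n) \<Rightarrow> real^'n \<Rightarrow> real^'n \<Rightarrow> real^'n \<Rightarrow> real" where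
  "rform a b x u v =
     1/2 * (frechet_derivative b (at x) v \<bullet> u + frechet_derivative b (at x) u \<bullet> v)
     - 1/2 * (bil (frechet_derivative a (at x) u) (raised a b x) v
        + bil (frechet_derivative a (at x) v) (raised a b x) u
        - bil (frechet_derivative a (at x) (raised a b x)) u v)"

definition sform ::
  "(real^'n::finite \<Rightarrow> real^'n) \<Rightarrow> real^'n \<Rightarrow> real^'n \<Rightarrow> real^'n \<Rightarrow> real" where
  "sform b x u v = 1/2 * (frechet_derivative b (at x) v \<bullet> u - frechet_derivative b (at x) u \<bullet> v)"

text \<open>Twice the spray of \<alpha>.\<close>

definition gam :: "(real^'n::finite \<Rightarrow> real^'n^'n) \<Rightarrow> real^'n \<Rightarrow> real^'n \<Rightarrow> real^'n" where
  "gam a x y = (\<chi> k. \<Sum>i\<in>UNIV. \<Sum>j\<in>UNIV. christoffel a x k i j * y $ i * y $ j)"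

locale smooth_pair =
  fixes V :: "(real^'n::finite) set" and a :: "real^'n \<Rightarrow> real^'n^'n" and b :: "real^'n \<Rightarrow> real^'n"
  assumes open_V: "open V" and smooth_a: "smooth_on V a" and smooth_b: "smooth_on V b"
    and sym_a: "x \<in> V \<Longrightarrow> transpose (a x) = a x"
    and pos_a: "x \<in> V \<Longrightarrow> y \<noteq> 0 \<Longrightarrow> bil (a x) y y > 0"
    and nonzero_b: "x \<in> V \<Longrightarrow> b x \<noteq> 0"
begin

abbreviation "B \<equiv> raised a b"
abbreviation "N x \<equiv> b x \<bullet> B x"
abbreviation "Da x \<equiv> frechet_derivative a (at x)"
abbreviation "Db x \<equiv> frechet_derivative b (at x)"

lemma bil_nonneg: "x \<in> V \<Longrightarrow> bil (a x) y y \<ge> 0"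
  using pos_a[of x y] by (cases "y = 0") auto

lemma a_commute: "x \<in> V \<Longrightarrow> bil (a x) u w = bil (a x) w u"
  using sym_a bil_commute by blast

lemma invertible_a: "x \<in> V \<Longrightarrow> invertible (a x)"
proof -
  assume "x \<in> V"
  then have "a x *v y = 0 \<Longrightarrow> y = 0" for y
    using pos_a[of x y] by (auto simp: bil_def)
  then show ?thesis
    by (metis invertible_left_inverse matrix_left_invertible_ker)
qed

lemma a_B: "x \<in> V \<Longrightarrow> a x *v B x = b x"
  using matrix_inv_right_left(1)[OF invertible_a]
  by (simp add: raised_def matrix_vector_mul_assoc)

lemma bil_B [simp]:
  assumes "x \<in> V" shows "bil (a x) u (B x) = b x \<bullet> u" "bil (a x) (B x) u = b x \<bullet> u"
  using a_commute[OF assms, of u "B x"] a_B[OF assms] by (simp_all add: bil_def inner_commute)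

lemma N_pos: "x \<in> V \<Longrightarrow> N x > 0"
proof -
  assume x: "x \<in> V"
  then have "B x \<noteq> 0" using a_B nonzero_b by force
  then show ?thesis using pos_a[OF x, of "B x"] x by simp
qed

lemma form_norm_sq: "x \<in> V \<Longrightarrow> (form_norm a b x)\<^sup>2 = N x"
  using N_pos[of x] by (simp add: form_norm_inner)

lemma smooth_entry: "smooth_on V (\<lambda>x. a x $ i $ j)"
  using smooth_on_vec_nth[OF open_V smooth_on_vec_nth[OF open_V smooth_a]] .

lemma smooth_inv: "smooth_on V (\<lambda>x. matrix_inv (a x) $ i $ j)"
  using smooth_on_matrix_inv[OF open_V] smooth_entry invertible_a by blast

lemma smooth_B: "smooth_on V B"
proof (rule smooth_on_vecI[OF open_V])
  fix i
  have "smooth_on V (\<lambda>x. \<Sum>j\<in>UNIV. matrix_inv (a x) $ i $ j * b x $ j)"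
    by (intro smooth_on_sum smooth_on_mult open_V smooth_inv smooth_on_vec_nth[OF _ smooth_b])
  then show "smooth_on V (\<lambda>x. B x $ i)"
    by (simp add: raised_def matrix_vector_mult_def)
qed

lemma smooth_N: "smooth_on V N"
  by (intro smooth_on_inner open_V smooth_b smooth_B)

lemma a_deriv: "x \<in> V \<Longrightarrow> (a has_derivative Da x) (at x)"
  using smooth_on_has_derivative[OF smooth_a] .

lemma b_deriv: "x \<in> V \<Longrightarrow> (b has_derivative Db x) (at x)"
  using smooth_on_has_derivative[OF smooth_b] .

lemma Da_linear: "x \<in> V \<Longrightarrow> linear (Da x)"
  using a_deriv has_derivative_linear by blast

lemma Db_linear: "x \<in> V \<Longrightarrow> linear (Db x)"
  using b_deriv has_derivative_linear by blast

lemma bil_deriv: "x \<in> V \<Longrightarrow> ((\<lambda>z. bil (a z) u w) has_derivative (\<lambda>k. bil (Da x k) u w)) (at x)"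
  using bounded_linear.has_derivative[OF bounded_linear_bil a_deriv] .

lemma Da_commute: "x \<in> V \<Longrightarrow> bil (Da x k) u w = bil (Da x k) w u"
proof -
  assume x: "x \<in> V"
  have "((\<lambda>z. bil (a z) w u) has_derivative (\<lambda>k. bil (Da x k) u w)) (at x)"
    by (rule has_derivative_transform_within_open[OF bil_deriv[OF x] open_V x]) (rule a_commute)
  from has_derivative_unique[OF this bil_deriv[OF x]] show ?thesis by metis
qed

lemma pderiv_a: "x \<in> V \<Longrightarrow> pderiv_at k (\<lambda>u. a u $ i $ j) x = bil (Da x (axis k 1)) (axis i 1) (axis j 1)"
  using frechet_derivative_at[OF bil_deriv, of x "axis i 1" "axis j 1"]
  by (simp add: pderiv_at_def) metis

lemma pderiv_b: "x \<in> V \<Longrightarrow> pderiv_at k (\<lambda>u. b u $ i) x = Db x (axis k 1) $ i"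
  using frechet_derivative_at[OF bounded_linear.has_derivative[OF bounded_linear_vec_nth b_deriv], of x i]
  by (simp add: pderiv_at_def) metis

lemmas lin_simps = linear_add[OF Da_linear] linear_scale[OF Da_linear]
  linear_add[OF Db_linear] linear_scale[OF Db_linear]

lemma vec_axis_sum: "h = (\<Sum>l\<in>UNIV. h $ l *\<^sub>R axis l (1::real))"
  by (simp add: vec_eq_iff axis_def if_distrib cong: if_cong)

text \<open>Lowering the upper index cancels the inverse matrix. Both sides are linear in
  \<open>h\<close>, so the index formula at the basis vectors suffices.\<close>

lemma christoffel_lower:
  assumes x: "x \<in> V"
  shows "bil (a x) h (\<chi> k. christoffel a x k i j) =
    1/2 * (bil (Da x (axis i 1)) h (axis j 1) + bil (Da x (axis j 1)) h (axis i 1)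
      - bil (Da x h) (axis i 1) (axis j 1))"
proof -
  define T :: "real^'n \<Rightarrow> real" where "T h = bil (Da x (axis i 1)) h (axis j 1)
      + bil (Da x (axis j 1)) h (axis i 1) - bil (Da x h) (axis i 1) (axis j 1)" for h
  have linT: "linear T"
    unfolding T_def by (rule linearI) (simp_all add: lin_simps x algebra_simps)
  define t where "t = (\<chi> l. T (axis l 1))"
  have "(\<chi> k. christoffel a x k i j) = (1/2) *\<^sub>R (matrix_inv (a x) *v t)"
    by (simp add: vec_eq_iff christoffel_def matrix_vector_mult_def t_def T_def pderiv_a[OF x]
        Da_commute[OF x] del: bil_axis)
  then have "a x *v (\<chi> k. christoffel a x k i j) = (1/2) *\<^sub>R t"
    using matrix_inv_right_left(1)[OF invertible_a[OF x]]
    by (simp add: matrix_vector_mult_scaleR matrix_vector_mul_assoc)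
  then have "bil (a x) h (\<chi> k. christoffel a x k i j) = 1/2 * (h \<bullet> t)"
    by (simp add: bil_def)
  also have "h \<bullet> t = T h"
  proof -
    have "T h = T (\<Sum>l\<in>UNIV. h $ l *\<^sub>R axis l 1)" using vec_axis_sum[of h] by simp
    then show ?thesis
      by (simp add: linear_sum[OF linT] linear_scale[OF linT] inner_vec_def t_def)
  qed
  finally show ?thesis by (simp add: T_def)
qed

lemma cov_deriv_eq:
  assumes x: "x \<in> V"
  shows "cov_deriv a b x i j = Db x (axis j 1) \<bullet> axis i 1 -
    1/2 * (bil (Da x (axis i 1)) (B x) (axis j 1) + bil (Da x (axis j 1)) (B x) (axis i 1)
      - bil (Da x (B x)) (axis i 1) (axis j 1))"
proof -
  have "(\<Sum>k\<in>UNIV. christoffel a x k i j * b x $ k) = bil (a x) (B x) (\<chi> k. christoffel a x k i j)"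
    using x by (simp add: inner_vec_def mult.commute)
  then show ?thesis
    unfolding cov_deriv_def christoffel_lower[OF x] pderiv_b[OF x] by (simp add: inner_axis)
qed

lemma r_tensor_eq: "x \<in> V \<Longrightarrow> r_tensor a b x i j = rform a b x (axis i 1) (axis j 1)"
  unfolding r_tensor_def rform_def cov_deriv_eq
  by (simp add: Da_commute[of x "B x" "axis i 1"] algebra_simps del: bil_axis)

lemma s_tensor_eq: "x \<in> V \<Longrightarrow> s_tensor a b x i j = sform b x (axis i 1) (axis j 1)"
  unfolding s_tensor_def sform_def cov_deriv_eq
  by (simp add: Da_commute[of x "B x" "axis i 1"] algebra_simps del: bil_axis)

lemma bilinear_rform: "x \<in> V \<Longrightarrow> bilinear (rform a b x)"
  unfolding bilinear_def rform_def
  by (intro conjI allI linearI; simp add: lin_simps inner_add_left inner_add_right field_simps)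

lemma bilinear_sform: "x \<in> V \<Longrightarrow> bilinear (sform b x)"
  unfolding bilinear_def sform_def
  by (intro conjI allI linearI; simp add: lin_simps inner_add_left inner_add_right field_simps)

lemma rform_commute: "x \<in> V \<Longrightarrow> rform a b x u v = rform a b x v u"
  unfolding rform_def using Da_commute[of x "B x" u v] by (simp add: algebra_simps)

lemma sform_anti: "sform b x u v = - sform b x v u"
  unfolding sform_def by (simp add: field_simps)

lemma s_form_eq: "x \<in> V \<Longrightarrow> s_form a b x i = sform b x (B x) (axis i 1)"
proof -
  assume x: "x \<in> V"
  have "sform b x (B x) (axis i 1) = sform b x (\<Sum>l\<in>UNIV. B x $ l *\<^sub>R axis l 1) (axis i 1)"
    using vec_axis_sum[of "B x"] by simp
  also have "\<dots> = (\<Sum>l\<in>UNIV. B x $ l * sform b x (axis l 1) (axis i 1))"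
    using bilinear_sform[OF x] unfolding bilinear_def
    by (simp add: linear_sum[of "\<lambda>u. sform b x u (axis i 1)"] linear_scale[of "\<lambda>u. sform b x u (axis i 1)"])
  finally show ?thesis by (simp add: s_form_def s_tensor_eq[OF x])
qed

text \<open>The constants are free so that one equivalence serves the equations of (\<alpha>,
  \<beta>), where \<open>k = 3 / b^2\<close>, and those of both barred pairs, where
  \<open>k = 0\<close>.\<close>

lemma r_tensor_iff:
  assumes x: "x \<in> V"
  shows "(\<forall>i j. r_tensor a b x i j = c * a x $ i $ j + d * b x $ i * b x $ j
      - k * (s_form a b x i * b x $ j + s_form a b x j * b x $ i))
    \<longleftrightarrow> (\<forall>u v. rform a b x u v = c * bil (a x) u v + d * (b x \<bullet> u) * (b x \<bullet> v)
      - k * (sform b x (B x) u * (b x \<bullet> v) + sform b x (B x) v * (b x \<bullet> u)))"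
proof -
  have "bilinear (\<lambda>u v. c * bil (a x) u v + d * (b x \<bullet> u) * (b x \<bullet> v)
      - k * (sform b x (B x) u * (b x \<bullet> v) + sform b x (B x) v * (b x \<bullet> u)))"
    using bilinear_sform[OF x] unfolding bilinear_def
    by (intro conjI allI linearI; simp add: linear_iff inner_add_right algebra_simps)
  from bilinear_iff_axis[OF bilinear_rform[OF x] this] show ?thesis
    by (simp add: r_tensor_eq[OF x] s_form_eq[OF x] inner_axis)
qed

lemma s_tensor_iff:
  assumes x: "x \<in> V"
  shows "(\<forall>i j. s_tensor a b x i j = k * (b x $ i * s_form a b x j - b x $ j * s_form a b x i))
    \<longleftrightarrow> (\<forall>u v. sform b x u v = k * ((b x \<bullet> u) * sform b x (B x) v - (b x \<bullet> v) * sform b x (B x) u))"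
proof -
  have "bilinear (\<lambda>u v. k * ((b x \<bullet> u) * sform b x (B x) v - (b x \<bullet> v) * sform b x (B x) u))"
    using bilinear_sform[OF x] unfolding bilinear_def
    by (intro conjI allI linearI; simp add: linear_iff inner_add_right algebra_simps)
  from bilinear_iff_axis[OF bilinear_sform[OF x] this] show ?thesis
    by (simp add: s_tensor_eq[OF x] s_form_eq[OF x] inner_axis)
qed

text \<open>The classical \<open>(b^2)_{|k} = 2 b^i b_{i|k}\<close>. The inverse matrix is never
  differentiated: the derivative of \<open>a B = b\<close> is paired with \<open>B\<close> and
  solved for \<open>b x \<bullet> B' k\<close>.\<close>

lemma N_deriv:
  assumes x: "x \<in> V"
  shows "(N has_derivative (\<lambda>k. 2 * (rform a b x (B x) k + sform b x (B x) k))) (at x)"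
proof -
  define B' where "B' = frechet_derivative B (at x)"
  have dB: "(B has_derivative B') (at x)"
    unfolding B'_def by (rule smooth_on_has_derivative[OF smooth_B x])
  have dN: "(N has_derivative (\<lambda>k. b x \<bullet> B' k + Db x k \<bullet> B x)) (at x)"
    using has_derivative_inner[OF b_deriv[OF x] dB] .
  have dM: "((\<lambda>z. a z *v B z) has_derivative (\<lambda>k. a x *v B' k + Da x k *v B x)) (at x)"
    using bounded_bilinear.FDERIV[OF bounded_bilinear_matrix_vector a_deriv[OF x] dB] .
  have "(b has_derivative (\<lambda>k. a x *v B' k + Da x k *v B x)) (at x)"
    by (rule has_derivative_transform_within_open[OF dM open_V x]) (rule a_B)
  from has_derivative_unique[OF this b_deriv[OF x]]
  have "Db x k = a x *v B' k + Da x k *v B x" for k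
    by (simp add: fun_eq_iff)
  then have "Db x k \<bullet> B x = bil (a x) (B x) (B' k) + bil (Da x k) (B x) (B x)" for k
    by (simp only: bil_def inner_add_right inner_commute[of _ "B x"])
  then have "b x \<bullet> B' k = Db x k \<bullet> B x - bil (Da x k) (B x) (B x)" for k
    using x by simp
  then have "b x \<bullet> B' k + Db x k \<bullet> B x = 2 * (rform a b x (B x) k + sform b x (B x) k)" for k
    by (simp add: rform_def sform_def algebra_simps)
  with dN show ?thesis by simp
qed

lemma gam_lower:
  assumes x: "x \<in> V"
  shows "bil (a x) h (gam a x y) = bil (Da x y) h y - 1/2 * bil (Da x h) y y"
proof -
  define T where "T u v = 1/2 * (bil (Da x u) h v + bil (Da x v) h u - bil (Da x h) u v)" for u v
  have linT: "linear (\<lambda>u. T u v)" "linear (T u)" for u v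
    unfolding T_def by (rule linearI; simp add: lin_simps x algebra_simps)+
  have "gam a x y = (\<Sum>i\<in>UNIV. \<Sum>j\<in>UNIV. (y $ i * y $ j) *\<^sub>R (\<chi> k. christoffel a x k i j))"
    by (simp add: gam_def vec_eq_iff mult_ac)
  moreover have lin: "linear (bil (a x) h)" by (simp add: linear_iff)
  ultimately have "bil (a x) h (gam a x y) =
      (\<Sum>i\<in>UNIV. \<Sum>j\<in>UNIV. y $ i * y $ j * T (axis i 1) (axis j 1))"
    by (simp add: linear_sum[OF lin] christoffel_lower[OF x] T_def)
  also have "\<dots> = T (\<Sum>i\<in>UNIV. y $ i *\<^sub>R axis i 1) (\<Sum>j\<in>UNIV. y $ j *\<^sub>R axis j 1)"
    by (subst linear_sum[OF linT(1)])
      (simp add: linear_sum[OF linT(2)] linear_scale[OF linT(1)] linear_scale[OF linT(2)] sum_distrib_left mult_ac)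
  also have "\<dots> = T y y" using vec_axis_sum[of y] by simp
  finally show ?thesis by (simp add: T_def)
qed

end

section \<open>The spray in the unit gauge\<close>

text \<open>If \<open>b = 1\<close> then \<open>F\<^sup>2 = phi (\<alpha>\<^sup>2) \<beta>\<close>; the subscripts stand for the partial derivatives.\<close>

definition phi :: "real \<Rightarrow> real \<Rightarrow> real" where
  "phi A \<beta> = (sqrt A + \<beta>) ^ 4 / A"

definition phi_A :: "real \<Rightarrow> real \<Rightarrow> real" where
  "phi_A A \<beta> = (sqrt A + \<beta>) ^ 3 * (sqrt A - \<beta>) / A\<^sup>2"

definition phi_b :: "real \<Rightarrow> real \<Rightarrow> real" where
  "phi_b A \<beta> = 4 * (sqrt A + \<beta>) ^ 3 / A"

definition phi_Ab :: "real \<Rightarrow> real \<Rightarrow> real" where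
  "phi_Ab A \<beta> = 2 * (sqrt A + \<beta>)\<^sup>2 * (sqrt A - 2 * \<beta>) / A\<^sup>2"

text \<open>\<open>phi_A\<close> is homogeneous of degree 0 in \<open>sqrt A\<close> and \<beta>;
  Euler's relation \<open>2 A phi_AA + \<beta> phi_Ab = 0\<close> is solved for
  \<open>phi_AA\<close>.\<close>

definition phi_AA :: "real \<Rightarrow> real \<Rightarrow> real" where
  "phi_AA A \<beta> = - (\<beta> * phi_Ab A \<beta>) / (2 * A)"

definition phi_bb :: "real \<Rightarrow> real \<Rightarrow> real" where
  "phi_bb A \<beta> = 12 * (sqrt A + \<beta>)\<^sup>2 / A"

lemma has_derivative_sqrt:
  fixes f :: "'a::real_normed_vector \<Rightarrow> real"
  assumes "(f has_derivative f') (at x)" "f x > 0"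
  shows "((\<lambda>z. sqrt (f z)) has_derivative (\<lambda>k. f' k / (2 * sqrt (f x)))) (at x)"
  by (rule has_derivative_eq_rhs[OF has_derivative_real_sqrt[OF assms(2,1)]]) (simp add: field_simps)

context
  fixes f g :: "'a::real_normed_vector \<Rightarrow> real" and f' g' x
  assumes f: "(f has_derivative f') (at x)" and g: "(g has_derivative g') (at x)" and pos: "f x > 0"
begin

text \<open>Writing \<open>f x = r^2\<close> removes the square root from what the chain rule
  produces, and a rational identity in \<open>r\<close> remains. The same substitution is made in
  all computations with \<open>phi\<close> below.\<close>

lemma phi_deriv:
  "((\<lambda>z. phi (f z) (g z)) has_derivative
     (\<lambda>k. phi_A (f x) (g x) * f' k + phi_b (f x) (g x) * g' k)) (at x)"
proof -
  obtain r where r: "r > 0" "sqrt (f x) = r" "f x = r\<^sup>2"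
    using pos by (metis real_sqrt_gt_zero real_sqrt_pow2 less_imp_le)
  show ?thesis
  unfolding phi_def phi_A_def phi_b_def divide_inverse
  apply (rule has_derivative_eq_rhs)
   apply (rule has_derivative_sqrt[OF f pos] f g derivative_intros | use pos in force)+
  by (rule ext, simp only: r(2), simp only: r(3), use r(1) in \<open>simp add: field_simps\<close>,
      simp add: algebra_simps eval_nat_numeral)
qed

lemma phi_A_deriv:
  "((\<lambda>z. phi_A (f z) (g z)) has_derivative
     (\<lambda>k. phi_AA (f x) (g x) * f' k + phi_Ab (f x) (g x) * g' k)) (at x)"
proof -
  obtain r where r: "r > 0" "sqrt (f x) = r" "f x = r\<^sup>2"
    using pos by (metis real_sqrt_gt_zero real_sqrt_pow2 less_imp_le)
  show ?thesis
  unfolding phi_AA_def phi_A_def phi_Ab_def divide_inverse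
  apply (rule has_derivative_eq_rhs)
   apply (rule has_derivative_sqrt[OF f pos] f g derivative_intros | use pos in force)+
  by (rule ext, simp only: r(2), simp only: r(3), use r(1) in \<open>simp add: field_simps\<close>,
      simp add: algebra_simps eval_nat_numeral)
qed

lemma phi_b_deriv:
  "((\<lambda>z. phi_b (f z) (g z)) has_derivative
     (\<lambda>k. phi_Ab (f x) (g x) * f' k + phi_bb (f x) (g x) * g' k)) (at x)"
proof -
  obtain r where r: "r > 0" "sqrt (f x) = r" "f x = r\<^sup>2"
    using pos by (metis real_sqrt_gt_zero real_sqrt_pow2 less_imp_le)
  show ?thesis
  unfolding phi_bb_def phi_b_def phi_Ab_def divide_inverse
  apply (rule has_derivative_eq_rhs)
   apply (rule has_derivative_sqrt[OF f pos] f g derivative_intros | use pos in force)+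
  by (rule ext, simp only: r(2), simp only: r(3), use r(1) in \<open>simp add: field_simps\<close>,
      simp add: algebra_simps eval_nat_numeral)
qed

end

lemma pderiv_at_eq: "(f has_derivative f') (at x) \<Longrightarrow> pderiv_at k f x = f' (axis k 1)"
  using frechet_derivative_at by (metis pderiv_at_def)

lemma linear_axis_sum:
  fixes L :: "real^'n::finite \<Rightarrow> real"
  assumes "linear L" shows "(\<Sum>k\<in>UNIV. L (axis k 1) * y $ k) = L y"
proof -
  have "L y = L (\<Sum>l\<in>UNIV. y $ l *\<^sub>R axis l 1)"
    by (rule arg_cong[of _ _ L]) (simp add: vec_eq_iff axis_def if_distrib cong: if_cong)
  then show ?thesis
    by (simp add: linear_sum[OF assms] linear_scale[OF assms] mult.commute)
qed

locale unit_pair = smooth_pair V a b for V :: "(real^'n::finite) set" and a b +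
  fixes F :: "real^'n \<Rightarrow> real^'n \<Rightarrow> real"
  assumes unit: "x \<in> V \<Longrightarrow> b x \<bullet> raised a b x = 1"
    and F_eq: "x \<in> V \<Longrightarrow> y \<noteq> 0 \<Longrightarrow> F x y = (sqrt (bil (a x) y y) + b x \<bullet> y)\<^sup>2 / sqrt (bil (a x) y y)"
begin

abbreviation "A x y \<equiv> bil (a x) y y"

lemma F_sq: "x \<in> V \<Longrightarrow> y \<noteq> 0 \<Longrightarrow> (F x y)\<^sup>2 = phi (A x y) (b x \<bullet> y)"
  using pos_a[of x y] by (simp add: F_eq phi_def power_divide flip: power_mult)

lemma A_deriv_y: "((\<lambda>v. A x v) has_derivative (\<lambda>k. bil (a x) k y + bil (a x) y k)) (at y)"
proof -
  have "((\<lambda>v. v \<bullet> (a x *v v)) has_derivative (\<lambda>k. y \<bullet> (a x *v k) + k \<bullet> (a x *v y))) (at y)"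
    by (intro has_derivative_inner has_derivative_ident
        bounded_linear_imp_has_derivative matrix_vector_mul_bounded_linear)
  then show ?thesis by (simp add: bil_def add.commute)
qed

lemma A_deriv_y': "x \<in> V \<Longrightarrow> ((\<lambda>v. A x v) has_derivative (\<lambda>k. 2 * bil (a x) k y)) (at y)"
  using A_deriv_y[of x y] a_commute[of x y] by simp

lemma b_deriv_y: "((\<lambda>v. b x \<bullet> v) has_derivative (\<lambda>k. b x \<bullet> k)) (at y)"
  by (auto intro!: derivative_eq_intros)

lemma pderiv_F_x:
  assumes x: "x \<in> V" and v: "v \<noteq> 0"
  shows "pderiv_at k (\<lambda>u. (F u v)\<^sup>2) x =
    phi_A (A x v) (b x \<bullet> v) * bil (Da x (axis k 1)) v v
    + phi_b (A x v) (b x \<bullet> v) * (Db x (axis k 1) \<bullet> v)"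
proof (rule pderiv_at_eq)
  show "((\<lambda>u. (F u v)\<^sup>2) has_derivative (\<lambda>h. phi_A (A x v) (b x \<bullet> v) * bil (Da x h) v v
    + phi_b (A x v) (b x \<bullet> v) * (Db x h \<bullet> v))) (at x)"
    by (rule has_derivative_transform_within_open[OF phi_deriv[OF bil_deriv[OF x]
            has_derivative_inner_left[OF b_deriv[OF x]] pos_a[OF x v]] open_V x])
      (simp add: F_sq v)
qed

lemma open_nonzero: "open (- {0 :: real^'n})"
  by (simp add: open_Compl)

lemma pderiv_F_y:
  assumes x: "x \<in> V" and y: "y \<noteq> 0"
  shows "pderiv_at i (\<lambda>w. 1/2 * (F x w)\<^sup>2) y =
    phi_A (A x y) (b x \<bullet> y) * bil (a x) (axis i 1) y + 1/2 * phi_b (A x y) (b x \<bullet> y) * b x $ i"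
proof -
  have "((\<lambda>w. 1/2 * phi (A x w) (b x \<bullet> w)) has_derivative
     (\<lambda>h. 1/2 * (phi_A (A x y) (b x \<bullet> y) * (2 * bil (a x) h y) + phi_b (A x y) (b x \<bullet> y) * (b x \<bullet> h)))) (at y)"
    by (intro has_derivative_mult_right phi_deriv A_deriv_y' b_deriv_y pos_a x y)
  then have "((\<lambda>w. 1/2 * (F x w)\<^sup>2) has_derivative
     (\<lambda>h. 1/2 * (phi_A (A x y) (b x \<bullet> y) * (2 * bil (a x) h y) + phi_b (A x y) (b x \<bullet> y) * (b x \<bullet> h)))) (at y)"
    by (rule has_derivative_transform_within_open[OF _ open_nonzero]) (use F_sq x y in auto)
  from pderiv_at_eq[OF this, of i] show ?thesis by (simp add: inner_axis)
qed

text \<open>The fundamental tensor as a bilinear form, with \<open>h\<close> the direction of the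
  inner and \<open>k\<close> that of the outer differentiation; its symmetry shows only after
  expansion.\<close>

definition gform :: "real^'n \<Rightarrow> real^'n \<Rightarrow> real^'n \<Rightarrow> real^'n \<Rightarrow> real" where
  "gform x y h k = phi_A (A x y) (b x \<bullet> y) * bil (a x) h k
     + (phi_AA (A x y) (b x \<bullet> y) * (2 * bil (a x) k y) + phi_Ab (A x y) (b x \<bullet> y) * (b x \<bullet> k)) * bil (a x) h y
     + 1/2 * (phi_Ab (A x y) (b x \<bullet> y) * (2 * bil (a x) k y) + phi_bb (A x y) (b x \<bullet> y) * (b x \<bullet> k)) * (b x \<bullet> h)"

lemma fundamental_tensor_gform:
  assumes x: "x \<in> V" and y: "y \<noteq> 0"
  shows "bil (fundamental_tensor F x y) h k = gform x y h k"
proof -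
  have "pderiv_at j (\<lambda>v. pderiv_at i (\<lambda>w. 1/2 * (F x w)\<^sup>2) v) y = gform x y (axis i 1) (axis j 1)" for i j
  proof (rule pderiv_at_eq)
    have d: "((\<lambda>v. bil (a x) (axis i 1) v) has_derivative (\<lambda>k. bil (a x) (axis i 1) k)) (at y)"
      by (intro bounded_linear_imp_has_derivative linear_conv_bounded_linear[THEN iffD1]) (simp add: linear_iff)
    have "((\<lambda>v. phi_A (A x v) (b x \<bullet> v) * bil (a x) (axis i 1) v
        + 1/2 * phi_b (A x v) (b x \<bullet> v) * b x $ i) has_derivative
       (\<lambda>k. (phi_A (A x y) (b x \<bullet> y) * bil (a x) (axis i 1) k
          + (phi_AA (A x y) (b x \<bullet> y) * (2 * bil (a x) k y) + phi_Ab (A x y) (b x \<bullet> y) * (b x \<bullet> k)) * bil (a x) (axis i 1) y)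
         + 1/2 * (phi_Ab (A x y) (b x \<bullet> y) * (2 * bil (a x) k y) + phi_bb (A x y) (b x \<bullet> y) * (b x \<bullet> k)) * b x $ i)) (at y)"
      by (intro has_derivative_add has_derivative_mult has_derivative_mult_left has_derivative_mult_right
          phi_A_deriv phi_b_deriv d A_deriv_y' b_deriv_y pos_a x y)
    then show "((\<lambda>v. pderiv_at i (\<lambda>w. 1/2 * (F x w)\<^sup>2) v) has_derivative gform x y (axis i 1)) (at y)"
      unfolding gform_def[abs_def]
      by (rule has_derivative_transform_within_open[OF _ open_nonzero, THEN has_derivative_eq_rhs])
        (use y in \<open>auto simp: pderiv_F_y[OF x, simplified] inner_axis\<close>)
  qed
  then have "\<forall>i j. bil (fundamental_tensor F x y) (axis i 1) (axis j 1) = gform x y (axis i 1) (axis j 1)"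
    by (simp add: fundamental_tensor_def)
  moreover have "bilinear (bil (fundamental_tensor F x y))" "bilinear (gform x y)"
    unfolding bilinear_def gform_def by (simp_all add: linear_iff inner_add_right algebra_simps)
  ultimately show ?thesis using bilinear_iff_axis by blast
qed

text \<open>The part of the Euler-Lagrange expression of \<open>F^2\<close> that is free of
  accelerations; the spray is a quarter of it with the index raised by the fundamental
  tensor.\<close>

definition euler :: "real^'n \<Rightarrow> real^'n \<Rightarrow> real^'n" where
  "euler x y = (\<chi> l. (\<Sum>k\<in>UNIV. pderiv_at l (\<lambda>v. pderiv_at k (\<lambda>u. (F u v)\<^sup>2) x) y * y $ k)
        - pderiv_at l (\<lambda>u. (F u y)\<^sup>2) x)"

lemma euler_inner:
  assumes x: "x \<in> V" and y: "y \<noteq> 0"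
  shows "h \<bullet> euler x y =
     (phi_AA (A x y) (b x \<bullet> y) * (2 * bil (a x) h y) + phi_Ab (A x y) (b x \<bullet> y) * (b x \<bullet> h)) * bil (Da x y) y y
     + phi_A (A x y) (b x \<bullet> y) * (2 * bil (Da x y) h y)
     + (phi_Ab (A x y) (b x \<bullet> y) * (2 * bil (a x) h y) + phi_bb (A x y) (b x \<bullet> y) * (b x \<bullet> h)) * (Db x y \<bullet> y)
     + phi_b (A x y) (b x \<bullet> y) * (Db x y \<bullet> h)
     - phi_A (A x y) (b x \<bullet> y) * bil (Da x h) y y - phi_b (A x y) (b x \<bullet> y) * (Db x h \<bullet> y)"
    (is "_ = ?R h")
proof -
  \<comment> \<open>\<open>L h m\<close> is the derivative of \<open>F^2\<close> in the direction
    \<open>m\<close> of \<open>x\<close> and then \<open>h\<close> of \<open>y\<close>. It is linear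
    in \<open>m\<close>, so the sum over \<open>k\<close> weighted by \<open>y $ k\<close> amounts
    to \<open>m = y\<close>.\<close>
  define L where "L h m = (phi_AA (A x y) (b x \<bullet> y) * (2 * bil (a x) h y) + phi_Ab (A x y) (b x \<bullet> y) * (b x \<bullet> h)) * bil (Da x m) y y
     + phi_A (A x y) (b x \<bullet> y) * (2 * bil (Da x m) h y)
     + (phi_Ab (A x y) (b x \<bullet> y) * (2 * bil (a x) h y) + phi_bb (A x y) (b x \<bullet> y) * (b x \<bullet> h)) * (Db x m \<bullet> y)
     + phi_b (A x y) (b x \<bullet> y) * (Db x m \<bullet> h)" for h m
  have p: "pderiv_at l (\<lambda>v. pderiv_at k (\<lambda>u. (F u v)\<^sup>2) x) y = L (axis l 1) (axis k 1)" for k l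
  proof (rule pderiv_at_eq)
    define M where "M = Da x (axis k 1)"
    have 1: "((\<lambda>v. bil M v v) has_derivative (\<lambda>h. 2 * bil M h y)) (at y)"
    proof -
      have "((\<lambda>v. v \<bullet> (M *v v)) has_derivative (\<lambda>k. y \<bullet> (M *v k) + k \<bullet> (M *v y))) (at y)"
        by (intro has_derivative_inner has_derivative_ident
            bounded_linear_imp_has_derivative matrix_vector_mul_bounded_linear)
      moreover have "y \<bullet> (M *v h) = h \<bullet> (M *v y)" for h
        using Da_commute[OF x, of "axis k 1" y h] by (simp add: M_def bil_def)
      ultimately show ?thesis by (simp add: bil_def)
    qed
    have 2: "((\<lambda>v. Db x (axis k 1) \<bullet> v) has_derivative (\<lambda>h. Db x (axis k 1) \<bullet> h)) (at y)"
      by (auto intro!: derivative_eq_intros)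
    have "((\<lambda>v. phi_A (A x v) (b x \<bullet> v) * bil M v v
         + phi_b (A x v) (b x \<bullet> v) * (Db x (axis k 1) \<bullet> v)) has_derivative
        (\<lambda>h. (phi_A (A x y) (b x \<bullet> y) * (2 * bil M h y)
          + (phi_AA (A x y) (b x \<bullet> y) * (2 * bil (a x) h y) + phi_Ab (A x y) (b x \<bullet> y) * (b x \<bullet> h)) * bil M y y)
          + (phi_b (A x y) (b x \<bullet> y) * (Db x (axis k 1) \<bullet> h)
          + (phi_Ab (A x y) (b x \<bullet> y) * (2 * bil (a x) h y) + phi_bb (A x y) (b x \<bullet> y) * (b x \<bullet> h)) * (Db x (axis k 1) \<bullet> y)))) (at y)"
      by (intro has_derivative_add has_derivative_mult
          phi_A_deriv phi_b_deriv 1 2 A_deriv_y' b_deriv_y pos_a x y)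
    then have "((\<lambda>v. phi_A (A x v) (b x \<bullet> v) * bil M v v
         + phi_b (A x v) (b x \<bullet> v) * (Db x (axis k 1) \<bullet> v)) has_derivative (\<lambda>h. L h (axis k 1))) (at y)"
      by (rule has_derivative_eq_rhs) (simp add: L_def M_def fun_eq_iff)
    then show "((\<lambda>v. pderiv_at k (\<lambda>u. (F u v)\<^sup>2) x) has_derivative (\<lambda>h. L h (axis k 1))) (at y)"
      by (rule has_derivative_transform_within_open[OF _ open_nonzero])
        (use y in \<open>auto simp: pderiv_F_x[OF x] M_def\<close>)
  qed
  have linL: "linear (L h)" for h
    unfolding L_def by (rule linearI) (simp_all add: lin_simps x inner_add_left algebra_simps)
  have e: "euler x y $ l = ?R (axis l 1)" for l
    using linear_axis_sum[OF linL, of "axis l 1" y]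
    by (simp add: euler_def p pderiv_F_x[OF x y]) (simp add: L_def)
  have linR: "linear ?R"
    by (rule linearI) (simp_all add: lin_simps x inner_add_right inner_add_left algebra_simps)
  show ?thesis
    using linear_axis_sum[OF linR, of h] by (simp add: inner_vec_def e mult.commute)
qed

text \<open>Subtracting the contribution of the spray of \<alpha> turns coordinate derivatives into
  tensors: by \<open>gam_lower\<close> the terms with \<open>Da\<close> are absorbed, and only
  \<open>r(y, y)\<close> and \<open>s(h, y)\<close> are left.\<close>

lemma euler_gform:
  assumes x: "x \<in> V" and y: "y \<noteq> 0"
  shows "h \<bullet> euler x y - gform x y h (2 *\<^sub>R gam a x y) =
     (2 * phi_Ab (A x y) (b x \<bullet> y) * bil (a x) h y + phi_bb (A x y) (b x \<bullet> y) * (b x \<bullet> h)) * rform a b x y y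
     + 2 * phi_b (A x y) (b x \<bullet> y) * sform b x h y"
proof -
  have 1: "b x \<bullet> gam a x y = bil (Da x y) (B x) y - 1/2 * bil (Da x (B x)) y y"
    using gam_lower[OF x, of "B x" y] x by simp
  have 2: "bil (a x) (gam a x y) y = 1/2 * bil (Da x y) y y"
    using gam_lower[OF x, of y y] a_commute[OF x, of y] by simp
  have 3: "bil (a x) h (gam a x y) = bil (Da x y) h y - 1/2 * bil (Da x h) y y"
    by (rule gam_lower[OF x])
  show ?thesis
    unfolding euler_inner[OF x y] gform_def rform_def sform_def
    by (simp add: 1 2 3 field_simps)
qed

lemma gform_linear [simp]:
  "gform x y h (u + v) = gform x y h u + gform x y h v"
  "gform x y h (u - v) = gform x y h u - gform x y h v"
  "gform x y h (c *\<^sub>R u) = c * gform x y h u"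
  by (simp_all add: gform_def inner_add_right inner_diff_right algebra_simps)

text \<open>In a regular direction \<open>g\<close> is injective, so the spray is characterised by
  \<open>g (4 G) = euler\<close> and the inverse of \<open>g\<close> never has to be
  computed.\<close>

lemma spray_iff:
  assumes x: "x \<in> V" and y: "y \<in> regular_directions F x"
  shows "spray F x y = G \<longleftrightarrow> (\<forall>h. gform x y h (4 *\<^sub>R G - 2 *\<^sub>R gam a x y) =
     (2 * phi_Ab (A x y) (b x \<bullet> y) * bil (a x) h y + phi_bb (A x y) (b x \<bullet> y) * (b x \<bullet> h)) * rform a b x y y
     + 2 * phi_b (A x y) (b x \<bullet> y) * sform b x h y)"
proof -
  let ?g = "fundamental_tensor F x y"
  have y0: "y \<noteq> 0" and inv: "invertible ?g"
    using y by (auto simp: regular_directions_def)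
  have "spray F x y = (1/4) *\<^sub>R (matrix_inv ?g *v euler x y)"
    by (simp add: vec_eq_iff spray_def euler_def matrix_vector_mult_def)
  then have "spray F x y = G \<longleftrightarrow> matrix_inv ?g *v euler x y = 4 *\<^sub>R G"
    by auto
  also have "\<dots> \<longleftrightarrow> euler x y = ?g *v (4 *\<^sub>R G)"
    using matrix_inv_right_left[OF inv] by (metis matrix_vector_mul_assoc matrix_vector_mul_lid)
  also have "\<dots> \<longleftrightarrow> (\<forall>h. h \<bullet> euler x y = gform x y h (4 *\<^sub>R G))"
    unfolding fundamental_tensor_gform[OF x y0, symmetric] bil_def using vector_eq_ldot by metis
  finally show ?thesis
    unfolding euler_gform[OF x y0, symmetric] by (simp add: algebra_simps) metis
qed

end

section \<open>Douglas metrics in the unit gauge\<close>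

lemma phi_square:
  assumes "r > 0"
  shows "phi_A (r\<^sup>2) \<beta> = (r + \<beta>) ^ 3 * (r - \<beta>) / r ^ 4"
    "phi_b (r\<^sup>2) \<beta> = 4 * (r + \<beta>) ^ 3 / r\<^sup>2"
    "phi_Ab (r\<^sup>2) \<beta> = 2 * (r + \<beta>)\<^sup>2 * (r - 2 * \<beta>) / r ^ 4"
    "phi_AA (r\<^sup>2) \<beta> = - (\<beta> * (r + \<beta>)\<^sup>2 * (r - 2 * \<beta>)) / r ^ 6"
    "phi_bb (r\<^sup>2) \<beta> = 12 * (r + \<beta>)\<^sup>2 / r\<^sup>2"
  using assms unfolding phi_A_def phi_b_def phi_Ab_def phi_AA_def phi_bb_def
  by (simp_all add: power_mult[symmetric] field_simps eval_nat_numeral)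

text \<open>Euler's relations for \<open>phi_A\<close>, of degree 0, and for \<open>phi_b\<close>,
  of degree 1, in \<open>r\<close> and \<beta>.\<close>

lemma phi_euler:
  assumes "r > 0"
  shows "2 * r\<^sup>2 * phi_AA (r\<^sup>2) \<beta> + \<beta> * phi_Ab (r\<^sup>2) \<beta> = 0"
    "r\<^sup>2 * phi_Ab (r\<^sup>2) \<beta> + 1/2 * \<beta> * phi_bb (r\<^sup>2) \<beta> = 1/2 * phi_b (r\<^sup>2) \<beta>"
  using assms by (simp_all add: phi_square field_simps, simp_all add: eval_nat_numeral algebra_simps)

text \<open>The equation of \<open>spray_iff\<close> for the candidate spray of
  \<open>douglas_if\<close>, with \<open>p = a(h, y)\<close>, \<open>q = b(h)\<close> and
  \<open>r(y, y) = c (\<alpha>^2 - \<beta>^2)\<close>. The multiples of \<open>B\<close> and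
  \<open>y\<close> on the left are those that make it hold for all \<open>p\<close> and
  \<open>q\<close>.\<close>

lemma spray_identity:
  assumes r: "r > 0"
  shows "4/3 * c * r\<^sup>2 * (phi_A (r\<^sup>2) \<beta> * q + (phi_AA (r\<^sup>2) \<beta> * (2 * \<beta>) + phi_Ab (r\<^sup>2) \<beta>) * p
           + 1/2 * (phi_Ab (r\<^sup>2) \<beta> * (2 * \<beta>) + phi_bb (r\<^sup>2) \<beta>) * q)
        + 4 * (c / 3 * (r - 2 * \<beta>)) * (phi_A (r\<^sup>2) \<beta> * p + 1/2 * phi_b (r\<^sup>2) \<beta> * q)
      = (2 * phi_Ab (r\<^sup>2) \<beta> * p + phi_bb (r\<^sup>2) \<beta> * q) * (c * (r\<^sup>2 - \<beta>\<^sup>2))"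
  using assms unfolding phi_square[OF assms]
  by (simp add: field_simps eval_nat_numeral)

text \<open>A kernel vector \<open>k\<close> of \<open>g\<close>, tested with \<open>y\<close> and
  with \<open>B\<close>, gives two homogeneous linear equations for \<open>p = a(k, y)\<close> and
  \<open>q = b(k)\<close>. Once powers of \<open>r + \<beta>\<close> are cancelled, eliminating
  \<open>p\<close> leaves \<open>3 r^2 (r + \<beta>)^2 q = 0\<close>.\<close>

lemma kernel_identity:
  assumes r: "r > 0" and ne: "r\<^sup>2 \<noteq> \<beta>\<^sup>2"
    and e1: "phi_A (r\<^sup>2) \<beta> * p + 1/2 * phi_b (r\<^sup>2) \<beta> * q = 0"
    and e2: "phi_A (r\<^sup>2) \<beta> * q + (phi_AA (r\<^sup>2) \<beta> * (2 * p) + phi_Ab (r\<^sup>2) \<beta> * q) * \<beta>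
           + 1/2 * (phi_Ab (r\<^sup>2) \<beta> * (2 * p) + phi_bb (r\<^sup>2) \<beta> * q) = 0"
  shows "p = 0" "q = 0"
proof -
  have n: "r + \<beta> \<noteq> 0" "r - \<beta> \<noteq> 0" "r \<noteq> 0"
    using ne r by (auto simp: power2_eq_iff add_eq_0_iff)
  have "phi_A (r\<^sup>2) \<beta> * p + 1/2 * phi_b (r\<^sup>2) \<beta> * q
      = (r + \<beta>) ^ 3 / r ^ 4 * ((r - \<beta>) * p + 2 * r\<^sup>2 * q)"
    unfolding phi_square[OF r] using n by (simp add: field_simps eval_nat_numeral)
  with e1 n have 1: "(r - \<beta>) * p + 2 * r\<^sup>2 * q = 0" by simp
  have "phi_A (r\<^sup>2) \<beta> * q + (phi_AA (r\<^sup>2) \<beta> * (2 * p) + phi_Ab (r\<^sup>2) \<beta> * q) * \<beta>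
           + 1/2 * (phi_Ab (r\<^sup>2) \<beta> * (2 * p) + phi_bb (r\<^sup>2) \<beta> * q)
      = (r + \<beta>)\<^sup>2 / r ^ 6 * (r\<^sup>2 * q * (7 * r\<^sup>2 + 2 * r * \<beta> - 5 * \<beta>\<^sup>2) + 2 * (r - 2 * \<beta>) * (r\<^sup>2 - \<beta>\<^sup>2) * p)"
    unfolding phi_square[OF r] using n by (simp add: field_simps) (simp add: eval_nat_numeral algebra_simps)
  with e2 n have 2: "r\<^sup>2 * q * (7 * r\<^sup>2 + 2 * r * \<beta> - 5 * \<beta>\<^sup>2) + 2 * (r - 2 * \<beta>) * (r\<^sup>2 - \<beta>\<^sup>2) * p = 0" by simp
  have "3 * r\<^sup>2 * (r + \<beta>)\<^sup>2 * q = 0"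
    using 1 2 by algebra
  then show "q = 0" using n by simp
  then show "p = 0" using 1 n by simp
qed

text \<open>Here \<open>y = u + t B\<close> with \<open>u\<close> a unit vector orthogonal to
  \<open>B\<close>, \<open>X = a(u, T)\<close>, \<open>Z = b(T)\<close> for
  \<open>T = T(y, y)\<close>, and \<open>\<rho> = r(u, u)\<close>; \<open>e1\<close> and
  \<open>e2\<close> are the spray equation tested with \<open>u\<close> and \<open>B\<close>.
  Eliminating \<open>P\<close> leaves the factor \<open>r^2 (r + t)^2\<close> times an expression in
  \<open>r^2\<close> alone, so the square root \<open>r\<close> disappears from the
  conclusion.\<close>

lemma eigenvalue_identity:
  assumes r: "r > 0" and rt: "r\<^sup>2 = 1 + t\<^sup>2"
    and e1: "2 * (phi_A (r\<^sup>2) t * X + 2 * phi_AA (r\<^sup>2) t * (X + t * Z) + phi_Ab (r\<^sup>2) t * Z)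
        + 4 * P * phi_A (r\<^sup>2) t = 2 * phi_Ab (r\<^sup>2) t * \<rho>"
    and e2: "2 * (phi_A (r\<^sup>2) t * Z + (2 * phi_AA (r\<^sup>2) t * (X + t * Z) + phi_Ab (r\<^sup>2) t * Z) * t
        + 1/2 * (2 * phi_Ab (r\<^sup>2) t * (X + t * Z) + phi_bb (r\<^sup>2) t * Z))
        + 4 * P * (phi_A (r\<^sup>2) t * t + 1/2 * phi_b (r\<^sup>2) t)
       = (2 * phi_Ab (r\<^sup>2) t * t + phi_bb (r\<^sup>2) t) * \<rho>"
  shows "2 * \<rho> * (1 + t\<^sup>2) = 3 * (Z - t * X)"
proof -
  have n: "r \<noteq> 0" "r + t \<noteq> 0"
    using r rt by (auto simp: add_eq_0_iff)
  have "2 * (phi_A (r\<^sup>2) t * X + 2 * phi_AA (r\<^sup>2) t * (X + t * Z) + phi_Ab (r\<^sup>2) t * Z)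
        + 4 * P * phi_A (r\<^sup>2) t - 2 * phi_Ab (r\<^sup>2) t * \<rho> =
      2 * (r + t)\<^sup>2 / r ^ 6 * ((r\<^sup>2 - t\<^sup>2) * r\<^sup>2 * X - 2 * t * (r - 2 * t) * (X + t * Z)
        + 2 * r\<^sup>2 * (r - 2 * t) * Z + 2 * P * r\<^sup>2 * (r\<^sup>2 - t\<^sup>2) - 2 * r\<^sup>2 * (r - 2 * t) * \<rho>)"
    unfolding phi_square[OF r] using n by (simp add: field_simps) (simp add: eval_nat_numeral algebra_simps)
  with e1 n have 1: "(r\<^sup>2 - t\<^sup>2) * r\<^sup>2 * X - 2 * t * (r - 2 * t) * (X + t * Z)
        + 2 * r\<^sup>2 * (r - 2 * t) * Z + 2 * P * r\<^sup>2 * (r\<^sup>2 - t\<^sup>2) - 2 * r\<^sup>2 * (r - 2 * t) * \<rho> = 0"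
    by simp
  have "2 * (phi_A (r\<^sup>2) t * Z + (2 * phi_AA (r\<^sup>2) t * (X + t * Z) + phi_Ab (r\<^sup>2) t * Z) * t
        + 1/2 * (2 * phi_Ab (r\<^sup>2) t * (X + t * Z) + phi_bb (r\<^sup>2) t * Z))
        + 4 * P * (phi_A (r\<^sup>2) t * t + 1/2 * phi_b (r\<^sup>2) t)
       - (2 * phi_Ab (r\<^sup>2) t * t + phi_bb (r\<^sup>2) t) * \<rho> =
      2 * (r + t)\<^sup>2 / r ^ 6 * ((r\<^sup>2 - t\<^sup>2) * r\<^sup>2 * Z
        + (- 2 * t * (r - 2 * t) * (X + t * Z) + 2 * r\<^sup>2 * (r - 2 * t) * Z) * t
        + 2 * r\<^sup>2 * (r - 2 * t) * (X + t * Z) + 6 * r ^ 4 * Z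
        + 2 * P * r\<^sup>2 * (r + t) * ((r - t) * t + 2 * r\<^sup>2) - 2 * r\<^sup>2 * ((r - 2 * t) * t + 3 * r\<^sup>2) * \<rho>)"
    unfolding phi_square[OF r] using n by (simp add: field_simps) (simp add: eval_nat_numeral algebra_simps)
  with e2 n have 2: "(r\<^sup>2 - t\<^sup>2) * r\<^sup>2 * Z
        + (- 2 * t * (r - 2 * t) * (X + t * Z) + 2 * r\<^sup>2 * (r - 2 * t) * Z) * t
        + 2 * r\<^sup>2 * (r - 2 * t) * (X + t * Z) + 6 * r ^ 4 * Z
        + 2 * P * r\<^sup>2 * (r + t) * ((r - t) * t + 2 * r\<^sup>2) - 2 * r\<^sup>2 * ((r - 2 * t) * t + 3 * r\<^sup>2) * \<rho> = 0"
    by simp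
  have "r\<^sup>2 * (r + t)\<^sup>2 * (3 * (Z - t * X) - 2 * \<rho> * r\<^sup>2) = 0"
    using 1 2 rt by algebra
  then have "3 * (Z - t * X) - 2 * \<rho> * r\<^sup>2 = 0" using n by simp
  then show ?thesis using rt by simp
qed

context smooth_pair
begin

lemma smooth_christoffel: "smooth_on V (\<lambda>x. christoffel a x k i j)"
  unfolding christoffel_def
  by (intro smooth_on_mult smooth_on_sum smooth_on_diff smooth_on_add smooth_on_const smooth_inv open_V
      smooth_on_pderiv_at smooth_entry)

lemma smooth_r_tensor: "smooth_on V (\<lambda>x. r_tensor a b x i j)"
  unfolding r_tensor_def cov_deriv_def
  by (intro smooth_on_mult smooth_on_sum smooth_on_diff smooth_on_add smooth_on_const open_V
      smooth_on_pderiv_at smooth_christoffel smooth_on_vec_nth smooth_b)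

text \<open>The source of the bound on the dimension: two linear conditions on \<open>w\<close>
  leave a nonzero solution.\<close>

lemma exists_orthogonal:
  assumes x: "x \<in> V" and n: "CARD('n) \<ge> 3"
  obtains w where "w \<noteq> 0" "bil (a x) w u = 0" "b x \<bullet> w = 0"
proof -
  have "dim {a x *v u, b x} \<le> card {a x *v u, b x}"
    by (rule dim_le_card) (simp_all add: span_superset)
  also have "\<dots> \<le> 2" by (simp add: card_insert_if)
  finally have "dim {a x *v u, b x} < DIM(real^'n)" using n by simp
  then obtain w where "w \<noteq> 0" "\<And>y. y \<in> span {a x *v u, b x} \<Longrightarrow> orthogonal w y"
    using orthogonal_to_subspace_exists by blast
  then have "orthogonal w (a x *v u)" "orthogonal w (b x)" by (simp_all add: span_base)
  with \<open>w \<noteq> 0\<close> show thesis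
    using that[of w] by (simp add: orthogonal_def bil_def inner_commute)
qed


end

context unit_pair
begin

lemma A_pos: "x \<in> V \<Longrightarrow> y \<noteq> 0 \<Longrightarrow> A x y > 0"
  by (rule pos_a)

text \<open>The classical \<open>g_ij y^j = [F^2 / 2]_{y^i}\<close>: the second derivatives of
  \<open>phi\<close> drop out by Euler's relations.\<close>

lemma gform_y:
  assumes x: "x \<in> V" and y: "y \<noteq> 0"
  shows "gform x y h y = phi_A (A x y) (b x \<bullet> y) * bil (a x) h y + 1/2 * phi_b (A x y) (b x \<bullet> y) * (b x \<bullet> h)"
proof -
  obtain r where r: "r > 0" "A x y = r\<^sup>2"
    using A_pos[OF x y] by (metis real_sqrt_gt_zero real_sqrt_pow2 less_imp_le)
  define \<beta> where "\<beta> = b x \<bullet> y"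
  define p q where "p = bil (a x) h y" and "q = b x \<bullet> h"
  note e = phi_euler[OF r(1), of \<beta>]
  have "gform x y h y = phi_A (r\<^sup>2) \<beta> * p + (2 * r\<^sup>2 * phi_AA (r\<^sup>2) \<beta> + \<beta> * phi_Ab (r\<^sup>2) \<beta>) * p
      + (r\<^sup>2 * phi_Ab (r\<^sup>2) \<beta> + 1/2 * \<beta> * phi_bb (r\<^sup>2) \<beta>) * q"
    by (simp add: gform_def r \<beta>_def p_def q_def algebra_simps)
  also have "\<dots> = phi_A (r\<^sup>2) \<beta> * p + 1/2 * phi_b (r\<^sup>2) \<beta> * q"
    unfolding e by simp
  finally show ?thesis by (simp add: r \<beta>_def p_def q_def)
qed

lemma gform_B:
  assumes x: "x \<in> V"
  shows "gform x y h (B x) = phi_A (A x y) (b x \<bullet> y) * (b x \<bullet> h)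
     + (phi_AA (A x y) (b x \<bullet> y) * (2 * (b x \<bullet> y)) + phi_Ab (A x y) (b x \<bullet> y)) * bil (a x) h y
     + 1/2 * (phi_Ab (A x y) (b x \<bullet> y) * (2 * (b x \<bullet> y)) + phi_bb (A x y) (b x \<bullet> y)) * (b x \<bullet> h)"
  using unit[OF x] x by (simp add: gform_def)

lemma gform_commute: "x \<in> V \<Longrightarrow> gform x y h k = gform x y k h"
  using a_commute[of x h k] by (simp add: gform_def algebra_simps)

text \<open>The spray is that of \<open>\<alpha>\<close> plus \<open>c \<alpha>\<^sup>2 b\<^sup>i / 3 + c (\<alpha> - 2 \<beta>) y\<^sup>i / 3\<close>.\<close>

theorem douglas_if:
  assumes c: "smooth_on V c"
    and s: "\<And>x u v. x \<in> V \<Longrightarrow> sform b x u v = 0"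
    and r: "\<And>x u v. x \<in> V \<Longrightarrow> rform a b x u v = c x * (bil (a x) u v - (b x \<bullet> u) * (b x \<bullet> v))"
  shows "douglas_on V F"
proof -
  \<comment> \<open>\<open>2/3\<close> becomes the \<open>1/3\<close> in front of
    \<open>c \<alpha>^2 B\<close>, since \<Gamma> enters the spray with the factor
    \<open>1/2\<close>.\<close>
  define \<Gamma> where "\<Gamma> i j k x = christoffel a x i j k + 2/3 * c x * a x $ j $ k * B x $ i" for i j k x
  define P where "P x y = c x / 3 * (sqrt (A x y) - 2 * (b x \<bullet> y))" for x y
  have spray: "spray F x y $ i = 1/2 * (\<Sum>j\<in>UNIV. \<Sum>k\<in>UNIV. \<Gamma> i j k x * y $ j * y $ k) + P x y * y $ i"
    if x: "x \<in> V" and reg: "y \<in> regular_directions F x" for x y i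
  proof -
    have y: "y \<noteq> 0" using reg by (auto simp: regular_directions_def)
    obtain r where r': "r > 0" "A x y = r\<^sup>2"
      using A_pos[OF x y] by (metis real_sqrt_gt_zero real_sqrt_pow2 less_imp_le)
    define G where "G = (1/2) *\<^sub>R gam a x y + (c x / 3 * A x y) *\<^sub>R B x + P x y *\<^sub>R y"
    have "gform x y h (4 *\<^sub>R G - 2 *\<^sub>R gam a x y) =
       (2 * phi_Ab (A x y) (b x \<bullet> y) * bil (a x) h y + phi_bb (A x y) (b x \<bullet> y) * (b x \<bullet> h)) * rform a b x y y
       + 2 * phi_b (A x y) (b x \<bullet> y) * sform b x h y" for h
    proof -
      have "4 *\<^sub>R G - 2 *\<^sub>R gam a x y = (4/3 * c x * A x y) *\<^sub>R B x + (4 * P x y) *\<^sub>R y"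
        by (simp add: G_def scaleR_add_right)
      then have "gform x y h (4 *\<^sub>R G - 2 *\<^sub>R gam a x y) =
          4/3 * c x * A x y * gform x y h (B x) + 4 * P x y * gform x y h y"
        by simp
      also have "\<dots> = (2 * phi_Ab (A x y) (b x \<bullet> y) * bil (a x) h y + phi_bb (A x y) (b x \<bullet> y) * (b x \<bullet> h))
          * (c x * (A x y - (b x \<bullet> y)\<^sup>2))"
        using spray_identity[OF r'(1), of "c x" "b x \<bullet> y" "b x \<bullet> h" "bil (a x) h y"] r'
        by (simp only: gform_B[OF x] gform_y[OF x y] P_def r'(2)) simp
      finally show ?thesis using s[OF x] r[OF x] by (simp add: power2_eq_square)
    qed
    then have "spray F x y = G" using spray_iff[OF x reg] by blast
    then show ?thesis
      by (simp add: G_def gam_def \<Gamma>_def bil_sum algebra_simps sum.distrib sum_distrib_left sum_distrib_right)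
  qed
  moreover have "smooth_on V (\<Gamma> i j k)" for i j k
    unfolding \<Gamma>_def[abs_def]
    by (intro smooth_on_add smooth_on_mult smooth_on_const smooth_christoffel smooth_entry c open_V
        smooth_on_vec_nth smooth_B)
  moreover have "P x (t *\<^sub>R y) = t * P x y" if "t > 0" for x t y
    using that by (simp add: P_def real_sqrt_mult algebra_simps)
  ultimately show ?thesis
    unfolding douglas_on_def by blast
qed

text \<open>By \<open>kernel_identity\<close> a kernel vector \<open>k\<close> of \<open>g\<close>
  is orthogonal to \<open>y\<close> and to \<open>B\<close>; then
  \<open>0 = g(k, k) = phi_A a(k, k)\<close> with \<open>phi_A\<close> nonzero. This makes the
  Douglas condition available at concrete directions.\<close>

lemma regular_direction:
  assumes x: "x \<in> V" and y: "y \<noteq> 0" and ne: "A x y \<noteq> (b x \<bullet> y)\<^sup>2"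
  shows "y \<in> regular_directions F x"
proof -
  obtain r where r: "r > 0" "A x y = r\<^sup>2"
    using A_pos[OF x y] by (metis real_sqrt_gt_zero real_sqrt_pow2 less_imp_le)
  have "k = 0" if k: "fundamental_tensor F x y *v k = 0" for k
  proof -
    have g: "gform x y h k = 0" for h
      using k fundamental_tensor_gform[OF x y, of h k] by (simp add: bil_def)
    have e1: "phi_A (r\<^sup>2) (b x \<bullet> y) * bil (a x) k y + 1/2 * phi_b (r\<^sup>2) (b x \<bullet> y) * (b x \<bullet> k) = 0"
      using g[of y] gform_y[OF x y, of k] gform_commute[OF x, of y y k] r by simp
    have e2: "phi_A (r\<^sup>2) (b x \<bullet> y) * (b x \<bullet> k)
        + (phi_AA (r\<^sup>2) (b x \<bullet> y) * (2 * bil (a x) k y) + phi_Ab (r\<^sup>2) (b x \<bullet> y) * (b x \<bullet> k)) * (b x \<bullet> y)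
        + 1/2 * (phi_Ab (r\<^sup>2) (b x \<bullet> y) * (2 * bil (a x) k y) + phi_bb (r\<^sup>2) (b x \<bullet> y) * (b x \<bullet> k)) = 0"
      using g[of "B x"] x unit[OF x] unfolding gform_def r by simp
    have pq: "bil (a x) k y = 0" "b x \<bullet> k = 0"
      using kernel_identity[OF r(1) _ e1 e2] ne r(2) by auto
    have "r + b x \<bullet> y \<noteq> 0" "r - b x \<bullet> y \<noteq> 0"
      using ne r by (auto simp: power2_eq_iff add_eq_0_iff)
    then have "phi_A (r\<^sup>2) (b x \<bullet> y) \<noteq> 0"
      using r by (simp add: phi_square)
    then have "bil (a x) k k = 0"
      using g[of k] pq by (simp add: gform_def r)
    then show "k = 0" using A_pos[OF x, of k] by auto
  qed
  then have "invertible (fundamental_tensor F x y)"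
    by (metis invertible_left_inverse matrix_left_invertible_ker)
  then show ?thesis using y by (simp add: regular_directions_def)
qed

text \<open>The difference between the coefficients \<Gamma> and the Levi-Civita connection of
  \<alpha>. No symmetry of \<Gamma> in its lower indices is assumed, which is why
  \<open>T u B + T B u\<close> occurs below.\<close>

definition T :: "('n \<Rightarrow> 'n \<Rightarrow> 'n \<Rightarrow> real^'n \<Rightarrow> real) \<Rightarrow> real^'n \<Rightarrow> real^'n \<Rightarrow> real^'n \<Rightarrow> real^'n" where
  "T \<Gamma> x u v = (\<chi> i. \<Sum>j\<in>UNIV. \<Sum>k\<in>UNIV. (\<Gamma> i j k x - christoffel a x i j k) * u $ j * v $ k)"

lemma T_linear [simp]:
  "T \<Gamma> x (u + u') v = T \<Gamma> x u v + T \<Gamma> x u' v"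
  "T \<Gamma> x u (v + v') = T \<Gamma> x u v + T \<Gamma> x u v'"
  "T \<Gamma> x (c *\<^sub>R u) v = c *\<^sub>R T \<Gamma> x u v"
  "T \<Gamma> x u (c *\<^sub>R v) = c *\<^sub>R T \<Gamma> x u v"
  "T \<Gamma> x (u - u') v = T \<Gamma> x u v - T \<Gamma> x u' v"
  "T \<Gamma> x u (v - v') = T \<Gamma> x u v - T \<Gamma> x u v'"
  by (simp_all add: T_def vec_eq_iff sum.distrib sum_subtractf distrib_left distrib_right
      left_diff_distrib right_diff_distrib sum_distrib_left mult_ac)

lemma T_minus: "T \<Gamma> x (- y) (- y) = T \<Gamma> x y y"
  by (simp add: T_def)

definition douglas_at ::
  "('n \<Rightarrow> 'n \<Rightarrow> 'n \<Rightarrow> real^'n \<Rightarrow> real) \<Rightarrow> (real^'n \<Rightarrow> real^'n \<Rightarrow> real) \<Rightarrow> real^'n \<Rightarrow> bool" where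
  "douglas_at \<Gamma> P x \<longleftrightarrow> (\<forall>y\<in>regular_directions F x. \<forall>i. spray F x y $ i =
     1/2 * (\<Sum>j\<in>UNIV. \<Sum>k\<in>UNIV. \<Gamma> i j k x * y $ j * y $ k) + P x y * y $ i)"

lemma douglas_equation:
  assumes x: "x \<in> V" and y: "y \<noteq> 0" and ne: "A x y \<noteq> (b x \<bullet> y)\<^sup>2"
    and dg: "douglas_at \<Gamma> P x"
  shows "2 * gform x y h (T \<Gamma> x y y) + 4 * P x y * gform x y h y =
     (2 * phi_Ab (A x y) (b x \<bullet> y) * bil (a x) h y + phi_bb (A x y) (b x \<bullet> y) * (b x \<bullet> h)) * rform a b x y y
     + 2 * phi_b (A x y) (b x \<bullet> y) * sform b x h y"
proof -
  have reg: "y \<in> regular_directions F x"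
    by (rule regular_direction[OF x y ne])
  have "4 *\<^sub>R spray F x y - 2 *\<^sub>R gam a x y = 2 *\<^sub>R T \<Gamma> x y y + (4 * P x y) *\<^sub>R y"
    using dg reg unfolding douglas_at_def
    by (simp add: vec_eq_iff T_def gam_def left_diff_distrib sum_subtractf)
  then show ?thesis
    using spray_iff[OF x reg, of "spray F x y"] by simp
qed

text \<open>For \<open>h\<close> orthogonal to \<open>y\<close> and \<open>b\<close> the equation reads \<open>(\<alpha> - \<beta>) a(h, T) = 4 \<alpha>\<^sup>2 s(h, y)\<close>.
  Adding it for \<open>y\<close> and \<open>-y\<close> leaves \<open>2 \<alpha> a(h, T) = 0\<close>.\<close>

lemma orthogonal_direction:
  assumes x: "x \<in> V" and y: "y \<noteq> 0" and ne: "A x y \<noteq> (b x \<bullet> y)\<^sup>2"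
    and dg: "douglas_at \<Gamma> P x"
    and h: "bil (a x) h y = 0" "b x \<bullet> h = 0"
  shows "bil (a x) h (T \<Gamma> x y y) = 0" "sform b x h y = 0"
proof -
  obtain r where r: "r > 0" "A x y = r\<^sup>2"
    using A_pos[OF x y] by (metis real_sqrt_gt_zero real_sqrt_pow2 less_imp_le)
  define \<beta> where "\<beta> = b x \<bullet> y"
  have n: "r + \<beta> \<noteq> 0" "r - \<beta> \<noteq> 0" "r \<noteq> 0"
    using ne r by (auto simp: power2_eq_iff add_eq_0_iff \<beta>_def)
  have s: "sform b x h (- y) = - sform b x h y"
    using bilinear_rneg[OF bilinear_sform[OF x]] .
  define X S where "X = bil (a x) h (T \<Gamma> x y y)" and "S = sform b x h y"
  \<comment> \<open>\<open>P\<close> is absent: \<open>g(h, y) = 0\<close> for this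
    \<open>h\<close>, so the unrelated values of \<open>P\<close> at \<open>y\<close> and
    \<open>-y\<close> do no harm.\<close>
  have 1: "phi_A (r\<^sup>2) \<beta> * X = phi_b (r\<^sup>2) \<beta> * S"
    using douglas_equation[OF x y ne dg, where h=h] h r
    by (simp add: gform_y[OF x y]) (simp add: gform_def h \<beta>_def X_def S_def)
  \<comment> \<open>Passing to \<open>-y\<close> keeps \<alpha> and \<open>T(y, y)\<close> but
    changes the signs of \<beta> and \<open>s(h, y)\<close>.\<close>
  have 2: "phi_A (r\<^sup>2) (- \<beta>) * X = - phi_b (r\<^sup>2) (- \<beta>) * S"
    using douglas_equation[OF x _ _ dg, where h=h and y="-y"] y ne h r s
    by (simp add: gform_y[OF x] T_minus) (simp add: gform_def h \<beta>_def X_def S_def T_minus)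
  have "phi_A (r\<^sup>2) \<beta> * X - phi_b (r\<^sup>2) \<beta> * S = (r + \<beta>) ^ 3 / r ^ 4 * ((r - \<beta>) * X - 4 * r\<^sup>2 * S)"
    unfolding phi_square[OF r(1)] using n(3) by (simp add: field_simps eval_nat_numeral)
  with 1 have 3: "(r - \<beta>) * X - 4 * r\<^sup>2 * S = 0" using n by simp
  have "phi_A (r\<^sup>2) (- \<beta>) * X + phi_b (r\<^sup>2) (- \<beta>) * S = (r - \<beta>) ^ 3 / r ^ 4 * ((r + \<beta>) * X + 4 * r\<^sup>2 * S)"
    unfolding phi_square[OF r(1)] using n(3) by (simp add: field_simps eval_nat_numeral)
  with 2 have 4: "(r + \<beta>) * X + 4 * r\<^sup>2 * S = 0" using n by simp
  from 3 4 have "r * X = 0" by algebra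
  then show "bil (a x) h (T \<Gamma> x y y) = 0" using n by (simp add: X_def)
  then show "sform b x h y = 0" using 3 n by (simp add: X_def S_def)
qed

theorem douglas_only_if:
  assumes n: "CARD('n) \<ge> 3" and D: "douglas_on V F" and x: "x \<in> V"
  obtains c where "\<And>u v. sform b x u v = 0"
    "\<And>u v. rform a b x u v = c * (bil (a x) u v - (b x \<bullet> u) * (b x \<bullet> v))"
proof -
  from D obtain \<Gamma> P where "\<forall>x\<in>V. \<forall>y\<in>regular_directions F x. \<forall>i.
           spray F x y $ i =
             1/2 * (\<Sum>j\<in>UNIV. \<Sum>k\<in>UNIV. \<Gamma> i j k x * y $ j * y $ k) + P x y * y $ i"
    unfolding douglas_on_def by blast
  then have dg: "douglas_at \<Gamma> P x"
    using x by (simp add: douglas_at_def)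
  note orth = orthogonal_direction[OF x _ _ dg]
  note deq = douglas_equation[OF x _ _ dg]
  note bs = bilinear_ladd[OF bilinear_sform[OF x]] bilinear_radd[OF bilinear_sform[OF x]]
    bilinear_lmul[OF bilinear_sform[OF x]] bilinear_rmul[OF bilinear_sform[OF x]]
    bilinear_lsub[OF bilinear_sform[OF x]] bilinear_rsub[OF bilinear_sform[OF x]]
  note br = bilinear_ladd[OF bilinear_rform[OF x]] bilinear_radd[OF bilinear_rform[OF x]]
    bilinear_lmul[OF bilinear_rform[OF x]] bilinear_rmul[OF bilinear_rform[OF x]]
    bilinear_lsub[OF bilinear_rform[OF x]] bilinear_rsub[OF bilinear_rform[OF x]]
  define W where "W = {w. b x \<bullet> w = 0}"
  note ac = a_commute[OF x]
  \<comment> \<open>For nonzero \<open>w\<close> in \<open>W\<close> one has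
    \<open>\<alpha>^2 = a(w, w) + t^2 > t^2 = \<beta>^2\<close>, so the whole line
    \<open>w + t B\<close> avoids the degenerate directions.\<close>
  have A_ne: "A x (w + t *\<^sub>R B x) = A x w + t\<^sup>2 \<and> b x \<bullet> (w + t *\<^sub>R B x) = t
      \<and> (w \<noteq> 0 \<longrightarrow> w + t *\<^sub>R B x \<noteq> 0 \<and> A x (w + t *\<^sub>R B x) \<noteq> (b x \<bullet> (w + t *\<^sub>R B x))\<^sup>2)"
    if "w \<in> W" for w t
  proof -
    have 1: "A x (w + t *\<^sub>R B x) = A x w + t\<^sup>2" "b x \<bullet> (w + t *\<^sub>R B x) = t"
      using that x unit[OF x] by (simp_all add: W_def power2_eq_square inner_add_right)
    moreover have "w + t *\<^sub>R B x \<noteq> 0 \<and> A x (w + t *\<^sub>R B x) \<noteq> (b x \<bullet> (w + t *\<^sub>R B x))\<^sup>2" if "w \<noteq> 0"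
      using A_pos[OF x that] 1 by (smt (verit) bil_linear(5) power2_less_0)
    ultimately show ?thesis by blast
  qed
  have sWW: "sform b x h y = 0" if "h \<in> W" "y \<in> W" for h y
  proof (cases "y = 0")
    case True
    then show ?thesis using bilinear_rzero[OF bilinear_sform[OF x]] by simp
  next
    case False
    \<comment> \<open>Removing from \<open>h\<close> its component along \<open>y\<close> changes
      nothing in \<open>s(h, y)\<close>, because \<open>s(y, y) = 0\<close>.\<close>
    define k where "k = bil (a x) h y / A x y"
    have "sform b x (h - k *\<^sub>R y) y = 0"
      using orth(2)[OF False, of "h - k *\<^sub>R y"] A_ne[OF that(2), of 0] A_pos[OF x False] that False
      by (simp add: k_def W_def inner_diff_right)
    moreover have "sform b x y y = 0" by (simp add: sform_def)
    ultimately show ?thesis by (simp add: bs)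
  qed
  have sWB: "sform b x h (B x) = 0" if h: "h \<in> W" for h
  proof -
    \<comment> \<open>With \<open>y\<close> in \<open>W\<close> orthogonal to \<open>h\<close>, the
      vector \<open>h\<close> is orthogonal to \<open>y + B\<close> and to \<open>B\<close>, so
      \<open>s(h, y) + s(h, B) = 0\<close>, where the first term is already known to vanish.\<close>
    obtain y where y: "y \<noteq> 0" "bil (a x) y h = 0" "b x \<bullet> y = 0"
      using exists_orthogonal[OF x n] by blast
    then have yW: "y \<in> W" by (simp add: W_def)
    have "sform b x h (y + 1 *\<^sub>R B x) = 0"
      using orth(2)[of "y + 1 *\<^sub>R B x" h] A_ne[OF yW, of 1] A_pos[OF x y(1)] y h x ac[of h y]
      by (simp add: W_def)
    then show ?thesis using sWW[OF h yW] by (simp add: bs)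
  qed
  define pr where "pr u = u - (b x \<bullet> u) *\<^sub>R B x" for u
  have pr: "pr u \<in> W" "u = pr u + (b x \<bullet> u) *\<^sub>R B x" for u
    using unit[OF x] by (simp_all add: W_def pr_def inner_diff_right)
  have s0: "sform b x u v = 0" for u v
  proof -
    have "sform b x (pr u + (b x \<bullet> u) *\<^sub>R B x) (pr v + (b x \<bullet> v) *\<^sub>R B x) = 0"
      using sWW[OF pr(1)[of u] pr(1)[of v]] sWB[OF pr(1)[of u]] sWB[OF pr(1)[of v]] sform_anti[of x "B x" "pr v"]
      by (simp add: bs) (simp add: sform_def)
    then show ?thesis using pr(2) by metis
  qed
  \<comment> \<open>\<open>N\<close> is constantly 1, so the derivative given by
    \<open>N_deriv\<close> vanishes.\<close>
  have rB: "rform a b x (B x) k = 0" for k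
  proof -
    have "((\<lambda>z. 1) has_derivative (\<lambda>k. 2 * (rform a b x (B x) k + sform b x (B x) k))) (at x)"
      by (rule has_derivative_transform_within_open[OF N_deriv[OF x] open_V x]) (simp add: unit)
    from has_derivative_unique[OF this has_derivative_const] have "2 * (rform a b x (B x) k + sform b x (B x) k) = 0"
      by metis
    then show ?thesis using s0 by simp
  qed
  \<comment> \<open>With \<open>y = u + t B\<close>, \<open>q v u\<close> is the coefficient of
    \<open>t\<close> in \<open>a(v, T(y, y))\<close>, and \<kappa> is the coefficient of
    \<open>t^2\<close> in \<open>b(T(y, y))\<close>.\<close>
  define q where "q v u = bil (a x) v (T \<Gamma> x u (B x) + T \<Gamma> x (B x) u)" for v u
  define \<kappa> where "\<kappa> = b x \<bullet> T \<Gamma> x (B x) (B x)"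
  have T_exp: "T \<Gamma> x (u + t *\<^sub>R B x) (u + t *\<^sub>R B x) =
      T \<Gamma> x u u + t *\<^sub>R (T \<Gamma> x u (B x) + T \<Gamma> x (B x) u) + t\<^sup>2 *\<^sub>R T \<Gamma> x (B x) (B x)" for u t
    by (simp add: algebra_simps power2_eq_square)
  have q_orth: "q v u = 0" if "u \<in> W" "v \<in> W" "bil (a x) v u = 0" for u v
  proof (cases "u = 0")
    case True
    have "T \<Gamma> x 0 w = 0" "T \<Gamma> x w 0 = 0" for w by (simp_all add: T_def vec_eq_iff)
    then show ?thesis by (simp add: True q_def)
  next
    case False
    have "bil (a x) v (T \<Gamma> x (u + t *\<^sub>R B x) (u + t *\<^sub>R B x)) = 0" for t
      using orth(1)[of "u + t *\<^sub>R B x" v] A_ne[OF that(1), of t] A_pos[OF x False] False that x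
      by (simp add: W_def)
    \<comment> \<open>The difference of the two values isolates the odd part in \<open>t\<close>,
      which is \<open>2 q v u\<close>.\<close>
    from this[of 1] this[of "-1"] show ?thesis
      unfolding T_exp q_def by simp
  qed
  have rho: "2 * rform a b x u u = 3 * (\<kappa> - q u u)" if u: "u \<in> W" "A x u = 1" for u
  proof -
    have u0: "u \<noteq> 0" using u by auto
    define \<rho> where "\<rho> = rform a b x u u"
    define X Z where "X t = bil (a x) u (T \<Gamma> x (u + t *\<^sub>R B x) (u + t *\<^sub>R B x))"
      and "Z t = b x \<bullet> T \<Gamma> x (u + t *\<^sub>R B x) (u + t *\<^sub>R B x)" for t
    have eq: "2 * \<rho> * (1 + t\<^sup>2) = 3 * (Z t - t * X t)" for t
    proof -
      define y where "y = u + t *\<^sub>R B x"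
      define r where "r = sqrt (1 + t\<^sup>2)"
      have r: "r > 0" "r\<^sup>2 = 1 + t\<^sup>2" by (simp_all add: r_def add_pos_nonneg)
      have y: "A x y = r\<^sup>2" "b x \<bullet> y = t" "y \<noteq> 0" "A x y \<noteq> (b x \<bullet> y)\<^sup>2"
        using A_ne[OF u(1), of t] u0 u(2) by (auto simp: y_def r(2))
      have bu: "b x \<bullet> u = 0" "bil (a x) u y = 1" "bil (a x) (B x) y = t"
        using u x y unit[OF x] by (simp_all add: y_def W_def)
      have ryy: "rform a b x y y = \<rho>"
        using rB rform_commute[OF x, of u "B x"] by (simp add: y_def br \<rho>_def)
      have Ty: "bil (a x) (T \<Gamma> x y y) y = X t + t * Z t"
        using x ac[of "T \<Gamma> x y y" u] by (simp add: X_def Z_def y_def inner_add_right)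
      have Tu: "bil (a x) u (T \<Gamma> x y y) = X t" "b x \<bullet> T \<Gamma> x y y = Z t"
        by (simp_all add: X_def Z_def y_def)
      have e1: "2 * (phi_A (r\<^sup>2) t * X t + 2 * phi_AA (r\<^sup>2) t * (X t + t * Z t) + phi_Ab (r\<^sup>2) t * Z t)
        + 4 * P x y * phi_A (r\<^sup>2) t = 2 * phi_Ab (r\<^sup>2) t * \<rho>"
        using deq[OF y(3,4), of u] unfolding gform_y[OF x y(3)] unfolding gform_def y(1,2) bu ryy s0 Tu Ty
        by (simp add: algebra_simps)
      have e2: "2 * (phi_A (r\<^sup>2) t * Z t + (2 * phi_AA (r\<^sup>2) t * (X t + t * Z t) + phi_Ab (r\<^sup>2) t * Z t) * t
        + 1/2 * (2 * phi_Ab (r\<^sup>2) t * (X t + t * Z t) + phi_bb (r\<^sup>2) t * Z t))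
        + 4 * P x y * (phi_A (r\<^sup>2) t * t + 1/2 * phi_b (r\<^sup>2) t)
       = (2 * phi_Ab (r\<^sup>2) t * t + phi_bb (r\<^sup>2) t) * \<rho>"
        using deq[OF y(3,4), of "B x"] unfolding gform_y[OF x y(3)]
        unfolding gform_def y(1,2) bu ryy s0 Tu Ty bil_B[OF x] unit[OF x]
        by (simp add: algebra_simps)
      show ?thesis by (rule eigenvalue_identity[OF r e1 e2])
    qed
    have XZ: "X t = X 0 + t * q u u + t\<^sup>2 * bil (a x) u (T \<Gamma> x (B x) (B x))"
      "Z t = Z 0 + t * (b x \<bullet> (T \<Gamma> x u (B x) + T \<Gamma> x (B x) u)) + t\<^sup>2 * \<kappa>" for t
      unfolding X_def Z_def T_exp q_def \<kappa>_def by (simp_all add: inner_add_right)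
    \<comment> \<open>The even part decides: \<open>t = 0\<close> gives
      \<open>2 \<rho> = 3 Z 0\<close>, and \<open>t = 1\<close> and \<open>t = -1\<close> together
      give \<open>8 \<rho> = 6 (Z 0 + \<kappa> - q u u)\<close>.\<close>
    show ?thesis
      using eq[of 0] eq[of 1] eq[of "-1"] XZ[of 1] XZ[of "-1"] by (simp add: \<rho>_def algebra_simps)
  qed
  obtain e0 where e0: "e0 \<noteq> 0" "b x \<bullet> e0 = 0"
    using exists_orthogonal[OF x n] by metis
  define e where "e = (1 / sqrt (A x e0)) *\<^sub>R e0"
  have e: "e \<in> W" "A x e = 1"
    using e0 A_pos[OF x e0(1)] by (simp_all add: e_def W_def)
  define m where "m = q e e"
  have qb: "q (u + u') v = q u v + q u' v" "q u (v + v') = q u v + q u v'"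
    "q (c *\<^sub>R u) v = c * q u v" "q u (c *\<^sub>R v) = c * q u v"
    "q (u - u') v = q u v - q u' v" "q u (v - v') = q u v - q u v'" for u u' v v' c
    unfolding q_def by (simp_all add: algebra_simps)
  have q_eq: "q u u = m * A x u" if u: "u \<in> W" for u
  proof -
    define k where "k = bil (a x) u e"
    define u' where "u' = u - k *\<^sub>R e"
    have u': "u' \<in> W" "bil (a x) u' e = 0" "bil (a x) e u' = 0" "u = k *\<^sub>R e + u'"
      using u e ac[of e u] by (simp_all add: u'_def W_def inner_diff_right k_def)
    \<comment> \<open>\<open>l e\<close> and \<open>u'\<close> are orthogonal and of equal length,
      so \<open>l e + u'\<close> and \<open>l e - u'\<close> are orthogonal too. Hence
      \<open>q\<close> vanishes on this pair, which compares \<open>q u' u'\<close> with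
      \<open>l^2 m\<close>.\<close>
    define l where "l = sqrt (A x u')"
    have l: "l\<^sup>2 = A x u'" using bil_nonneg[OF x, of u'] by (simp add: l_def)
    have lW: "l *\<^sub>R e \<in> W" using e by (simp add: W_def)
    have "q (l *\<^sub>R e + u') (l *\<^sub>R e - u') = 0"
      using u' e lW l by (intro q_orth) (simp_all add: W_def inner_add_right inner_diff_right power2_eq_square)
    moreover have "q e u' = 0" "q u' e = 0"
      using u' e by (auto intro!: q_orth)
    ultimately have "q u' u' = m * A x u'"
      by (simp add: qb l[symmetric] m_def power2_eq_square mult_ac)
    then have "q (k *\<^sub>R e + u') (k *\<^sub>R e + u') = m * A x (k *\<^sub>R e + u')"
      using \<open>q e u' = 0\<close> \<open>q u' e = 0\<close> u' e(2) by (simp add: qb m_def algebra_simps)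
    then show ?thesis using u'(4) by simp
  qed
  define c where "c = 3/2 * (\<kappa> - m)"
  have rW: "rform a b x u u = c * A x u" if u: "u \<in> W" for u
  proof (cases "u = 0")
    case True
    then show ?thesis using bilinear_rzero[OF bilinear_rform[OF x]] by simp
  next
    case False
    define l where "l = sqrt (A x u)"
    have l: "l\<^sup>2 = A x u" "l > 0" using A_pos[OF x False] by (simp_all add: l_def)
    define w where "w = (1/l) *\<^sub>R u"
    have w: "w \<in> W" "A x w = 1" "u = l *\<^sub>R w"
      using u l by (simp_all add: w_def W_def power2_eq_square[symmetric])
        (simp add: power2_eq_square l(1)[symmetric])
    have "rform a b x w w = c"
      using rho[OF w(1,2)] q_eq[OF w(1)] w(2) by (simp add: c_def)
    then show ?thesis using w by (simp add: br)
  qed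
  have rq: "rform a b x u u = c * (A x u - (b x \<bullet> u)\<^sup>2)" for u
  proof -
    have "rform a b x (pr u + (b x \<bullet> u) *\<^sub>R B x) (pr u + (b x \<bullet> u) *\<^sub>R B x) = rform a b x (pr u) (pr u)"
      using rB rform_commute[OF x, of _ "B x"] by (simp add: br)
    moreover have "A x (pr u + (b x \<bullet> u) *\<^sub>R B x) = A x (pr u) + (b x \<bullet> u)\<^sup>2"
      using A_ne[OF pr(1)[of u]] by blast
    ultimately show ?thesis using rW[OF pr(1)[of u]] pr(2)[of u] by simp
  qed
  have "rform a b x u v = c * (bil (a x) u v - (b x \<bullet> u) * (b x \<bullet> v))" for u v
    using rq[of "u + v"] rq[of u] rq[of v] rform_commute[OF x, of v u] ac[of v u]
    by (simp add: br inner_add_right power2_eq_square algebra_simps)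
  with s0 that show thesis by blast
qed

end

section \<open>Deformations of a pair\<close>

context smooth_pair
begin

lemma raised_unique:
  assumes x: "x \<in> V" and w: "\<And>h. bil (a x) h w = b x \<bullet> h"
  shows "B x = w"
proof -
  have "bil (a x) (B x - w) (B x - w) = 0"
    using w[of "B x - w"] x by (simp add: inner_diff_right)
  then show ?thesis using pos_a[OF x, of "B x - w"] by auto
qed

end

text \<open>\<open>w\<close> is the factor by which the raised form changes:
  \<open>a0 B = (p + q N) b\<close>, so by \<open>u_eq\<close> the form \<open>u b\<close> is raised
  to \<open>w B\<close>. Prescribing \<open>w\<close> replaces computing the inverse of
  \<open>a0\<close>.\<close>

locale deformation = P: smooth_pair V a b + Q: smooth_pair V a0 b0
  for V :: "(real^'n::finite) set" and a b a0 b0 +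
  fixes p q u w :: "real^'n \<Rightarrow> real"
  assumes a0_eq: "x \<in> V \<Longrightarrow> bil (a0 x) h k = p x * bil (a x) h k + q x * (b x \<bullet> h) * (b x \<bullet> k)"
    and b0_eq: "x \<in> V \<Longrightarrow> b0 x = u x *\<^sub>R b x"
    and u_eq: "x \<in> V \<Longrightarrow> u x = w x * (p x + q x * (b x \<bullet> raised a b x))"
begin

lemma raised_deformed: "x \<in> V \<Longrightarrow> raised a0 b0 x = w x *\<^sub>R raised a b x"
  by (rule Q.raised_unique) (simp_all add: a0_eq b0_eq u_eq algebra_simps)

context
  fixes x and p' q' u' :: "real^'n \<Rightarrow> real"
  assumes x: "x \<in> V" and p': "(p has_derivative p') (at x)" and q': "(q has_derivative q') (at x)"
    and u': "(u has_derivative u') (at x)"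
begin

lemma Db0: "frechet_derivative b0 (at x) k = u' k *\<^sub>R b x + u x *\<^sub>R P.Db x k"
proof -
  have "(b0 has_derivative (\<lambda>k. u x *\<^sub>R P.Db x k + u' k *\<^sub>R b x)) (at x)"
    by (rule has_derivative_transform_within_open[OF has_derivative_scaleR[OF u' P.b_deriv[OF x]] P.open_V x])
      (simp add: b0_eq)
  from has_derivative_unique[OF Q.b_deriv[OF x] this] show ?thesis by (simp add: fun_eq_iff)
qed

lemma Da0: "bil (frechet_derivative a0 (at x) k) h l = p' k * bil (a x) h l + p x * bil (P.Da x k) h l
    + q' k * (b x \<bullet> h) * (b x \<bullet> l) + q x * ((P.Db x k \<bullet> h) * (b x \<bullet> l) + (b x \<bullet> h) * (P.Db x k \<bullet> l))"
proof -
  note bh = has_derivative_inner_left[OF P.b_deriv[OF x]]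
  have "((\<lambda>z. bil (a0 z) h l) has_derivative (\<lambda>k. (p x * bil (P.Da x k) h l + p' k * bil (a x) h l)
      + (q x * (b x \<bullet> h) * (P.Db x k \<bullet> l) + (q x * (P.Db x k \<bullet> h) + q' k * (b x \<bullet> h)) * (b x \<bullet> l)))) (at x)"
    by (rule has_derivative_transform_within_open[OF has_derivative_add[OF has_derivative_mult[OF p' P.bil_deriv[OF x, of h l]]
            has_derivative_mult[OF has_derivative_mult[OF q' bh[of h]] bh[of l]]] P.open_V x])
      (simp add: a0_eq)
  from has_derivative_unique[OF Q.bil_deriv[OF x] this] show ?thesis
    by (simp add: fun_eq_iff algebra_simps)
qed

lemma sform_deformed:
  "sform b0 x h k = u x * sform b x h k + 1/2 * (u' k * (b x \<bullet> h) - u' h * (b x \<bullet> k))"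
  by (simp add: sform_def Db0 inner_add_left field_simps)

text \<open>The derivative of \<open>q b b\<close> contributes \<open>Db\<close> in two ways:
  symmetrised, which lowers the coefficient of \<open>r\<close> from \<open>u\<close> to
  \<open>u - w q N = w p\<close>, and antisymmetrised with one slot \<open>B\<close>, which is the
  last term.\<close>

lemma rform_deformed:
  "rform a0 b0 x h k = w x * p x * rform a b x h k + 1/2 * (u' k * (b x \<bullet> h) + u' h * (b x \<bullet> k))
    - 1/2 * w x * ((p' h + q' h * P.N x) * (b x \<bullet> k) + (p' k + q' k * P.N x) * (b x \<bullet> h))
    + 1/2 * w x * (p' (P.B x) * bil (a x) h k + q' (P.B x) * (b x \<bullet> h) * (b x \<bullet> k))
    - w x * q x * (sform b x (P.B x) h * (b x \<bullet> k) + sform b x (P.B x) k * (b x \<bullet> h))"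
proof -
  have lin: "linear (frechet_derivative a0 (at x))" by (rule Q.Da_linear[OF x])
  show ?thesis
    unfolding rform_def sform_def raised_deformed[OF x]
    by (simp add: Db0 Da0 linear_scale[OF lin] inner_add_left P.bil_B[OF x] u_eq[OF x]) (simp add: field_simps)
qed

end

end

section \<open>The equations for \<open>r\<close> and \<open>s\<close> at a point and their passage
  to the unit gauge\<close>

definition unit_eq ::
  "(real^'n::finite \<Rightarrow> real^'n^'n) \<Rightarrow> (real^'n \<Rightarrow> real^'n) \<Rightarrow> real^'n \<Rightarrow> real \<Rightarrow> bool" where
  "unit_eq a b x c \<longleftrightarrow> (\<forall>h k. sform b x h k = 0 \<and>
     rform a b x h k = c * (bil (a x) h k - (b x \<bullet> h) * (b x \<bullet> k)))"

definition s_eq ::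
  "(real^'n::finite \<Rightarrow> real^'n^'n) \<Rightarrow> (real^'n \<Rightarrow> real^'n) \<Rightarrow> real^'n \<Rightarrow> bool" where
  "s_eq a b x \<longleftrightarrow> (\<forall>h k. sform b x h k = 1 / (b x \<bullet> raised a b x) *
     ((b x \<bullet> h) * sform b x (raised a b x) k - (b x \<bullet> k) * sform b x (raised a b x) h))"

text \<open>\<open>m = 3\<close> is the equation of (\<alpha>, \<beta>). \<open>m = 0\<close> is
  that of a barred pair, with \<open>d = 0\<close> in case (i) and
  \<open>(c, d) = (\<tau> b^2, - \<tau>)\<close> in case (ii).\<close>

definition r_eq ::
  "(real^'n::finite \<Rightarrow> real^'n^'n) \<Rightarrow> (real^'n \<Rightarrow> real^'n) \<Rightarrow> real^'n \<Rightarrow> real \<Rightarrow> real \<Rightarrow> real \<Rightarrow> bool" where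
  "r_eq a b x c d m \<longleftrightarrow> (\<forall>h k. rform a b x h k = c * bil (a x) h k + d * (b x \<bullet> h) * (b x \<bullet> k)
     - m / (b x \<bullet> raised a b x) * (sform b x (raised a b x) h * (b x \<bullet> k) + sform b x (raised a b x) k * (b x \<bullet> h)))"

context smooth_pair
begin

lemma sform_BB: "sform b x (B x) (B x) = 0"
  by (simp add: sform_def)

lemma N_deriv_r_eq:
  assumes x: "x \<in> V" and r: "r_eq a b x c d m"
  shows "(N has_derivative (\<lambda>k. 2 * (c + d * N x) * (b x \<bullet> k) + (2 - 2 * m) * sform b x (B x) k)) (at x)"
proof (rule has_derivative_eq_rhs[OF N_deriv[OF x]])
  have *: "rform a b x (B x) k = (c + d * N x) * (b x \<bullet> k) - m * sform b x (B x) k" for k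
    using r[unfolded r_eq_def, rule_format, of "B x" k] x N_pos[OF x] by (simp add: sform_BB algebra_simps)
  show "(\<lambda>k. 2 * (rform a b x (B x) k + sform b x (B x) k)) =
      (\<lambda>k. 2 * (c + d * N x) * (b x \<bullet> k) + (2 - 2 * m) * sform b x (B x) k)"
    unfolding * by (simp add: fun_eq_iff algebra_simps)
qed

end

text \<open>The passage to \<open>b = 1\<close>: \<open>\<alpha>\<close> is multiplied by \<open>b\<^sup>2\<close> and \<open>\<beta>\<close> by \<open>b\<close>, with \<open>b\<^sup>2\<close> written \<open>N\<close>.\<close>

locale gauge = deformation V a b a0 b0 "\<lambda>x. (b x \<bullet> raised a b x)\<^sup>2" "\<lambda>x. 0"
    "\<lambda>x. sqrt (b x \<bullet> raised a b x)"
    "\<lambda>x. 1 / ((b x \<bullet> raised a b x) * sqrt (b x \<bullet> raised a b x))"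
  for V :: "(real^'n::finite) set" and a b a0 b0
begin

context
  fixes x N' assumes x: "x \<in> V" and N': "(P.N has_derivative N') (at x)"
begin

lemma N_square_deriv: "((\<lambda>x. (P.N x)\<^sup>2) has_derivative (\<lambda>k. 2 * P.N x * N' k)) (at x)"
  by (rule has_derivative_eq_rhs[OF has_derivative_power[OF N']]) (simp add: mult_ac)

lemma sqrt_N_deriv: "((\<lambda>x. sqrt (P.N x)) has_derivative (\<lambda>k. N' k / (2 * sqrt (P.N x)))) (at x)"
  by (rule has_derivative_sqrt[OF N' P.N_pos[OF x]])

lemma sform_gauge:
  "sform b0 x h k = sqrt (P.N x) * sform b x h k
     + (N' k * (b x \<bullet> h) - N' h * (b x \<bullet> k)) / (4 * sqrt (P.N x))"
  using P.N_pos[OF x] by (simp add: sform_deformed[OF x N_square_deriv has_derivative_const sqrt_N_deriv] field_simps)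

lemma rform_gauge:
  "rform a0 b0 x h k = sqrt (P.N x) * rform a b x h k
    - 3 / (4 * sqrt (P.N x)) * (N' k * (b x \<bullet> h) + N' h * (b x \<bullet> k))
    + 1 / sqrt (P.N x) * N' (P.B x) * bil (a x) h k"
proof -
  obtain M where M: "M > 0" "P.N x = M\<^sup>2" "sqrt (M\<^sup>2) = M"
    using P.N_pos[OF x] by (metis real_sqrt_gt_zero real_sqrt_pow2 less_imp_le)
  show ?thesis
    unfolding rform_deformed[OF x N_square_deriv has_derivative_const sqrt_N_deriv] M(2) M(3)
    using M(1) by (simp add: field_simps) (simp add: eval_nat_numeral algebra_simps)
qed

end

text \<open>With \<open>m = 3\<close> the derivative of \<open>N\<close> contains
  \<open>-4 s(B, k)\<close>, just what cancels \<open>s\<close> in \<open>sform_gauge\<close>. In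
  \<open>rform_gauge\<close> the coefficient of \<open>a\<close> is
  \<open>sqrt N c + N'(B) / sqrt N\<close> with \<open>N'(B) = 2 N (c + d N)\<close>; divided by the
  factor \<open>N^2\<close> of \<open>a0\<close> it is the stated function.\<close>

lemma unit_eq_if:
  assumes x: "x \<in> V" and s: "s_eq a b x" and r: "r_eq a b x c d 3"
  shows "unit_eq a0 b0 x ((3 * c + 2 * d * P.N x) / (P.N x * sqrt (P.N x)))"
proof -
  obtain M where M: "M > 0" "P.N x = M\<^sup>2" "sqrt (M\<^sup>2) = M"
    using P.N_pos[OF x] by (metis real_sqrt_gt_zero real_sqrt_pow2 less_imp_le)
  note N' = P.N_deriv_r_eq[OF x r]
  show ?thesis
    unfolding unit_eq_def
  proof (intro allI conjI)
    fix h k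
    note s' = s[unfolded s_eq_def, rule_format, of h k]
    note r' = r[unfolded r_eq_def, rule_format, of h k]
    show "sform b0 x h k = 0"
      unfolding sform_gauge[OF x N'] s' M(2) M(3)
      using M(1) by (simp add: field_simps eval_nat_numeral)
    show "rform a0 b0 x h k = (3 * c + 2 * d * P.N x) / (P.N x * sqrt (P.N x))
        * (bil (a0 x) h k - b0 x \<bullet> h * (b0 x \<bullet> k))"
      unfolding rform_gauge[OF x N'] r' a0_eq[OF x] b0_eq[OF x] M(2) M(3) P.sform_BB
      using M(1) by (simp add: M(2) field_simps eval_nat_numeral)
  qed
qed

text \<open>\<open>R\<close> is the derivative of \<open>N\<close> along \<open>B\<close>. The
  formulas for \<open>c\<close> and \<open>d\<close> solve the two equations
  \<open>c0 N sqrt N = 3 c + 2 d N\<close> and \<open>R = 2 N (c + d N)\<close>.\<close>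

lemma unit_eq_only_if:
  fixes c0
  assumes x: "x \<in> V" and e: "unit_eq a0 b0 x c0"
  defines "R \<equiv> 2 * rform a b x (P.B x) (P.B x)"
  shows "s_eq a b x"
    and "r_eq a b x (c0 * P.N x * sqrt (P.N x) - R / P.N x) (3/2 * R / (P.N x)\<^sup>2 - sqrt (P.N x) * c0) 3"
proof -
  obtain M where M: "M > 0" "P.N x = M\<^sup>2" "sqrt (M\<^sup>2) = M"
    using P.N_pos[OF x] by (metis real_sqrt_gt_zero real_sqrt_pow2 less_imp_le)
  define N' where "N' k = 2 * (rform a b x (P.B x) k + sform b x (P.B x) k)" for k
  have N': "(P.N has_derivative N') (at x)"
    unfolding N'_def[abs_def] by (rule P.N_deriv[OF x])
  have NB: "N' (P.B x) = R" by (simp add: N'_def R_def P.sform_BB)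
  have s: "4 * M\<^sup>2 * sform b x h k = N' h * (b x \<bullet> k) - N' k * (b x \<bullet> h)" for h k
  proof -
    have "0 = M * sform b x h k + (N' k * (b x \<bullet> h) - N' h * (b x \<bullet> k)) / (4 * M)"
      using e sform_gauge[OF x N', of h k] M by (simp add: unit_eq_def)
    then show ?thesis using M(1) by (simp add: field_simps power2_eq_square)
  qed
  have sB: "4 * M\<^sup>2 * sform b x (P.B x) k = R * (b x \<bullet> k) - N' k * M\<^sup>2" for k
    using s[of "P.B x" k] M(2) NB by simp
  have NN: "N' k = R / M\<^sup>2 * (b x \<bullet> k) - 4 * sform b x (P.B x) k" for k
    using sB[of k] M(1) by (simp add: field_simps)
  show "s_eq a b x"
    unfolding s_eq_def M(2)
  proof (intro allI)
    fix h k
    show "sform b x h k = 1 / M\<^sup>2 * (b x \<bullet> h * sform b x (P.B x) k - b x \<bullet> k * sform b x (P.B x) h)"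
    proof -
      have "4 * M\<^sup>2 * sform b x h k = 4 * (b x \<bullet> h * sform b x (P.B x) k - b x \<bullet> k * sform b x (P.B x) h)"
        using s[of h k] unfolding NN by (simp add: algebra_simps)
      then show ?thesis using M(1) by (simp add: field_simps)
    qed
  qed
  show "r_eq a b x (c0 * P.N x * sqrt (P.N x) - R / P.N x) (3/2 * R / (P.N x)\<^sup>2 - sqrt (P.N x) * c0) 3"
    unfolding r_eq_def M(2) M(3)
  proof (intro allI)
    fix h k
    have "c0 * (M ^ 4 * bil (a x) h k - M\<^sup>2 * (b x \<bullet> h) * (b x \<bullet> k)) = M * rform a b x h k
        - 3 / (4 * M) * (N' k * (b x \<bullet> h) + N' h * (b x \<bullet> k)) + 1 / M * R * bil (a x) h k"
      using e[unfolded unit_eq_def, rule_format, of h k] rform_gauge[OF x N', of h k] M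
      by (simp add: a0_eq[OF x] b0_eq[OF x] NB power4_eq_xxxx power2_eq_square mult_ac)
    then have r: "rform a b x h k = c0 * (M ^ 3 * bil (a x) h k - M * (b x \<bullet> h) * (b x \<bullet> k))
        + 3 / (4 * M\<^sup>2) * (N' k * (b x \<bullet> h) + N' h * (b x \<bullet> k)) - R * bil (a x) h k / M\<^sup>2"
      using M(1) by (simp add: field_simps eval_nat_numeral)
    show "rform a b x h k = (c0 * M\<^sup>2 * M - R / M\<^sup>2) * bil (a x) h k
        + (3/2 * R / (M\<^sup>2)\<^sup>2 - M * c0) * (b x \<bullet> h) * (b x \<bullet> k)
        - 3 / M\<^sup>2 * (sform b x (P.B x) h * (b x \<bullet> k) + sform b x (P.B x) k * (b x \<bullet> h))"
      unfolding r NN using M(1) by (simp add: field_simps eval_nat_numeral)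
  qed
qed

end

text \<open>\<open>gauge_i\<close> and \<open>gauge_ii\<close> lead from the barred pair of the respective case directly to the pair
  with \<open>b = 1\<close>.\<close>

locale gauge_i = deformation V a b a0 b0 "\<lambda>x. (b x \<bullet> raised a b x)\<^sup>2"
    "\<lambda>x. 1 / (b x \<bullet> raised a b x)\<^sup>2 - (b x \<bullet> raised a b x)"
    "\<lambda>x. 1 / (b x \<bullet> raised a b x)" "\<lambda>x. 1"
  for V :: "(real^'n::finite) set" and a b a0 b0
begin

text \<open>The parameters of the locale are those of case (i) followed by the unit gauge:
  \<open>N^2\<close> times the coefficients of \<alpha>, and \<open>sqrt N\<close> times the factor
  of \<beta>. The \<open>3\<close> arises since \<tau> occurs once from \<open>r\<close> and twice
  from the derivative of \<open>p = N^2\<close> along \<open>B\<close>.\<close>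

lemma unit_eq_i:
  assumes x: "x \<in> V" and s: "s_eq a b x" and r: "r_eq a b x \<tau> 0 0"
  shows "unit_eq a0 b0 x (3 * \<tau>)"
proof -
  have pos: "P.N x > 0" by (rule P.N_pos[OF x])
  define N' where "N' k = 2 * \<tau> * (b x \<bullet> k) + 2 * sform b x (P.B x) k" for k
  have N': "(P.N has_derivative N') (at x)"
    unfolding N'_def using P.N_deriv_r_eq[OF x r] by simp
  have p': "((\<lambda>x. (P.N x)\<^sup>2) has_derivative (\<lambda>k. 2 * P.N x * N' k)) (at x)"
    by (rule has_derivative_eq_rhs[OF has_derivative_power[OF N']]) (simp add: mult_ac)
  have u': "((\<lambda>x. 1 / P.N x) has_derivative (\<lambda>k. - N' k / (P.N x)\<^sup>2)) (at x)"
    by (rule has_derivative_eq_rhs[OF has_derivative_divide[OF has_derivative_const N']])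
      (use pos in \<open>simp_all add: fun_eq_iff field_simps power2_eq_square\<close>)
  have q': "((\<lambda>x. 1 / (P.N x)\<^sup>2 - P.N x) has_derivative (\<lambda>k. - 2 * N' k / (P.N x) ^ 3 - N' k)) (at x)"
    by (rule has_derivative_eq_rhs[OF has_derivative_diff[OF has_derivative_divide[OF has_derivative_const p'] N']])
      (use pos in \<open>simp_all add: fun_eq_iff field_simps eval_nat_numeral\<close>)
  show ?thesis
    unfolding unit_eq_def
  proof (intro allI conjI)
    fix h k
    note s' = s[unfolded s_eq_def, rule_format, of h k]
    note r' = r[unfolded r_eq_def, rule_format, of h k]
    show "sform b0 x h k = 0"
      unfolding sform_deformed[OF x p' q' u'] s' N'_def
      using pos by (simp add: field_simps eval_nat_numeral)
    show "rform a0 b0 x h k = 3 * \<tau> * (bil (a0 x) h k - b0 x \<bullet> h * (b0 x \<bullet> k))"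
      unfolding rform_deformed[OF x p' q' u'] r' a0_eq[OF x] b0_eq[OF x] N'_def P.sform_BB
      using pos by (simp add: field_simps) (simp add: eval_nat_numeral algebra_simps)
  qed
qed

end

locale gauge_ii = deformation V a b a0 b0 "\<lambda>x. 1 / (b x \<bullet> raised a b x)"
    "\<lambda>x. 0" "\<lambda>x. 1 / (b x \<bullet> raised a b x)" "\<lambda>x. 1"
  for V :: "(real^'n::finite) set" and a b a0 b0
begin

text \<open>Here \<open>c + d N = 0\<close>, so \<open>N\<close> is constant along \<open>B\<close>
  and the coefficient \<open>\<tau> N\<close> passes to the new pair unchanged.\<close>

lemma unit_eq_ii:
  assumes x: "x \<in> V" and s: "s_eq a b x" and r: "r_eq a b x (\<tau> * P.N x) (- \<tau>) 0"
  shows "unit_eq a0 b0 x (\<tau> * P.N x)"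
proof -
  have pos: "P.N x > 0" by (rule P.N_pos[OF x])
  define N' where "N' k = 2 * sform b x (P.B x) k" for k
  have N': "(P.N has_derivative N') (at x)"
    unfolding N'_def using P.N_deriv_r_eq[OF x r] by simp
  have u': "((\<lambda>x. 1 / P.N x) has_derivative (\<lambda>k. - N' k / (P.N x)\<^sup>2)) (at x)"
    by (rule has_derivative_eq_rhs[OF has_derivative_divide[OF has_derivative_const N']])
      (use pos in \<open>simp_all add: fun_eq_iff field_simps power2_eq_square\<close>)
  show ?thesis
    unfolding unit_eq_def
  proof (intro allI conjI)
    fix h k
    note s' = s[unfolded s_eq_def, rule_format, of h k]
    note r' = r[unfolded r_eq_def, rule_format, of h k]
    show "sform b0 x h k = 0"
      unfolding sform_deformed[OF x u' has_derivative_const u'] s' N'_def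
      using pos by (simp add: field_simps eval_nat_numeral)
    show "rform a0 b0 x h k = \<tau> * P.N x * (bil (a0 x) h k - b0 x \<bullet> h * (b0 x \<bullet> k))"
      unfolding rform_deformed[OF x u' has_derivative_const u'] r' a0_eq[OF x] b0_eq[OF x] N'_def P.sform_BB
      using pos by (simp add: field_simps eval_nat_numeral)
  qed
qed

end

section \<open>Change of charts\<close>

lemma has_derivative_bil:
  assumes "(M has_derivative M') (at x)" "(f has_derivative f') (at x)" "(g has_derivative g') (at x)"
  shows "((\<lambda>z. bil (M z) (f z) (g z)) has_derivative
    (\<lambda>k. bil (M x) (f x) (g' k) + bil (M' k) (f x) (g x) + bil (M x) (f' k) (g x))) (at x)"
  unfolding bil_def
  by (rule has_derivative_eq_rhs[OF has_derivative_inner[OF assms(2)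
          bounded_bilinear.FDERIV[OF bounded_bilinear_matrix_vector assms(1,3)]]])
    (simp add: fun_eq_iff inner_add_right)

locale chart_change = P: smooth_pair V a b + Q: smooth_pair V' a' b'
  for V :: "(real^'n::finite) set" and a b V' and a' :: "real^'n \<Rightarrow> real^'n^'n" and b' +
  fixes U :: "(real^'n) set" and \<phi> :: "real^'n \<Rightarrow> real^'n"
  assumes open_U: "open U" and U_subset: "U \<subseteq> V" and smooth_\<phi>: "smooth_on U \<phi>"
    and \<phi>_in: "z \<in> U \<Longrightarrow> \<phi> z \<in> V'"
    and a_law: "z \<in> U \<Longrightarrow> a z = transpose (jacobian \<phi> (at z)) ** a' (\<phi> z) ** jacobian \<phi> (at z)"
    and b_law: "z \<in> U \<Longrightarrow> b z = transpose (jacobian \<phi> (at z)) *v b' (\<phi> z)"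
begin

abbreviation "D z \<equiv> frechet_derivative \<phi> (at z)"

lemma \<phi>_deriv: "z \<in> U \<Longrightarrow> (\<phi> has_derivative D z) (at z)"
  by (rule smooth_on_has_derivative[OF smooth_\<phi>])

lemma jacobian_D: "z \<in> U \<Longrightarrow> jacobian \<phi> (at z) *v h = D z h"
proof -
  assume z: "z \<in> U"
  have "(\<phi> has_derivative (\<lambda>h. jacobian \<phi> (at z) *v h)) (at z)"
    using jacobian_works[of \<phi> "at z"] \<phi>_deriv[OF z] differentiable_def by blast
  from has_derivative_unique[OF this \<phi>_deriv[OF z]] show ?thesis by metis
qed

lemma a_pull: "z \<in> U \<Longrightarrow> bil (a z) h k = bil (a' (\<phi> z)) (D z h) (D z k)"
  unfolding a_law bil_def
  by (simp add: matrix_vector_mul_assoc[symmetric] jacobian_D)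
    (metis dot_lmul_matrix inner_commute jacobian_D transpose_matrix_vector)

lemma b_pull: "z \<in> U \<Longrightarrow> b z \<bullet> h = b' (\<phi> z) \<bullet> D z h"
  unfolding b_law by (metis dot_lmul_matrix jacobian_D transpose_matrix_vector)

text \<open>\<open>D z h = 0\<close> would give \<open>a(h, h) = 0\<close> by the transformation
  law, so positivity of \<open>a\<close> yields injectivity without the inverse transition
  map.\<close>

lemma surj_D:
  assumes z: "z \<in> U" shows "surj (D z)"
proof -
  have lin: "linear (D z)" using \<phi>_deriv[OF z] has_derivative_linear by blast
  have "h = 0" if "D z h = 0" for h
  proof (rule ccontr)
    assume "h \<noteq> 0"
    then have "bil (a z) h h > 0" using P.pos_a z U_subset by blast
    then show False using a_pull[OF z, of h h] that by simp
  qed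
  then have "inj (D z)" using linear_injective_0[OF lin] by blast
  with lin show ?thesis by (simp add: linear_injective_imp_surjective)
qed

lemma B_pull:
  assumes z: "z \<in> U" shows "raised a' b' (\<phi> z) = D z (P.B z)"
proof (rule Q.raised_unique[OF \<phi>_in[OF z]])
  fix h
  obtain h0 where "h = D z h0" using surj_D[OF z] by blast
  then show "bil (a' (\<phi> z)) h (D z (P.B z)) = b' (\<phi> z) \<bullet> h"
    using a_pull[OF z, of h0 "P.B z"] b_pull[OF z, of h0] P.bil_B z U_subset by (metis subsetD)
qed

lemma N_pull: "z \<in> U \<Longrightarrow> P.N z = Q.N (\<phi> z)"
  using b_pull[of z "P.B z"] B_pull[of z] by simp

text \<open>The second derivatives \<open>H\<close> of the transition map cancel because they are symmetric and
  \<open>a B = b\<close>.\<close>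

lemma rform_pull:
  assumes x: "x \<in> U"
  shows "rform a b x u v = rform a' b' (\<phi> x) (D x u) (D x v)"
proof -
  define H where "H u = frechet_derivative (\<lambda>z. D z u) (at x)" for u
  have H: "((\<lambda>z. D z u) has_derivative H u) (at x)" for u
    unfolding H_def by (rule smooth_on_has_derivative[OF smooth_on_frechet[OF smooth_\<phi>] x])
  have Hsym: "H u v = H v u" for u v
    by (rule second_derivative_symmetric[OF open_U x \<phi>_deriv H H])
  have xV: "x \<in> V" using x U_subset by blast
  have Da: "bil (P.Da x k) u v = bil (a' (\<phi> x)) (D x u) (H v k)
      + bil (Q.Da (\<phi> x) (D x k)) (D x u) (D x v) + bil (a' (\<phi> x)) (H u k) (D x v)" for k u v
  proof -
    have "((\<lambda>z. bil (a z) u v) has_derivative (\<lambda>k. bil (a' (\<phi> x)) (D x u) (H v k)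
      + bil (Q.Da (\<phi> x) (D x k)) (D x u) (D x v) + bil (a' (\<phi> x)) (H u k) (D x v))) (at x)"
      by (rule has_derivative_transform_within_open[OF has_derivative_bil[OF
              has_derivative_compose[OF \<phi>_deriv[OF x] Q.a_deriv[OF \<phi>_in[OF x]]] H[of u] H[of v]] open_U x])
        (simp add: a_pull)
    from has_derivative_unique[OF P.bil_deriv[OF xV] this] show ?thesis by metis
  qed
  have Db: "P.Db x k \<bullet> u = b' (\<phi> x) \<bullet> H u k + Q.Db (\<phi> x) (D x k) \<bullet> D x u" for k u
  proof -
    have "((\<lambda>z. b z \<bullet> u) has_derivative (\<lambda>k. b' (\<phi> x) \<bullet> H u k + Q.Db (\<phi> x) (D x k) \<bullet> D x u)) (at x)"
      by (rule has_derivative_transform_within_open[OF has_derivative_inner[OF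
              has_derivative_compose[OF \<phi>_deriv[OF x] Q.b_deriv[OF \<phi>_in[OF x]]] H[of u]] open_U x])
        (simp add: b_pull)
    from has_derivative_unique[OF has_derivative_inner_left[OF P.b_deriv[OF xV]] this] show ?thesis by metis
  qed
  note BB = Q.bil_B[OF \<phi>_in[OF x], unfolded B_pull[OF x]]
  show ?thesis
    unfolding rform_def Da Db B_pull[OF x] BB
    by (simp add: Hsym[of u "P.B x"] Hsym[of v "P.B x"] Hsym[of u v] Q.a_commute[OF \<phi>_in[OF x], of _ "D x u"]
      Q.a_commute[OF \<phi>_in[OF x], of _ "D x v"] field_simps)
qed

end

section \<open>The unit gauge on a manifold\<close>

locale manifold_pair =
  fixes A :: "('m::{t2_space, second_countable_topology}, 'n::finite) chart set"
    and a :: "('m, 'n) chart \<Rightarrow> real^'n \<Rightarrow> real^'n^'n"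
    and b :: "('m, 'n) chart \<Rightarrow> real^'n \<Rightarrow> real^'n"
  assumes atlas: "smooth_atlas A" and metric: "riemannian_metric A a" and form: "one_form A b"
    and nonzero: "nowhere_vanishing A b"
begin

lemma open_region: "\<kappa> \<in> A \<Longrightarrow> open (region \<kappa>)"
  using atlas by (auto simp: smooth_atlas_def)

lemma point_of:
  assumes "\<kappa> \<in> A"
  shows "x \<in> region \<kappa> \<Longrightarrow> point_of \<kappa> x \<in> fst \<kappa>" "x \<in> region \<kappa> \<Longrightarrow> snd \<kappa> (point_of \<kappa> x) = x"
    "m \<in> fst \<kappa> \<Longrightarrow> snd \<kappa> m \<in> region \<kappa>" "m \<in> fst \<kappa> \<Longrightarrow> point_of \<kappa> (snd \<kappa> m) = m"
proof -
  have "homeomorphism (fst \<kappa>) (region \<kappa>) (snd \<kappa>) (point_of \<kappa>)"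
    using atlas assms by (auto simp: smooth_atlas_def)
  then show "x \<in> region \<kappa> \<Longrightarrow> point_of \<kappa> x \<in> fst \<kappa>" "x \<in> region \<kappa> \<Longrightarrow> snd \<kappa> (point_of \<kappa> x) = x"
    "m \<in> fst \<kappa> \<Longrightarrow> snd \<kappa> m \<in> region \<kappa>" "m \<in> fst \<kappa> \<Longrightarrow> point_of \<kappa> (snd \<kappa> m) = m"
    by (auto simp: homeomorphism_def)
qed

lemma open_overlap:
  assumes "\<kappa> \<in> A" "\<kappa>' \<in> A" shows "open (overlap \<kappa> \<kappa>')"
proof -
  have "overlap \<kappa> \<kappa>' = region \<kappa> \<inter> point_of \<kappa> -` fst \<kappa>'"
  proof (intro set_eqI iffI)
    fix x assume "x \<in> overlap \<kappa> \<kappa>'"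
    then show "x \<in> region \<kappa> \<inter> point_of \<kappa> -` fst \<kappa>'"
      using point_of[OF assms(1)] by (auto simp: overlap_def)
  next
    fix x assume "x \<in> region \<kappa> \<inter> point_of \<kappa> -` fst \<kappa>'"
    then show "x \<in> overlap \<kappa> \<kappa>'"
      unfolding overlap_def using point_of(1,2)[OF assms(1), of x] by (intro image_eqI[of _ _ "point_of \<kappa> x"]) auto
  qed
  moreover have "continuous_on (region \<kappa>) (point_of \<kappa>)" "open (fst \<kappa>')"
    using atlas assms by (auto simp: smooth_atlas_def homeomorphism_def)
  ultimately show ?thesis
    using continuous_open_preimage open_region[OF assms(1)] by metis
qed

lemma pair: "\<kappa> \<in> A \<Longrightarrow> smooth_pair (region \<kappa>) (a \<kappa>) (b \<kappa>)"
  using open_region metric form nonzero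
  by unfold_locales (auto simp: riemannian_metric_def one_form_def nowhere_vanishing_def bil_def)

lemma change:
  assumes "\<kappa> \<in> A" "\<kappa>' \<in> A"
  shows "chart_change (region \<kappa>) (a \<kappa>) (b \<kappa>) (region \<kappa>') (a \<kappa>') (b \<kappa>') (overlap \<kappa> \<kappa>') (transition \<kappa> \<kappa>')"
proof (intro chart_change.intro pair assms chart_change_axioms.intro)
  show "open (overlap \<kappa> \<kappa>')" by (rule open_overlap[OF assms])
  show "overlap \<kappa> \<kappa>' \<subseteq> region \<kappa>" by (auto simp: overlap_def region_def)
  show "smooth_on (overlap \<kappa> \<kappa>') (transition \<kappa> \<kappa>')" using atlas assms by (auto simp: smooth_atlas_def)
  show "transition \<kappa> \<kappa>' z \<in> region \<kappa>'" if "z \<in> overlap \<kappa> \<kappa>'" for z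
    using that point_of[OF assms(1)] point_of[OF assms(2)] by (auto simp: overlap_def transition_def)
qed (use metric form assms in \<open>auto simp: riemannian_metric_def one_form_def Let_def\<close>)

text \<open>At each point some chart \<open>ch m\<close> is chosen; compatibility makes the value
  independent of the choice, and hence smooth in every chart.\<close>

lemma glue:
  assumes smooth: "\<And>\<kappa>. \<kappa> \<in> A \<Longrightarrow> smooth_on (region \<kappa>) (f \<kappa>)"
    and compatible: "\<And>\<kappa> \<kappa>' x. \<kappa> \<in> A \<Longrightarrow> \<kappa>' \<in> A \<Longrightarrow> x \<in> overlap \<kappa> \<kappa>' \<Longrightarrow> f \<kappa> x = f \<kappa>' (transition \<kappa> \<kappa>' x)"
  obtains g where "smooth_function A g" "\<forall>\<kappa>\<in>A. \<forall>x\<in>region \<kappa>. g (point_of \<kappa> x) = f \<kappa> x"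
proof -
  define ch where "ch m = (SOME \<kappa>. \<kappa> \<in> A \<and> m \<in> fst \<kappa>)" for m
  have ch: "ch m \<in> A \<and> m \<in> fst (ch m)" for m
  proof -
    have "m \<in> (\<Union>\<kappa>\<in>A. fst \<kappa>)" using atlas by (simp add: smooth_atlas_def)
    then show ?thesis unfolding ch_def by (intro someI_ex[of "\<lambda>\<kappa>. \<kappa> \<in> A \<and> m \<in> fst \<kappa>"]) blast
  qed
  define g where "g m = f (ch m) (snd (ch m) m)" for m
  have g: "g (point_of \<kappa> x) = f \<kappa> x" if "\<kappa> \<in> A" "x \<in> region \<kappa>" for \<kappa> x
  proof -
    define m where "m = point_of \<kappa> x"
    have m: "m \<in> fst \<kappa>" "x = snd \<kappa> m" using point_of[OF that(1)] that(2) by (simp_all add: m_def)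
    have "snd \<kappa> m \<in> overlap \<kappa> (ch m)" using m ch[of m] by (auto simp: overlap_def)
    then have "f \<kappa> (snd \<kappa> m) = f (ch m) (transition \<kappa> (ch m) (snd \<kappa> m))"
      using compatible that(1) ch by blast
    then show ?thesis
      using m point_of(4)[OF that(1) m(1)] by (simp add: g_def transition_def m_def[symmetric])
  qed
  have "smooth_function A g"
    unfolding smooth_function_def o_def
    using g smooth smooth_on_cong[OF open_region] by (metis (no_types, lifting))
  then show thesis using that g by blast
qed

definition N :: "('m, 'n) chart \<Rightarrow> real^'n \<Rightarrow> real" where
  "N \<kappa> x = b \<kappa> x \<bullet> raised (a \<kappa>) (b \<kappa>) x"

definition a0 :: "('m, 'n) chart \<Rightarrow> real^'n \<Rightarrow> real^'n^'n" where
  "a0 \<kappa> x = (N \<kappa> x)\<^sup>2 *\<^sub>R a \<kappa> x"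

definition b0 :: "('m, 'n) chart \<Rightarrow> real^'n \<Rightarrow> real^'n" where
  "b0 \<kappa> x = sqrt (N \<kappa> x) *\<^sub>R b \<kappa> x"

lemma N_pos: "\<kappa> \<in> A \<Longrightarrow> x \<in> region \<kappa> \<Longrightarrow> N \<kappa> x > 0"
  unfolding N_def using smooth_pair.N_pos[OF pair] by blast

lemma smooth_N: "\<kappa> \<in> A \<Longrightarrow> smooth_on (region \<kappa>) (N \<kappa>)"
  unfolding N_def[abs_def] by (rule smooth_pair.smooth_N[OF pair])

lemma N_transition: "\<kappa> \<in> A \<Longrightarrow> \<kappa>' \<in> A \<Longrightarrow> x \<in> overlap \<kappa> \<kappa>' \<Longrightarrow> N \<kappa> x = N \<kappa>' (transition \<kappa> \<kappa>' x)"
  unfolding N_def by (rule chart_change.N_pull[OF change])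

lemma form_norm_N: "form_norm (a \<kappa>) (b \<kappa>) x = sqrt (N \<kappa> x)"
  by (simp add: form_norm_inner N_def)

lemma manifold_pair_gauge: "manifold_pair A a0 b0"
proof
  show "riemannian_metric A a0"
    unfolding riemannian_metric_def Let_def
  proof (intro conjI ballI)
    fix \<kappa> assume \<kappa>: "\<kappa> \<in> A"
    show "smooth_on (region \<kappa>) (a0 \<kappa>)"
      unfolding a0_def[abs_def] power2_eq_square
      using metric \<kappa> by (intro smooth_on_scaleR smooth_on_mult smooth_N open_region) (auto simp: riemannian_metric_def)
    fix x assume x: "x \<in> region \<kappa>"
    show "transpose (a0 \<kappa> x) = a0 \<kappa> x"
      using smooth_pair.sym_a[OF pair[OF \<kappa>] x] by (simp add: a0_def transpose_def vec_eq_iff)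
    show "\<forall>y. y \<noteq> 0 \<longrightarrow> 0 < y \<bullet> (a0 \<kappa> x *v y)"
      using smooth_pair.pos_a[OF pair[OF \<kappa>] x] N_pos[OF \<kappa> x]
      by (simp add: a0_def bil_def scaleR_matrix_vector_assoc[symmetric])
  next
    fix \<kappa> \<kappa>' x assume *: "\<kappa> \<in> A" "\<kappa>' \<in> A" "x \<in> overlap \<kappa> \<kappa>'"
    show "a0 \<kappa> x = transpose (jacobian (transition \<kappa> \<kappa>') (at x)) ** a0 \<kappa>' (transition \<kappa> \<kappa>' x)
        ** jacobian (transition \<kappa> \<kappa>') (at x)"
      unfolding a0_def N_transition[OF *] chart_change.a_law[OF change[OF *(1,2)] *(3)]
      by (simp add: matrix_scalar_ac scalar_matrix_assoc)
  qed
  show "one_form A b0"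
    unfolding one_form_def Let_def
  proof (intro conjI ballI)
    fix \<kappa> assume \<kappa>: "\<kappa> \<in> A"
    show "smooth_on (region \<kappa>) (b0 \<kappa>)"
      unfolding b0_def[abs_def]
      using form \<kappa> N_pos[OF \<kappa>]
      by (intro smooth_on_scaleR smooth_on_sqrt smooth_N open_region) (auto simp: one_form_def)
  next
    fix \<kappa> \<kappa>' x assume *: "\<kappa> \<in> A" "\<kappa>' \<in> A" "x \<in> overlap \<kappa> \<kappa>'"
    show "b0 \<kappa> x = transpose (jacobian (transition \<kappa> \<kappa>') (at x)) *v b0 \<kappa>' (transition \<kappa> \<kappa>' x)"
      unfolding b0_def N_transition[OF *] chart_change.b_law[OF change[OF *(1,2)] *(3)]
      by (simp add: matrix_vector_mult_scaleR)
  qed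
  show "nowhere_vanishing A b0"
    using nonzero N_pos by (auto simp: nowhere_vanishing_def b0_def) (metis less_irrefl)
qed (rule atlas)

lemma gauge: "\<kappa> \<in> A \<Longrightarrow> gauge (region \<kappa>) (a \<kappa>) (b \<kappa>) (a0 \<kappa>) (b0 \<kappa>)"
proof -
  assume \<kappa>: "\<kappa> \<in> A"
  show ?thesis
    unfolding gauge_def
  proof (intro deformation.intro pair[OF \<kappa>] manifold_pair.pair[OF manifold_pair_gauge \<kappa>] deformation_axioms.intro)
    fix x assume x: "x \<in> region \<kappa>"
    show "sqrt (b \<kappa> x \<bullet> raised (a \<kappa>) (b \<kappa>) x) = 1 / (b \<kappa> x \<bullet> raised (a \<kappa>) (b \<kappa>) x * sqrt (b \<kappa> x \<bullet> raised (a \<kappa>) (b \<kappa>) x))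
        * ((b \<kappa> x \<bullet> raised (a \<kappa>) (b \<kappa>) x)\<^sup>2 + 0 * (b \<kappa> x \<bullet> raised (a \<kappa>) (b \<kappa>) x))"
      using N_pos[OF \<kappa> x] by (simp add: N_def field_simps power2_eq_square)
  qed (simp_all add: a0_def b0_def N_def)
qed

lemma unit_gauge: "\<kappa> \<in> A \<Longrightarrow> x \<in> region \<kappa> \<Longrightarrow> b0 \<kappa> x \<bullet> raised (a0 \<kappa>) (b0 \<kappa>) x = 1"
  using deformation.raised_deformed[OF gauge[unfolded gauge_def]] N_pos[of \<kappa> x]
  by (simp add: b0_def N_def)

definition unit_douglas :: "('m \<Rightarrow> real) \<Rightarrow> bool" where
  "unit_douglas c \<longleftrightarrow> smooth_function A c \<and>
     (\<forall>\<kappa>\<in>A. \<forall>x\<in>region \<kappa>. unit_eq (a0 \<kappa>) (b0 \<kappa>) x (c (point_of \<kappa> x)))"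

end

section \<open>Smoothness and chart independence of the function \<open>c\<close>\<close>

context smooth_pair
begin

text \<open>In \<open>rform\<close> the direction \<open>B x\<close> of differentiation varies with
  \<open>x\<close>; expanding over the components \<open>r_tensor\<close> leaves derivatives in
  fixed directions only.\<close>

lemma smooth_rform_BB: "smooth_on V (\<lambda>x. rform a b x (B x) (B x))"
proof -
  have eq: "rform a b x (B x) (B x) = (\<Sum>i\<in>UNIV. \<Sum>j\<in>UNIV. B x $ i * B x $ j * r_tensor a b x i j)"
    if x: "x \<in> V" for x
  proof -
    have lin: "linear (\<lambda>u. rform a b x u v)" "linear (rform a b x u)" for u v
      using bilinear_rform[OF x] by (simp_all add: bilinear_def)
    have "rform a b x (B x) (B x) =
        rform a b x (\<Sum>i\<in>UNIV. B x $ i *\<^sub>R axis i 1) (\<Sum>j\<in>UNIV. B x $ j *\<^sub>R axis j 1)"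
      by (simp only: vec_axis_sum[symmetric])
    also have "\<dots> = (\<Sum>i\<in>UNIV. \<Sum>j\<in>UNIV. B x $ i * B x $ j * r_tensor a b x i j)"
      by (subst linear_sum[OF lin(1)])
        (simp add: linear_sum[OF lin(2)] linear_scale[OF lin(1)] linear_scale[OF lin(2)]
          sum_distrib_left mult_ac r_tensor_eq[OF x])
    finally show ?thesis .
  qed
  have sm: "smooth_on V (\<lambda>x. \<Sum>i\<in>UNIV. \<Sum>j\<in>UNIV. B x $ i * B x $ j * r_tensor a b x i j)"
    by (intro smooth_on_sum smooth_on_mult smooth_r_tensor open_V smooth_on_vec_nth smooth_B)
  show ?thesis
    by (rule smooth_on_cong[OF open_V _ sm]) (simp add: eq)
qed

text \<open>The coordinate trace of \<open>a - b b\<close>. It depends on the chart, but so does the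
  trace of \<open>r\<close>, and in the unit gauge their quotient is \<open>c\<close>.\<close>

definition trace_gap :: "real^'n \<Rightarrow> real" where
  "trace_gap x = (\<Sum>i\<in>UNIV. a x $ i $ i - (b x $ i)\<^sup>2)"

lemma smooth_trace_gap: "smooth_on V trace_gap"
  unfolding trace_gap_def[abs_def] power2_eq_square
  by (intro smooth_on_sum smooth_on_diff smooth_on_mult smooth_entry open_V smooth_on_vec_nth smooth_b)

text \<open>\<open>a - b b\<close> is the pullback of \<open>a\<close> by the projection
  \<open>R\<close> onto the kernel of \<open>b\<close>, so its diagonal entries are nonnegative. If
  all were zero, \<open>R\<close> would kill every basis vector, yet it fixes a nonzero
  vector.\<close>

lemma trace_gap_pos:
  assumes x: "x \<in> V" and unit: "N x = 1" and n: "CARD('n) \<ge> 3"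
  shows "trace_gap x > 0"
proof -
  define R where "R u = u - (b x \<bullet> u) *\<^sub>R B x" for u
  have gap: "bil (a x) u u - (b x \<bullet> u)\<^sup>2 = bil (a x) (R u) (R u)" for u
    using x unit by (simp add: R_def power2_eq_square inner_diff_right)
  have ge: "a x $ i $ i - (b x $ i)\<^sup>2 \<ge> 0" for i
    using gap[of "axis i 1"] bil_nonneg[OF x, of "R (axis i 1)"] by (simp add: inner_axis)
  have "\<exists>i. a x $ i $ i - (b x $ i)\<^sup>2 \<noteq> 0"
  proof (rule ccontr)
    assume "\<not> ?thesis"
    then have "bil (a x) (R (axis i 1)) (R (axis i 1)) = 0" for i
      using gap[of "axis i 1"] by (simp add: inner_axis)
    then have R0: "R (axis i 1) = 0" for i
      using pos_a[OF x, of "R (axis i 1)"] by (metis less_irrefl)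
    have lin: "linear R" unfolding R_def by (rule linearI) (simp_all add: inner_add_right algebra_simps)
    obtain w where w: "w \<noteq> 0" "b x \<bullet> w = 0" using exists_orthogonal[OF x n] by metis
    have "R w = R (\<Sum>l\<in>UNIV. w $ l *\<^sub>R axis l 1)" using vec_axis_sum[of w] by simp
    also have "\<dots> = 0" by (simp add: linear_sum[OF lin] linear_scale[OF lin] R0)
    finally show False using w by (simp add: R_def)
  qed
  then obtain i where "a x $ i $ i - (b x $ i)\<^sup>2 > 0" using ge by (metis less_le)
  then show ?thesis
    unfolding trace_gap_def using ge by (intro sum_pos2[of UNIV i]) auto
qed

lemma unit_eq_trace:
  assumes x: "x \<in> V" and e: "unit_eq a b x c"
  shows "(\<Sum>i\<in>UNIV. r_tensor a b x i i) = c * trace_gap x"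
  using e unfolding unit_eq_def
  by (simp add: r_tensor_eq[OF x] trace_gap_def inner_axis power2_eq_square sum_distrib_left)

end

context manifold_pair
begin

text \<open>Within a chart \<open>c\<close> is a quotient of smooth traces. Across charts its values
  agree because \<open>r\<close>, tested on some \<open>w\<close> with \<open>b0(w) = 0\<close>,
  equals \<open>c a0(w, w)\<close>, and both forms transform as tensors.\<close>

lemma unit_douglas_exists:
  assumes n: "CARD('n) \<ge> 3" and e: "\<And>\<kappa> x. \<kappa> \<in> A \<Longrightarrow> x \<in> region \<kappa> \<Longrightarrow> \<exists>c. unit_eq (a0 \<kappa>) (b0 \<kappa>) x c"
  shows "\<exists>c. unit_douglas c"
proof -
  note pair0 = manifold_pair.pair[OF manifold_pair_gauge]
  note change0 = manifold_pair.change[OF manifold_pair_gauge]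
  define f where "f \<kappa> x = (\<Sum>i\<in>UNIV. r_tensor (a0 \<kappa>) (b0 \<kappa>) x i i) / smooth_pair.trace_gap (a0 \<kappa>) (b0 \<kappa>) x" for \<kappa> x
  have pos: "smooth_pair.trace_gap (a0 \<kappa>) (b0 \<kappa>) x > 0" if "\<kappa> \<in> A" "x \<in> region \<kappa>" for \<kappa> x
    by (rule smooth_pair.trace_gap_pos[OF pair0[OF that(1)] that(2) unit_gauge[OF that] n])
  have f: "f \<kappa> x = c" if "\<kappa> \<in> A" "x \<in> region \<kappa>" "unit_eq (a0 \<kappa>) (b0 \<kappa>) x c" for \<kappa> x c
    using smooth_pair.unit_eq_trace[OF pair0[OF that(1)] that(2,3)] pos[OF that(1,2)] by (simp add: f_def)
  have fe: "unit_eq (a0 \<kappa>) (b0 \<kappa>) x (f \<kappa> x)" if "\<kappa> \<in> A" "x \<in> region \<kappa>" for \<kappa> x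
    using e[OF that] f[OF that] by metis
  obtain c where "smooth_function A c" "\<forall>\<kappa>\<in>A. \<forall>x\<in>region \<kappa>. c (point_of \<kappa> x) = f \<kappa> x"
  proof (rule glue)
    show "smooth_on (region \<kappa>) (f \<kappa>)" if "\<kappa> \<in> A" for \<kappa>
      unfolding f_def[abs_def] using pos[OF that]
      by (intro smooth_on_divide smooth_on_sum open_region[OF that] smooth_pair.smooth_r_tensor[OF pair0[OF that]]
          smooth_pair.smooth_trace_gap[OF pair0[OF that]]) (metis less_irrefl)
    fix \<kappa> \<kappa>' x assume *: "\<kappa> \<in> A" "\<kappa>' \<in> A" "x \<in> overlap \<kappa> \<kappa>'"
    interpret C: chart_change "region \<kappa>" "a0 \<kappa>" "b0 \<kappa>" "region \<kappa>'" "a0 \<kappa>'" "b0 \<kappa>'" "overlap \<kappa> \<kappa>'" "transition \<kappa> \<kappa>'"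
      by (rule change0[OF *(1,2)])
    have x: "x \<in> region \<kappa>" using C.U_subset *(3) by blast
    obtain w where w: "w \<noteq> 0" "b0 \<kappa> x \<bullet> w = 0" using C.P.exists_orthogonal[OF x n] by metis
    have "f \<kappa> x * bil (a0 \<kappa> x) w w = rform (a0 \<kappa>) (b0 \<kappa>) x w w"
      using fe[OF *(1) x] w by (simp add: unit_eq_def)
    also have "\<dots> = f \<kappa>' (transition \<kappa> \<kappa>' x) * bil (a0 \<kappa> x) w w"
      using fe[OF *(2) C.\<phi>_in[OF *(3)]] w C.b_pull[OF *(3), of w]
      by (simp add: unit_eq_def C.rform_pull[OF *(3)] C.a_pull[OF *(3)])
    finally show "f \<kappa> x = f \<kappa>' (transition \<kappa> \<kappa>' x)"
      using C.P.pos_a[OF x w(1)] by simp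
  qed
  then have "unit_douglas c" using fe by (simp add: unit_douglas_def)
  then show ?thesis by blast
qed

lemma s_condition_iff: "s_condition A a b \<longleftrightarrow> (\<forall>\<kappa>\<in>A. \<forall>x\<in>region \<kappa>. s_eq (a \<kappa>) (b \<kappa>) x)"
  unfolding s_condition_def
proof (intro ball_cong refl)
  fix \<kappa> x assume that: "\<kappa> \<in> A" "x \<in> region \<kappa>"
  show "(\<forall>i j. s_tensor (a \<kappa>) (b \<kappa>) x i j =
          1 / (form_norm (a \<kappa>) (b \<kappa>) x)\<^sup>2 *
            (b \<kappa> x $ i * s_form (a \<kappa>) (b \<kappa>) x j - b \<kappa> x $ j * s_form (a \<kappa>) (b \<kappa>) x i))
     \<longleftrightarrow> s_eq (a \<kappa>) (b \<kappa>) x"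
    unfolding smooth_pair.s_tensor_iff[OF pair[OF that(1)] that(2)]
      smooth_pair.form_norm_sq[OF pair[OF that(1)] that(2)] s_eq_def by (rule refl)
qed

lemma douglas_equations_iff:
  "douglas_equations A a b c d \<longleftrightarrow> (\<forall>\<kappa>\<in>A. \<forall>x\<in>region \<kappa>. s_eq (a \<kappa>) (b \<kappa>) x \<and>
     r_eq (a \<kappa>) (b \<kappa>) x (c (point_of \<kappa> x)) (d (point_of \<kappa> x)) 3)"
proof -
  have "(\<forall>\<kappa>\<in>A. \<forall>x\<in>region \<kappa>. \<forall>i j. r_tensor (a \<kappa>) (b \<kappa>) x i j =
          c (point_of \<kappa> x) * a \<kappa> x $ i $ j + d (point_of \<kappa> x) * b \<kappa> x $ i * b \<kappa> x $ j
          - 3 / (form_norm (a \<kappa>) (b \<kappa>) x)\<^sup>2 *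
              (s_form (a \<kappa>) (b \<kappa>) x i * b \<kappa> x $ j + s_form (a \<kappa>) (b \<kappa>) x j * b \<kappa> x $ i))
     \<longleftrightarrow> (\<forall>\<kappa>\<in>A. \<forall>x\<in>region \<kappa>. r_eq (a \<kappa>) (b \<kappa>) x (c (point_of \<kappa> x)) (d (point_of \<kappa> x)) 3)"
  proof (intro ball_cong refl)
    fix \<kappa> x assume that: "\<kappa> \<in> A" "x \<in> region \<kappa>"
    show "(\<forall>i j. r_tensor (a \<kappa>) (b \<kappa>) x i j =
          c (point_of \<kappa> x) * a \<kappa> x $ i $ j + d (point_of \<kappa> x) * b \<kappa> x $ i * b \<kappa> x $ j
          - 3 / (form_norm (a \<kappa>) (b \<kappa>) x)\<^sup>2 *
              (s_form (a \<kappa>) (b \<kappa>) x i * b \<kappa> x $ j + s_form (a \<kappa>) (b \<kappa>) x j * b \<kappa> x $ i))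
      \<longleftrightarrow> r_eq (a \<kappa>) (b \<kappa>) x (c (point_of \<kappa> x)) (d (point_of \<kappa> x)) 3"
      unfolding smooth_pair.r_tensor_iff[OF pair[OF that(1)] that(2)]
        smooth_pair.form_norm_sq[OF pair[OF that(1)] that(2)] r_eq_def by (rule refl)
  qed
  then show ?thesis
    unfolding douglas_equations_def s_condition_iff by blast
qed

lemma smooth_functionD: "smooth_function A c \<Longrightarrow> \<kappa> \<in> A \<Longrightarrow> smooth_on (region \<kappa>) (\<lambda>x. c (point_of \<kappa> x))"
  by (simp add: smooth_function_def o_def)

theorem douglas_equations_unit:
  "(\<exists>c d. smooth_function A c \<and> smooth_function A d \<and> douglas_equations A a b c d) \<longleftrightarrow> (\<exists>c. unit_douglas c)"
proof
  \<comment> \<open>\<open>b^2\<close> is available chartwise only, but \<open>c0\<close>,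
    \<open>c\<close> and \<open>d\<close> have to be functions on the manifold. \<open>R\<close>
    below is glued for the same reason.\<close>
  obtain n where n': "smooth_function A n" "\<forall>\<kappa>\<in>A. \<forall>x\<in>region \<kappa>. n (point_of \<kappa> x) = N \<kappa> x"
    using glue[of N] smooth_N N_transition by blast
  note n = n'(1) n'(2)[rule_format]
  note NI = smooth_on_add smooth_on_diff smooth_on_mult smooth_on_divide smooth_on_sqrt smooth_on_const
    open_region smooth_functionD[OF n(1)]
  {
    assume "\<exists>c d. smooth_function A c \<and> smooth_function A d \<and> douglas_equations A a b c d"
    then obtain c d where cd: "smooth_function A c" "smooth_function A d" "douglas_equations A a b c d"
      by blast
    define c0 where "c0 m = (3 * c m + 2 * d m * n m) / (n m * sqrt (n m))" for m
    have "smooth_function A c0"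
      unfolding smooth_function_def o_def c0_def
    proof
      fix \<kappa> assume \<kappa>: "\<kappa> \<in> A"
      show "smooth_on (region \<kappa>) (\<lambda>x. (3 * c (point_of \<kappa> x) + 2 * d (point_of \<kappa> x) * n (point_of \<kappa> x))
          / (n (point_of \<kappa> x) * sqrt (n (point_of \<kappa> x))))"
        using \<kappa> N_pos[OF \<kappa>] by (intro NI smooth_functionD[OF cd(1)] smooth_functionD[OF cd(2)])
          (auto simp: n(2) dest!: N_pos[OF \<kappa>])
    qed
    moreover have "unit_eq (a0 \<kappa>) (b0 \<kappa>) x (c0 (point_of \<kappa> x))" if "\<kappa> \<in> A" "x \<in> region \<kappa>" for \<kappa> x
      using gauge.unit_eq_if[OF gauge[OF that(1)] that(2)] cd(3) that n(2)[OF that]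
      unfolding douglas_equations_iff c0_def N_def by fastforce
    ultimately show "\<exists>c. unit_douglas c" unfolding unit_douglas_def by blast
  next
    assume "\<exists>c. unit_douglas c"
    then obtain c0 where c0: "smooth_function A c0"
      "\<And>\<kappa> x. \<kappa> \<in> A \<Longrightarrow> x \<in> region \<kappa> \<Longrightarrow> unit_eq (a0 \<kappa>) (b0 \<kappa>) x (c0 (point_of \<kappa> x))"
      unfolding unit_douglas_def by blast
    obtain R where R': "smooth_function A R" "\<forall>\<kappa>\<in>A. \<forall>x\<in>region \<kappa>.
        R (point_of \<kappa> x) = 2 * rform (a \<kappa>) (b \<kappa>) x (raised (a \<kappa>) (b \<kappa>) x) (raised (a \<kappa>) (b \<kappa>) x)"
    proof (rule glue[of "\<lambda>\<kappa> x. 2 * rform (a \<kappa>) (b \<kappa>) x (raised (a \<kappa>) (b \<kappa>) x) (raised (a \<kappa>) (b \<kappa>) x)"])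
      show "smooth_on (region \<kappa>) (\<lambda>x. 2 * rform (a \<kappa>) (b \<kappa>) x (raised (a \<kappa>) (b \<kappa>) x) (raised (a \<kappa>) (b \<kappa>) x))"
        if "\<kappa> \<in> A" for \<kappa>
        by (intro smooth_on_mult smooth_on_const open_region[OF that] smooth_pair.smooth_rform_BB[OF pair[OF that]])
      fix \<kappa> \<kappa>' x assume *: "\<kappa> \<in> A" "\<kappa>' \<in> A" "x \<in> overlap \<kappa> \<kappa>'"
      note C = change[OF *(1,2)]
      show "2 * rform (a \<kappa>) (b \<kappa>) x (raised (a \<kappa>) (b \<kappa>) x) (raised (a \<kappa>) (b \<kappa>) x) =
         2 * rform (a \<kappa>') (b \<kappa>') (transition \<kappa> \<kappa>' x) (raised (a \<kappa>') (b \<kappa>') (transition \<kappa> \<kappa>' x))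
            (raised (a \<kappa>') (b \<kappa>') (transition \<kappa> \<kappa>' x))"
        by (simp add: chart_change.rform_pull[OF C *(3)] chart_change.B_pull[OF C *(3)])
    qed blast
    note R = R'(1) R'(2)[rule_format]
    define c where "c m = c0 m * n m * sqrt (n m) - R m / n m" for m
    define d where "d m = 3/2 * R m / (n m)\<^sup>2 - sqrt (n m) * c0 m" for m
    have "smooth_function A c" "smooth_function A d"
      unfolding smooth_function_def o_def c_def d_def power2_eq_square
      by (intro ballI NI smooth_functionD[OF c0(1)] smooth_functionD[OF R(1)];
          auto simp: n(2) dest!: N_pos)+
    moreover have "douglas_equations A a b c d"
      unfolding douglas_equations_iff
    proof (intro ballI conjI)
      fix \<kappa> x assume that: "\<kappa> \<in> A" "x \<in> region \<kappa>"
      note u = gauge.unit_eq_only_if[OF gauge[OF that(1)] that(2) c0(2)[OF that]]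
      show "s_eq (a \<kappa>) (b \<kappa>) x" by (rule u(1))
      show "r_eq (a \<kappa>) (b \<kappa>) x (c (point_of \<kappa> x)) (d (point_of \<kappa> x)) 3"
        using u(2) unfolding c_def d_def n(2)[OF that] R(2)[OF that] N_def .
    qed
    ultimately show "\<exists>c d. smooth_function A c \<and> smooth_function A d \<and> douglas_equations A a b c d" by blast
  }
qed

lemma singular_square_gauge:
  assumes "singular_square_metric A a b F"
  shows "singular_square_metric A a0 b0 F"
    and "\<kappa> \<in> A \<Longrightarrow> unit_pair (region \<kappa>) (a0 \<kappa>) (b0 \<kappa>) (F \<kappa>)"
proof -
  interpret G: manifold_pair A a0 b0 by (rule manifold_pair_gauge)
  have F: "F \<kappa> x y = (sqrt (bil (a0 \<kappa> x) y y) + b0 \<kappa> x \<bullet> y)\<^sup>2 / sqrt (bil (a0 \<kappa> x) y y)"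
    if "\<kappa> \<in> A" "x \<in> region \<kappa>" "y \<noteq> 0" for \<kappa> x y
  proof -
    from N_pos[OF that(1,2)] obtain M where M: "M > 0" "N \<kappa> x = M\<^sup>2"
      by (metis real_sqrt_gt_zero real_sqrt_pow2 less_imp_le)
    define s where "s = sqrt (bil (a \<kappa> x) y y)"
    have s: "s > 0" using smooth_pair.pos_a[OF pair[OF that(1)] that(2,3)] by (simp add: s_def)
    have "F \<kappa> x y = (M * s + b \<kappa> x \<bullet> y)\<^sup>2 / s"
      using assms that M by (simp add: singular_square_metric_def form_norm_N metric_norm_bil form_eval_inner s_def)
    moreover have "sqrt (bil (a0 \<kappa> x) y y) = N \<kappa> x * s"
      using N_pos[OF that(1,2)] by (simp add: a0_def real_sqrt_mult s_def)
    moreover have "b0 \<kappa> x \<bullet> y = M * (b \<kappa> x \<bullet> y)"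
      using M by (simp add: b0_def)
    ultimately show ?thesis
      using M s by (simp add: field_simps power2_eq_square)
  qed
  then show "singular_square_metric A a0 b0 F"
    using G.metric G.form unit_gauge
    by (simp add: singular_square_metric_def metric_norm_bil form_eval_inner G.form_norm_N G.N_def)
  show "\<kappa> \<in> A \<Longrightarrow> unit_pair (region \<kappa>) (a0 \<kappa>) (b0 \<kappa>) (F \<kappa>)"
    using F unit_gauge by (intro unit_pair.intro G.pair unit_pair_axioms.intro)
qed

theorem douglas_metric_unit:
  assumes F: "singular_square_metric A a b F" and n: "CARD('n) \<ge> 3"
  shows "douglas_metric A F \<longleftrightarrow> (\<exists>c. unit_douglas c)"
proof
  note U = singular_square_gauge(2)[OF F]
  assume "douglas_metric A F"
  then have "\<exists>c. unit_eq (a0 \<kappa>) (b0 \<kappa>) x c" if "\<kappa> \<in> A" "x \<in> region \<kappa>" for \<kappa> x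
    using unit_pair.douglas_only_if[OF U[OF that(1)] n _ that(2)] that
    unfolding douglas_metric_def unit_eq_def by metis
  then show "\<exists>c. unit_douglas c" by (rule unit_douglas_exists[OF n])
next
  note U = singular_square_gauge(2)[OF F]
  assume "\<exists>c. unit_douglas c"
  then obtain c where c: "smooth_function A c"
    "\<And>\<kappa> x. \<kappa> \<in> A \<Longrightarrow> x \<in> region \<kappa> \<Longrightarrow> unit_eq (a0 \<kappa>) (b0 \<kappa>) x (c (point_of \<kappa> x))"
    unfolding unit_douglas_def by blast
  show "douglas_metric A F"
    unfolding douglas_metric_def
  proof
    fix \<kappa> assume \<kappa>: "\<kappa> \<in> A"
    show "douglas_on (region \<kappa>) (F \<kappa>)"
      by (rule unit_pair.douglas_if[OF U[OF \<kappa>] smooth_functionD[OF c(1) \<kappa>]])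
        (use c(2)[OF \<kappa>] in \<open>simp_all add: unit_eq_def\<close>)
  qed
qed

lemma case_ii_gauge:
  assumes "unit_douglas c"
  shows "case_ii A a0 b0 a0 b0"
proof -
  interpret G: manifold_pair A a0 b0 by (rule manifold_pair_gauge)
  have N1: "form_norm (a0 \<kappa>) (b0 \<kappa>) x = 1" if "\<kappa> \<in> A" "x \<in> region \<kappa>" for \<kappa> x
    using unit_gauge[OF that] by (simp add: G.form_norm_N G.N_def)
  have u: "smooth_function A c" "\<And>\<kappa> x. \<kappa> \<in> A \<Longrightarrow> x \<in> region \<kappa> \<Longrightarrow> unit_eq (a0 \<kappa>) (b0 \<kappa>) x (c (point_of \<kappa> x))"
    using assms by (auto simp: unit_douglas_def)
  have "s_condition A a0 b0"
    unfolding G.s_condition_iff s_eq_def using u(2) by (simp add: unit_eq_def)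
  moreover have "r_tensor (a0 \<kappa>) (b0 \<kappa>) x i j = c (point_of \<kappa> x) *
      ((form_norm (a0 \<kappa>) (b0 \<kappa>) x)\<^sup>2 * a0 \<kappa> x $ i $ j - b0 \<kappa> x $ i * b0 \<kappa> x $ j)"
    if "\<kappa> \<in> A" "x \<in> region \<kappa>" for \<kappa> x i j
    using u(2)[OF that] smooth_pair.r_tensor_eq[OF G.pair[OF that(1)] that(2), of i j] N1[OF that]
    by (simp add: unit_eq_def inner_axis)
  ultimately show ?thesis
    unfolding case_ii_def using G.metric G.form G.nonzero N1 u(1) by auto
qed

end

section \<open>The two normal forms\<close>

lemma powi_sqrt:
  assumes "x > 0"
  shows "sqrt x powi (-8) = 1 / x ^ 4" "sqrt x powi (-2) = 1 / x" "sqrt x powi (-3) = 1 / (x * sqrt x)"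
proof -
  obtain r where "r > 0" "x = r\<^sup>2" "sqrt x = r"
    using assms by (metis real_sqrt_gt_zero real_sqrt_pow2 less_imp_le)
  then show "sqrt x powi (-8) = 1 / x ^ 4" "sqrt x powi (-2) = 1 / x" "sqrt x powi (-3) = 1 / (x * sqrt x)"
    by (simp_all add: power_int_def inverse_eq_divide eval_nat_numeral)
qed

lemma polarization:
  assumes "transpose M = M" "transpose M' = M'"
    and "\<And>y. bil M y y = p * bil M' y y + q * (v \<bullet> y)\<^sup>2"
  shows "bil M h k = p * bil M' h k + q * (v \<bullet> h) * (v \<bullet> k)"
  using assms(3)[of "h + k"] assms(3)[of h] assms(3)[of k] bil_commute[OF assms(1), of k h] bil_commute[OF assms(2), of k h]
  by (simp add: power2_eq_square inner_add_right algebra_simps)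

context smooth_pair
begin

text \<open>\<open>M (w B) = u b\<close>, so \<open>u b\<close> is raised to \<open>w B\<close>.
  Unlike \<open>raised_deformed\<close> this concerns a single matrix, and so applies before the new
  pair is known to be nowhere vanishing.\<close>

lemma deformed_norm:
  assumes x: "x \<in> V" and "\<And>h k. bil M h k = p * bil (a x) h k + q * (b x \<bullet> h) * (b x \<bullet> k)"
    and M: "transpose M = M" "invertible M"
    and uw: "u = w * (p + q * N x)"
  shows "(u *\<^sub>R b x) \<bullet> (matrix_inv M *v (u *\<^sub>R b x)) = u * w * N x"
proof -
  have "h \<bullet> (M *v (w *\<^sub>R B x)) = h \<bullet> (u *\<^sub>R b x)" for h
    using assms(2)[of h "w *\<^sub>R B x"] x by (simp add: bil_def[symmetric] uw algebra_simps inner_commute)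
  then have "M *v (w *\<^sub>R B x) = u *\<^sub>R b x"
    using vector_eq_ldot by metis
  then have "matrix_inv M *v (u *\<^sub>R b x) = w *\<^sub>R B x"
    using matrix_inv_right_left(2)[OF M(2)] by (metis matrix_vector_mul_assoc matrix_vector_mul_lid)
  then show ?thesis by simp
qed

end

locale bar_pair = P: manifold_pair A a' b'
  for A :: "('m::{t2_space, second_countable_topology}, 'n::finite) chart set" and a' b' +
  fixes a :: "('m, 'n) chart \<Rightarrow> real^'n \<Rightarrow> real^'n^'n"
    and b :: "('m, 'n) chart \<Rightarrow> real^'n \<Rightarrow> real^'n" and F
  assumes square: "singular_square_metric A a b F"
begin

lemma sym: "\<kappa> \<in> A \<Longrightarrow> x \<in> region \<kappa> \<Longrightarrow> transpose (a \<kappa> x) = a \<kappa> x"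
  using square by (auto simp: singular_square_metric_def riemannian_metric_def)

lemma sym': "\<kappa> \<in> A \<Longrightarrow> x \<in> region \<kappa> \<Longrightarrow> transpose (a' \<kappa> x) = a' \<kappa> x"
  using smooth_pair.sym_a[OF P.pair] .

lemma pos: "\<kappa> \<in> A \<Longrightarrow> x \<in> region \<kappa> \<Longrightarrow> y \<noteq> 0 \<Longrightarrow> bil (a \<kappa> x) y y > 0"
  using square by (auto simp: singular_square_metric_def riemannian_metric_def bil_def)

lemma invertible: "\<kappa> \<in> A \<Longrightarrow> x \<in> region \<kappa> \<Longrightarrow> invertible (a \<kappa> x)"
proof -
  assume "\<kappa> \<in> A" "x \<in> region \<kappa>"
  then have "a \<kappa> x *v y = 0 \<Longrightarrow> y = 0" for y
    using pos[of \<kappa> x y] by (auto simp: bil_def)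
  then show ?thesis
    by (metis invertible_left_inverse matrix_left_invertible_ker)
qed

lemma F_eq: "\<kappa> \<in> A \<Longrightarrow> x \<in> region \<kappa> \<Longrightarrow> y \<noteq> 0 \<Longrightarrow> F \<kappa> x y =
    (form_norm (a \<kappa>) (b \<kappa>) x * metric_norm (a \<kappa>) x y + form_eval (b \<kappa>) x y)\<^sup>2 / metric_norm (a \<kappa>) x y"
  using square by (auto simp: singular_square_metric_def)

context
  fixes p q :: "('m, 'n) chart \<Rightarrow> real^'n \<Rightarrow> real"
  assumes a_eq: "\<And>\<kappa> x h k. \<kappa> \<in> A \<Longrightarrow> x \<in> region \<kappa> \<Longrightarrow>
      bil (a \<kappa> x) h k = p \<kappa> x * bil (a' \<kappa> x) h k + q \<kappa> x * (b' \<kappa> x \<bullet> h) * (b' \<kappa> x \<bullet> k)"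
    and b_eq: "\<And>\<kappa> x. \<kappa> \<in> A \<Longrightarrow> x \<in> region \<kappa> \<Longrightarrow> b \<kappa> x = (1 / (P.N \<kappa> x * sqrt (P.N \<kappa> x))) *\<^sub>R b' \<kappa> x"
    and pq: "\<And>\<kappa> x. \<kappa> \<in> A \<Longrightarrow> x \<in> region \<kappa> \<Longrightarrow> p \<kappa> x + q \<kappa> x * P.N \<kappa> x = 1 / (P.N \<kappa> x) ^ 3"
begin

lemma manifold_pair_ab: "manifold_pair A a b"
proof
  show "nowhere_vanishing A b"
    using P.nonzero P.N_pos b_eq by (fastforce simp: nowhere_vanishing_def)
qed (use square P.atlas in \<open>simp_all add: singular_square_metric_def\<close>)

text \<open>\<open>pq\<close> is what the two cases have in common: it forces
  \<open>w = N^(3/2)\<close>, the reciprocal of the factor \<open>u\<close> of \<beta>, so that the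
  new squared norm \<open>u w N\<close> is again \<open>N\<close>.\<close>

lemma N_eq: "\<kappa> \<in> A \<Longrightarrow> x \<in> region \<kappa> \<Longrightarrow> b \<kappa> x \<bullet> raised (a \<kappa>) (b \<kappa>) x = P.N \<kappa> x"
proof -
  assume *: "\<kappa> \<in> A" "x \<in> region \<kappa>"
  obtain r where r: "r > 0" "P.N \<kappa> x = r\<^sup>2" "sqrt (r\<^sup>2) = r"
    using P.N_pos[OF *] by (metis real_sqrt_gt_zero real_sqrt_pow2 less_imp_le)
  have "b \<kappa> x \<bullet> raised (a \<kappa>) (b \<kappa>) x = 1 / r ^ 3 * r ^ 3 * P.N \<kappa> x"
    unfolding raised_def b_eq[OF *]
    by (subst smooth_pair.deformed_norm[OF P.pair[OF *(1)] *(2) a_eq[OF *] sym[OF *] invertible[OF *], where w="r ^ 3"])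
      (use r pq[OF *] in \<open>simp_all add: P.N_def field_simps eval_nat_numeral\<close>)
  then show ?thesis using r by simp
qed

lemma form_norm_eq: "\<kappa> \<in> A \<Longrightarrow> x \<in> region \<kappa> \<Longrightarrow> form_norm (a' \<kappa>) (b' \<kappa>) x = form_norm (a \<kappa>) (b \<kappa>) x"
  using N_eq[of \<kappa> x] by (simp add: P.N_def form_norm_inner)

text \<open>The deformation of either case composed with the unit gauge, which contributes
  \<open>N^2\<close> to \<open>p\<close> and \<open>q\<close> and \<open>sqrt N\<close> to the
  factor of \<beta>.\<close>

lemma deformation_ab:
  assumes \<kappa>: "\<kappa> \<in> A"
    and p': "\<And>x. x \<in> region \<kappa> \<Longrightarrow> p' x = (P.N \<kappa> x)\<^sup>2 * p \<kappa> x"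
    and q': "\<And>x. x \<in> region \<kappa> \<Longrightarrow> q' x = (P.N \<kappa> x)\<^sup>2 * q \<kappa> x"
  shows "deformation (region \<kappa>) (a' \<kappa>) (b' \<kappa>) (manifold_pair.a0 a b \<kappa>) (manifold_pair.b0 a b \<kappa>)
     p' q' (\<lambda>x. 1 / (b' \<kappa> x \<bullet> raised (a' \<kappa>) (b' \<kappa>) x)) (\<lambda>x. 1)"
proof -
  interpret M: manifold_pair A a b by (rule manifold_pair_ab)
  show ?thesis
  proof (intro deformation.intro P.pair[OF \<kappa>] manifold_pair.pair[OF M.manifold_pair_gauge \<kappa>] deformation_axioms.intro)
    fix x assume x: "x \<in> region \<kappa>"
    obtain r where r: "r > 0" "P.N \<kappa> x = r\<^sup>2" "sqrt (r\<^sup>2) = r"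
      using P.N_pos[OF \<kappa> x] by (metis real_sqrt_gt_zero real_sqrt_pow2 less_imp_le)
    have N: "M.N \<kappa> x = P.N \<kappa> x" using N_eq[OF \<kappa> x] by (simp add: M.N_def)
    show "bil (M.a0 \<kappa> x) h k = p' x * bil (a' \<kappa> x) h k + q' x * (b' \<kappa> x \<bullet> h) * (b' \<kappa> x \<bullet> k)" for h k
      by (simp add: M.a0_def N a_eq[OF \<kappa> x] p'[OF x] q'[OF x] algebra_simps)
    show "M.b0 \<kappa> x = (1 / (b' \<kappa> x \<bullet> raised (a' \<kappa>) (b' \<kappa>) x)) *\<^sub>R b' \<kappa> x"
      using r by (simp add: M.b0_def N b_eq[OF \<kappa> x] P.N_def[symmetric])
    have "p' x + q' x * P.N \<kappa> x = (P.N \<kappa> x)\<^sup>2 * (p \<kappa> x + q \<kappa> x * P.N \<kappa> x)"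
      by (simp add: p'[OF x] q'[OF x] algebra_simps)
    also have "\<dots> = 1 / P.N \<kappa> x"
      unfolding pq[OF \<kappa> x] using P.N_pos[OF \<kappa> x] by (simp add: field_simps eval_nat_numeral)
    finally show "1 / (b' \<kappa> x \<bullet> raised (a' \<kappa>) (b' \<kappa>) x) = 1 * (p' x + q' x * (b' \<kappa> x \<bullet> raised (a' \<kappa>) (b' \<kappa>) x))"
      by (simp add: P.N_def)
  qed
qed

end

end

lemma bar_pairI:
  assumes "smooth_atlas A" "singular_square_metric A a b F"
    and "riemannian_metric A a'" "one_form A b'" "nowhere_vanishing A b'"
  shows "bar_pair A a' b' a b F"
  using assms by (simp add: bar_pair_def bar_pair_axioms_def manifold_pair_def)

section \<open>Cases (i) and (ii): components, Douglas property and formula for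
  \<open>F\<close>\<close>

context bar_pair
begin

lemma case_i_components:
  assumes "case_i A a b a' b'" and *: "\<kappa> \<in> A" "x \<in> region \<kappa>"
  shows "bil (a \<kappa> x) h k = 1 * bil (a' \<kappa> x) h k
      + (1 / (P.N \<kappa> x) ^ 4 - 1 / P.N \<kappa> x) * (b' \<kappa> x \<bullet> h) * (b' \<kappa> x \<bullet> k)"
    and "b \<kappa> x = (1 / (P.N \<kappa> x * sqrt (P.N \<kappa> x))) *\<^sub>R b' \<kappa> x"
proof -
  note N = P.N_pos[OF *]
  have "sqrt (bil (a \<kappa> x) y y) = sqrt (bil (a' \<kappa> x) y y + (1 / (P.N \<kappa> x) ^ 4 - 1 / P.N \<kappa> x) * (b' \<kappa> x \<bullet> y)\<^sup>2)" for y
    using assms smooth_pair.bil_nonneg[OF P.pair[OF *(1)] *(2), of y]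
    by (simp add: case_i_def metric_norm_bil form_eval_inner P.form_norm_N powi_sqrt[OF N])
  \<comment> \<open>\<open>sqrt\<close> is injective on all reals, so the radicands agree whatever
    their signs.\<close>
  then have "bil (a \<kappa> x) y y = 1 * bil (a' \<kappa> x) y y + (1 / (P.N \<kappa> x) ^ 4 - 1 / P.N \<kappa> x) * (b' \<kappa> x \<bullet> y)\<^sup>2" for y
    by simp
  then show "bil (a \<kappa> x) h k = 1 * bil (a' \<kappa> x) h k
      + (1 / (P.N \<kappa> x) ^ 4 - 1 / P.N \<kappa> x) * (b' \<kappa> x \<bullet> h) * (b' \<kappa> x \<bullet> k)"
    by (rule polarization[OF sym[OF *] sym'[OF *]])
  have "b \<kappa> x \<bullet> y = ((1 / (P.N \<kappa> x * sqrt (P.N \<kappa> x))) *\<^sub>R b' \<kappa> x) \<bullet> y" for y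
    using assms by (simp add: case_i_def form_eval_inner P.form_norm_N powi_sqrt[OF N])
  then show "b \<kappa> x = (1 / (P.N \<kappa> x * sqrt (P.N \<kappa> x))) *\<^sub>R b' \<kappa> x"
    using vector_eq_rdot by blast
qed

lemma case_i_factor: "\<kappa> \<in> A \<Longrightarrow> x \<in> region \<kappa> \<Longrightarrow>
    1 + (1 / (P.N \<kappa> x) ^ 4 - 1 / P.N \<kappa> x) * P.N \<kappa> x = 1 / (P.N \<kappa> x) ^ 3"
  using P.N_pos[of \<kappa> x] by (simp add: field_simps eval_nat_numeral)

lemma case_i_form_norm:
  "case_i A a b a' b' \<Longrightarrow> \<kappa> \<in> A \<Longrightarrow> x \<in> region \<kappa> \<Longrightarrow>
     form_norm (a' \<kappa>) (b' \<kappa>) x = form_norm (a \<kappa>) (b \<kappa>) x"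
  by (rule form_norm_eq[of "\<lambda>\<kappa> x. 1", OF case_i_components case_i_factor])

lemma case_i_manifold_pair: "case_i A a b a' b' \<Longrightarrow> manifold_pair A a b"
  by (rule manifold_pair_ab[of "\<lambda>\<kappa> x. 1", OF case_i_components case_i_factor])

lemma case_i_unit_douglas:
  assumes i: "case_i A a b a' b'"
  shows "\<exists>c. manifold_pair.unit_douglas A a b c"
proof -
  interpret M: manifold_pair A a b by (rule case_i_manifold_pair[OF i])
  obtain \<tau> where \<tau>: "smooth_function A \<tau>" "\<And>\<kappa> x i j. \<kappa> \<in> A \<Longrightarrow> x \<in> region \<kappa> \<Longrightarrow>
      r_tensor (a' \<kappa>) (b' \<kappa>) x i j = \<tau> (point_of \<kappa> x) * a' \<kappa> x $ i $ j"
    using i unfolding case_i_def by blast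
  have "unit_eq (M.a0 \<kappa>) (M.b0 \<kappa>) x (3 * \<tau> (point_of \<kappa> x))" if *: "\<kappa> \<in> A" "x \<in> region \<kappa>" for \<kappa> x
  proof (rule gauge_i.unit_eq_i[OF _ *(2)])
    show "gauge_i (region \<kappa>) (a' \<kappa>) (b' \<kappa>) (M.a0 \<kappa>) (M.b0 \<kappa>)"
      unfolding gauge_i_def
      by (rule deformation_ab[of "\<lambda>\<kappa> x. 1", OF case_i_components[OF i] case_i_factor *(1)])
        (use P.N_pos[OF *(1)] in \<open>simp_all add: P.N_def[symmetric] field_simps eval_nat_numeral\<close>)
    show "s_eq (a' \<kappa>) (b' \<kappa>) x"
      using i * P.s_condition_iff by (simp add: case_i_def)
    show "r_eq (a' \<kappa>) (b' \<kappa>) x (\<tau> (point_of \<kappa> x)) 0 0"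
      using smooth_pair.r_tensor_iff[OF P.pair[OF *(1)] *(2), of "\<tau> (point_of \<kappa> x)" 0 0] \<tau>(2)[OF *]
      by (simp add: r_eq_def)
  qed
  moreover have "smooth_function A (\<lambda>m. 3 * \<tau> m)"
    unfolding smooth_function_def o_def
    by (intro ballI smooth_on_mult smooth_on_const P.open_region P.smooth_functionD[OF \<tau>(1)])
  ultimately show ?thesis unfolding M.unit_douglas_def by blast
qed

lemma case_i_F:
  assumes i: "case_i A a b a' b'" and *: "\<kappa> \<in> A" "x \<in> region \<kappa>" and y: "y \<noteq> 0"
  defines "bn \<equiv> form_norm (a' \<kappa>) (b' \<kappa>) x" and "al \<equiv> metric_norm (a' \<kappa>) x y" and "be \<equiv> form_eval (b' \<kappa>) x y"
  defines "rt \<equiv> sqrt (bn ^ 6 * (bn\<^sup>2 * al\<^sup>2 - be\<^sup>2) + be\<^sup>2)"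
  shows "F \<kappa> x y = (rt + be)\<^sup>2 / (bn\<^sup>2 * rt)"
proof -
  obtain r where r: "r > 0" "P.N \<kappa> x = r\<^sup>2" "sqrt (r\<^sup>2) = r"
    using P.N_pos[OF *] by (metis real_sqrt_gt_zero real_sqrt_pow2 less_imp_le)
  define s where "s = sqrt (bil (a \<kappa> x) y y)"
  have s: "s > 0" using pos[OF * y] by (simp add: s_def)
  have bn: "bn = r" by (simp only: bn_def P.form_norm_N r(2,3))
  have al: "al\<^sup>2 = bil (a' \<kappa> x) y y"
    using smooth_pair.bil_nonneg[OF P.pair[OF *(1)] *(2), of y] by (simp add: al_def metric_norm_bil)
  have "s\<^sup>2 = al\<^sup>2 + (1 / r ^ 8 - 1 / r\<^sup>2) * be\<^sup>2"
    using case_i_components(1)[OF i *, of y y] pos[OF * y] r(2) al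
    by (simp add: s_def be_def form_eval_inner power2_eq_square eval_nat_numeral)
  \<comment> \<open>Multiplying \<open>\<alpha>^2\<close> by \<open>b^8\<close> clears both
    denominators, which is where the exponents 6 and 2 under the root come from.\<close>
  then have "bn ^ 6 * (bn\<^sup>2 * al\<^sup>2 - be\<^sup>2) + be\<^sup>2 = (r ^ 4 * s)\<^sup>2"
    using r(1) by (simp add: bn power_mult_distrib field_simps eval_nat_numeral)
  then have rt: "rt = r ^ 4 * s" using r(1) s by (simp add: rt_def)
  have be: "form_eval (b \<kappa>) x y = be / r ^ 3"
    unfolding form_eval_inner case_i_components(2)[OF i *] be_def r(2) r(3) by (simp add: eval_nat_numeral)
  have "F \<kappa> x y = (r * s + be / r ^ 3)\<^sup>2 / s"
    unfolding F_eq[OF * y] case_i_form_norm[OF i *, symmetric] be metric_norm_bil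
    by (simp add: bn[unfolded bn_def] s_def)
  also have "\<dots> = (rt + be)\<^sup>2 / (bn\<^sup>2 * rt)"
    using r(1) s by (simp add: rt bn field_simps eval_nat_numeral)
  finally show ?thesis .
qed

lemma case_ii_components:
  assumes "case_ii A a b a' b'" and *: "\<kappa> \<in> A" "x \<in> region \<kappa>"
  shows "bil (a \<kappa> x) h k = 1 / (P.N \<kappa> x) ^ 3 * bil (a' \<kappa> x) h k + 0 * (b' \<kappa> x \<bullet> h) * (b' \<kappa> x \<bullet> k)"
    and "b \<kappa> x = (1 / (P.N \<kappa> x * sqrt (P.N \<kappa> x))) *\<^sub>R b' \<kappa> x"
proof -
  note N = P.N_pos[OF *]
  have "sqrt (bil (a \<kappa> x) y y) = sqrt (1 / (P.N \<kappa> x) ^ 3 * bil (a' \<kappa> x) y y)" for y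
  proof -
    have s: "sqrt (1 / (P.N \<kappa> x) ^ 3) = 1 / (P.N \<kappa> x * sqrt (P.N \<kappa> x))"
      using N by (simp add: real_sqrt_divide power3_eq_cube real_sqrt_mult)
    show ?thesis
      unfolding real_sqrt_mult s
      using assms by (simp add: case_ii_def metric_norm_bil P.form_norm_N powi_sqrt[OF N])
  qed
  then have "bil (a \<kappa> x) y y = 1 / (P.N \<kappa> x) ^ 3 * bil (a' \<kappa> x) y y + 0 * (b' \<kappa> x \<bullet> y)\<^sup>2" for y
    by simp
  then show "bil (a \<kappa> x) h k = 1 / (P.N \<kappa> x) ^ 3 * bil (a' \<kappa> x) h k + 0 * (b' \<kappa> x \<bullet> h) * (b' \<kappa> x \<bullet> k)"
    by (rule polarization[OF sym[OF *] sym'[OF *]])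
  have "b \<kappa> x \<bullet> y = ((1 / (P.N \<kappa> x * sqrt (P.N \<kappa> x))) *\<^sub>R b' \<kappa> x) \<bullet> y" for y
    using assms by (simp add: case_ii_def form_eval_inner P.form_norm_N powi_sqrt[OF N])
  then show "b \<kappa> x = (1 / (P.N \<kappa> x * sqrt (P.N \<kappa> x))) *\<^sub>R b' \<kappa> x"
    using vector_eq_rdot by blast
qed

lemma case_ii_factor: "1 / (P.N \<kappa> x) ^ 3 + 0 * P.N \<kappa> x = 1 / (P.N \<kappa> x) ^ 3"
  by simp

lemma case_ii_form_norm:
  "case_ii A a b a' b' \<Longrightarrow> \<kappa> \<in> A \<Longrightarrow> x \<in> region \<kappa> \<Longrightarrow>
     form_norm (a' \<kappa>) (b' \<kappa>) x = form_norm (a \<kappa>) (b \<kappa>) x"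
  by (rule form_norm_eq[of "\<lambda>\<kappa> x. 1 / (P.N \<kappa> x) ^ 3" "\<lambda>\<kappa> x. 0", OF case_ii_components case_ii_factor])

lemma case_ii_manifold_pair: "case_ii A a b a' b' \<Longrightarrow> manifold_pair A a b"
  by (rule manifold_pair_ab[of "\<lambda>\<kappa> x. 1 / (P.N \<kappa> x) ^ 3" "\<lambda>\<kappa> x. 0", OF case_ii_components case_ii_factor])

lemma case_ii_unit_douglas:
  assumes ii: "case_ii A a b a' b'"
  shows "\<exists>c. manifold_pair.unit_douglas A a b c"
proof -
  interpret M: manifold_pair A a b by (rule case_ii_manifold_pair[OF ii])
  obtain \<tau> where \<tau>: "smooth_function A \<tau>" "\<And>\<kappa> x i j. \<kappa> \<in> A \<Longrightarrow> x \<in> region \<kappa> \<Longrightarrow>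
      r_tensor (a' \<kappa>) (b' \<kappa>) x i j = \<tau> (point_of \<kappa> x) *
        ((form_norm (a' \<kappa>) (b' \<kappa>) x)\<^sup>2 * a' \<kappa> x $ i $ j - b' \<kappa> x $ i * b' \<kappa> x $ j)"
    using ii unfolding case_ii_def by blast
  obtain n where n: "smooth_function A n" "\<forall>\<kappa>\<in>A. \<forall>x\<in>region \<kappa>. n (point_of \<kappa> x) = P.N \<kappa> x"
    using P.glue[of P.N] P.smooth_N P.N_transition by blast
  have "unit_eq (M.a0 \<kappa>) (M.b0 \<kappa>) x (\<tau> (point_of \<kappa> x) * n (point_of \<kappa> x))"
    if *: "\<kappa> \<in> A" "x \<in> region \<kappa>" for \<kappa> x
  proof -
    have "unit_eq (M.a0 \<kappa>) (M.b0 \<kappa>) x (\<tau> (point_of \<kappa> x) * (b' \<kappa> x \<bullet> raised (a' \<kappa>) (b' \<kappa>) x))"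
    proof (rule gauge_ii.unit_eq_ii[OF _ *(2)])
      show "gauge_ii (region \<kappa>) (a' \<kappa>) (b' \<kappa>) (M.a0 \<kappa>) (M.b0 \<kappa>)"
        unfolding gauge_ii_def
        by (rule deformation_ab[of _ "\<lambda>\<kappa> x. 0", OF case_ii_components[OF ii] case_ii_factor *(1)])
          (use P.N_pos[OF *(1)] in \<open>simp_all add: P.N_def[symmetric] field_simps eval_nat_numeral\<close>)
      show "s_eq (a' \<kappa>) (b' \<kappa>) x"
        using ii * P.s_condition_iff by (simp add: case_ii_def)
      show "r_eq (a' \<kappa>) (b' \<kappa>) x (\<tau> (point_of \<kappa> x) * (b' \<kappa> x \<bullet> raised (a' \<kappa>) (b' \<kappa>) x)) (- \<tau> (point_of \<kappa> x)) 0"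
        using smooth_pair.r_tensor_iff[OF P.pair[OF *(1)] *(2), of
            "\<tau> (point_of \<kappa> x) * (b' \<kappa> x \<bullet> raised (a' \<kappa>) (b' \<kappa>) x)" "- \<tau> (point_of \<kappa> x)" 0]
          \<tau>(2)[OF *] smooth_pair.form_norm_sq[OF P.pair[OF *(1)] *(2)]
        by (simp add: r_eq_def algebra_simps)
    qed
    then show ?thesis using n(2) * by (simp add: P.N_def)
  qed
  moreover have "smooth_function A (\<lambda>m. \<tau> m * n m)"
    unfolding smooth_function_def o_def
    by (intro ballI smooth_on_mult P.open_region P.smooth_functionD[OF \<tau>(1)] P.smooth_functionD[OF n(1)])
  ultimately show ?thesis unfolding M.unit_douglas_def by blast
qed

lemma case_ii_F:
  assumes ii: "case_ii A a b a' b'" and *: "\<kappa> \<in> A" "x \<in> region \<kappa>" and y: "y \<noteq> 0"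
  defines "bn \<equiv> form_norm (a' \<kappa>) (b' \<kappa>) x" and "al \<equiv> metric_norm (a' \<kappa>) x y" and "be \<equiv> form_eval (b' \<kappa>) x y"
  shows "F \<kappa> x y = (bn * al + be)\<^sup>2 / (bn ^ 3 * al)"
proof -
  obtain r where r: "r > 0" "P.N \<kappa> x = r\<^sup>2" "sqrt (r\<^sup>2) = r"
    using P.N_pos[OF *] by (metis real_sqrt_gt_zero real_sqrt_pow2 less_imp_le)
  have bn: "bn = r" by (simp only: bn_def P.form_norm_N r(2,3))
  have al: "al > 0"
    using smooth_pair.pos_a[OF P.pair[OF *(1)] *(2) y] by (simp add: al_def metric_norm_bil)
  have "metric_norm (a \<kappa>) x y = al / r ^ 3" "form_eval (b \<kappa>) x y = be / r ^ 3"
    using ii * powi_sqrt(3)[OF P.N_pos[OF *]] r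
    by (simp_all add: case_ii_def P.form_norm_N al_def be_def eval_nat_numeral)
  then have "F \<kappa> x y = (r * (al / r ^ 3) + be / r ^ 3)\<^sup>2 / (al / r ^ 3)"
    using F_eq[OF * y] case_ii_form_norm[OF ii *] by (simp add: bn[unfolded bn_def])
  also have "\<dots> = (bn * al + be)\<^sup>2 / (bn ^ 3 * al)"
    using r(1) al by (simp add: bn field_simps eval_nat_numeral)
  finally show ?thesis .
qed

end

theorem theorem1p2:
  fixes A :: "('m::{t2_space, second_countable_topology}, 'n::finite) chart set"
    and a :: "('m, 'n) chart \<Rightarrow> real^'n \<Rightarrow> real^'n^'n"
    and b :: "('m, 'n) chart \<Rightarrow> real^'n \<Rightarrow> real^'n"
    and F :: "('m, 'n) chart \<Rightarrow> real^'n \<Rightarrow> real^'n \<Rightarrow> real"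
  assumes "CARD('n) \<ge> 3"
    and "smooth_atlas A"
    and "singular_square_metric A a b F"
    and "nowhere_vanishing A b"
  shows
    "(douglas_metric A F \<longleftrightarrow>
       (\<exists>c d. smooth_function A c \<and> smooth_function A d \<and> douglas_equations A a b c d)) \<and>
     ((\<forall>c d. smooth_function A c \<and> smooth_function A d \<and> douglas_equations A a b c d \<longrightarrow>
         ratio_depends_on_norm A a b c d) \<longrightarrow>
      (douglas_metric A F \<longleftrightarrow>
        (\<exists>\<alpha> \<beta> \<alpha>' \<beta>'. singular_square_metric A \<alpha> \<beta> F \<and>
           (case_i A \<alpha> \<beta> \<alpha>' \<beta>' \<or> case_ii A \<alpha> \<beta> \<alpha>' \<beta>'))) \<and>
      (\<forall>\<alpha> \<beta> \<alpha>' \<beta>'. singular_square_metric A \<alpha> \<beta> F \<and> case_i A \<alpha> \<beta> \<alpha>' \<beta>' \<longrightarrow>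
         (\<forall>\<kappa>\<in>A. \<forall>x\<in>region \<kappa>.
            let bn = form_norm (\<alpha>' \<kappa>) (\<beta>' \<kappa>) x in
            bn = form_norm (\<alpha> \<kappa>) (\<beta> \<kappa>) x \<and>
            (\<forall>y. y \<noteq> 0 \<longrightarrow>
               (let al = metric_norm (\<alpha>' \<kappa>) x y; be = form_eval (\<beta>' \<kappa>) x y;
                    rt = sqrt (bn ^ 6 * (bn\<^sup>2 * al\<^sup>2 - be\<^sup>2) + be\<^sup>2)
                in F \<kappa> x y = (rt + be)\<^sup>2 / (bn\<^sup>2 * rt))))) \<and>
      (\<forall>\<alpha> \<beta> \<alpha>' \<beta>'. singular_square_metric A \<alpha> \<beta> F \<and> case_ii A \<alpha> \<beta> \<alpha>' \<beta>' \<longrightarrow>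
         (\<forall>\<kappa>\<in>A. \<forall>x\<in>region \<kappa>.
            let bn = form_norm (\<alpha>' \<kappa>) (\<beta>' \<kappa>) x in
            bn = form_norm (\<alpha> \<kappa>) (\<beta> \<kappa>) x \<and>
            (\<forall>y. y \<noteq> 0 \<longrightarrow>
               (let al = metric_norm (\<alpha>' \<kappa>) x y; be = form_eval (\<beta>' \<kappa>) x y
                in F \<kappa> x y = (bn * al + be)\<^sup>2 / (bn ^ 3 * al))))))"
proof -
  interpret M: manifold_pair A a b
    using assms(2-4) by (simp add: manifold_pair_def singular_square_metric_def)
  have bar_i: "bar_pair A \<alpha>' \<beta>' \<alpha> \<beta> F"
    if "singular_square_metric A \<alpha> \<beta> F" "case_i A \<alpha> \<beta> \<alpha>' \<beta>'" for \<alpha> \<beta> \<alpha>' \<beta>'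
    using that assms(2) by (intro bar_pairI) (simp_all add: case_i_def)
  have bar_ii: "bar_pair A \<alpha>' \<beta>' \<alpha> \<beta> F"
    if "singular_square_metric A \<alpha> \<beta> F" "case_ii A \<alpha> \<beta> \<alpha>' \<beta>'" for \<alpha> \<beta> \<alpha>' \<beta>'
    using that assms(2) by (intro bar_pairI) (simp_all add: case_ii_def)
  note douglas = M.douglas_metric_unit[OF assms(3,1)]
  have eqs: "douglas_metric A F \<longleftrightarrow>
       (\<exists>c d. smooth_function A c \<and> smooth_function A d \<and> douglas_equations A a b c d)"
    unfolding douglas M.douglas_equations_unit ..
  have reduction: "douglas_metric A F \<longleftrightarrow>
        (\<exists>\<alpha> \<beta> \<alpha>' \<beta>'. singular_square_metric A \<alpha> \<beta> F \<and>
           (case_i A \<alpha> \<beta> \<alpha>' \<beta>' \<or> case_ii A \<alpha> \<beta> \<alpha>' \<beta>'))"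
  proof
    assume "douglas_metric A F"
    then show "\<exists>\<alpha> \<beta> \<alpha>' \<beta>'. singular_square_metric A \<alpha> \<beta> F \<and>
           (case_i A \<alpha> \<beta> \<alpha>' \<beta>' \<or> case_ii A \<alpha> \<beta> \<alpha>' \<beta>')"
      using douglas M.case_ii_gauge M.singular_square_gauge(1)[OF assms(3)] by blast
  next
    assume "\<exists>\<alpha> \<beta> \<alpha>' \<beta>'. singular_square_metric A \<alpha> \<beta> F \<and>
           (case_i A \<alpha> \<beta> \<alpha>' \<beta>' \<or> case_ii A \<alpha> \<beta> \<alpha>' \<beta>')"
    then obtain \<alpha> \<beta> \<alpha>' \<beta>' where s: "singular_square_metric A \<alpha> \<beta> F"
      and "case_i A \<alpha> \<beta> \<alpha>' \<beta>' \<or> case_ii A \<alpha> \<beta> \<alpha>' \<beta>'" by blast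
    then consider "case_i A \<alpha> \<beta> \<alpha>' \<beta>'" | "case_ii A \<alpha> \<beta> \<alpha>' \<beta>'" by blast
    then show "douglas_metric A F"
    proof cases
      case 1
      \<comment> \<open>The reduced pair may differ from \<open>(a, b)\<close>, but it has the same
        \<open>F\<close>, so the criterion is applied to it and to its own unit gauge.\<close>
      note B = bar_i[OF s 1]
      show ?thesis
        using manifold_pair.douglas_metric_unit[OF bar_pair.case_i_manifold_pair[OF B 1] s assms(1)]
          bar_pair.case_i_unit_douglas[OF B 1] by blast
    next
      case 2
      note B = bar_ii[OF s 2]
      show ?thesis
        using manifold_pair.douglas_metric_unit[OF bar_pair.case_ii_manifold_pair[OF B 2] s assms(1)]
          bar_pair.case_ii_unit_douglas[OF B 2] by blast
    qed
  qed
  have formula_i: "\<forall>\<alpha> \<beta> \<alpha>' \<beta>'. singular_square_metric A \<alpha> \<beta> F \<and> case_i A \<alpha> \<beta> \<alpha>' \<beta>' \<longrightarrow>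
         (\<forall>\<kappa>\<in>A. \<forall>x\<in>region \<kappa>.
            let bn = form_norm (\<alpha>' \<kappa>) (\<beta>' \<kappa>) x in
            bn = form_norm (\<alpha> \<kappa>) (\<beta> \<kappa>) x \<and>
            (\<forall>y. y \<noteq> 0 \<longrightarrow>
               (let al = metric_norm (\<alpha>' \<kappa>) x y; be = form_eval (\<beta>' \<kappa>) x y;
                    rt = sqrt (bn ^ 6 * (bn\<^sup>2 * al\<^sup>2 - be\<^sup>2) + be\<^sup>2)
                in F \<kappa> x y = (rt + be)\<^sup>2 / (bn\<^sup>2 * rt))))"
    unfolding Let_def
    by (intro allI impI ballI conjI; elim conjE;
        rule bar_pair.case_i_form_norm[OF bar_i] bar_pair.case_i_F[OF bar_i]; assumption)
  have formula_ii: "\<forall>\<alpha> \<beta> \<alpha>' \<beta>'. singular_square_metric A \<alpha> \<beta> F \<and> case_ii A \<alpha> \<beta> \<alpha>' \<beta>' \<longrightarrow>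
         (\<forall>\<kappa>\<in>A. \<forall>x\<in>region \<kappa>.
            let bn = form_norm (\<alpha>' \<kappa>) (\<beta>' \<kappa>) x in
            bn = form_norm (\<alpha> \<kappa>) (\<beta> \<kappa>) x \<and>
            (\<forall>y. y \<noteq> 0 \<longrightarrow>
               (let al = metric_norm (\<alpha>' \<kappa>) x y; be = form_eval (\<beta>' \<kappa>) x y
                in F \<kappa> x y = (bn * al + be)\<^sup>2 / (bn ^ 3 * al))))"
    unfolding Let_def
    by (intro allI impI ballI conjI; elim conjE;
        rule bar_pair.case_ii_form_norm[OF bar_ii] bar_pair.case_ii_F[OF bar_ii]; assumption)
  show ?thesis
    by (intro conjI impI eqs reduction formula_i formula_ii)
qed

end
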